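(* Let $l \in \{1,\ldots,m+2\}$ and let $\Sigma \subseteq \mathbb{R}^n$ be an $m$-fine set. If $\mathcal{E}_p^l(\Sigma) \le E < \infty$ for some $p > ml$, then there exists $R_0 = R_0(E,m,l,p) > 0$, depending only on $E$, $m$, $l$ and $p$ (and not otherwise on $\Sigma$), such that for all $x \in \Sigma$ and all $0 < r \le R_0$ $$\mathcal{H}^m(\Sigma \cap \mathbb{B}(x,r)) \ge \left( \tfrac{\sqrt{15}}{4} \right)^m \omega_m r^m,$$ where $\omega_m$ is the $m$-dimensional measure of the unit ball in $\mathbb{R}^m$.
   Context: Here $1 \le m \le n$ are integers, $\mathcal{H}^s$ is the $s$-dimensional Hausdorff measure, $\mathbb{B}(x,r)$ and $\overline{\mathbb{B}}(x,r)$ are the open and closed balls in $\mathbb{R}^n$, $G(n,m)$ is the Grassmannian of $m$-dimensional linear subspaces of $\mathbb{R}^n$, and $\bigtriangleup(x_0,\ldots,x_k)$ is the convex hull of $\{x_0,\ldots,x_k\}$. For $x_0,\ldots,x_{m+1} \in \mathbb{R}^n$ set $$\mathcal{K}(x_0,\ldots,x_{m+1}) = \frac{\mathcal{H}^{m+1}(\bigtriangleup(x_0,\ldots,x_{m+1}))}{\mathrm{diam}(x_0,\ldots,x_{m+1})^{m+2}}$$ (with value $0$ if all points coincide). For $p>0$ and $l \in \{1,\ldots,m+2\}$, $$\mathcal{E}_p^l(\Sigma) = \int_{\Sigma^l} \sup_{x_l,\ldots,x_{m+1} \in \Sigma} \mathcal{K}(x_0,\ldots,x_{m+1})^p \, d\mathcal{H}^{ml}_{x_0,\ldots,x_{l-1}}$$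 (if $l=m+2$ there is no supremum). For $x\in\Sigma$, $r>0$, $$\beta_m^{\Sigma}(x,r) = \frac1r \inf_{H \in G(n,m)} \ \sup_{z \in \Sigma \cap \overline{\mathbb{B}}(x,r)} \mathrm{dist}(z, x+H),$$ $$\theta_m^{\Sigma}(x,r) = \frac1r \inf_{H \in G(n,m)} d_{\mathcal{H}}\big(\Sigma \cap \overline{\mathbb{B}}(x,r), (x+H)\cap \overline{\mathbb{B}}(x,r)\big),$$ where $d_{\mathcal{H}}(E,F) = \sup_{y\in E}\mathrm{dist}(y,F) + \sup_{y \in F}\mathrm{dist}(y,E)$. A set $\Sigma\subseteq\mathbb{R}^n$ is $m$-fine if it is $m$-dimensional, compact, and satisfies: (a) there exist $R_{\mathrm{Ahl}}, A_{\mathrm{Ahl}} > 0$ with $\mathcal{H}^m(\Sigma \cap \mathbb{B}(x,r)) \ge A_{\mathrm{Ahl}} r^m$ for all $x \in \Sigma$, $0<r \le R_{\mathrm{Ahl}}$; (b) there exist $R_{\theta\beta} > 0$, $M_{\theta\beta} > 1$ with $\theta_m^{\Sigma}(x,r) \le M_{\theta\beta}\, \beta_m^{\Sigma}(x,r)$ for all $x \in \Sigma$, $0<r \le R_{\theta\beta}$. *)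

theory Defs
  imports "HOL-Analysis.Analysis"
begin

section \<open>Euclidean spaces of all dimensions inside one inner product space\<close>

text \<open>
  The radius in the theorem may not depend on the dimension $n$ of the ambient space, so $n$ has
  to be quantified inside the formula and cannot be a type index. All the spaces $\mathbb{R}^n$
  are therefore realised as subspaces of one type, the finitely supported sequences with the
  $\ell^2$ inner product. (The type of polynomial mappings is not suitable: its library norm is
  the $\ell^1$ norm.) The construction can be iterated: finitely supported sequences of points,
  again with the $\ell^2$ norm, contain the Euclidean products $(\mathbb{R}^n)^l$.
\<close>

typedef (overloaded) 'a finseq = "{f :: nat \<Rightarrow> 'a::zero. finite {i. f i \<noteq> 0}}"
  morphisms coord Finseq
  by (rule exI[of _ "\<lambda>_. 0"]) simp

setup_lifting type_definition_finseq

lemma finite_support: "finite {i. coord x i \<noteq> 0}"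
  using coord[of x] by simp

lemma finseq_eqI: "(\<And>i. coord x i = coord y i) \<Longrightarrow> x = y"
  by (metis coord_inject ext)

instantiation finseq :: (real_vector) real_vector
begin

lift_definition zero_finseq :: "'a finseq" is "\<lambda>_. 0" by simp

lift_definition plus_finseq :: "'a finseq \<Rightarrow> 'a finseq \<Rightarrow> 'a finseq"
  is "\<lambda>f g i. f i + g i"
  subgoal for f g
    by (rule finite_subset[of _ "{i. f i \<noteq> 0} \<union> {i. g i \<noteq> 0}"]) auto
  done

lift_definition minus_finseq :: "'a finseq \<Rightarrow> 'a finseq \<Rightarrow> 'a finseq"
  is "\<lambda>f g i. f i - g i"
  subgoal for f g
    by (rule finite_subset[of _ "{i. f i \<noteq> 0} \<union> {i. g i \<noteq> 0}"]) auto
  done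

lift_definition uminus_finseq :: "'a finseq \<Rightarrow> 'a finseq"
  is "\<lambda>f i. - f i" by simp

lift_definition scaleR_finseq :: "real \<Rightarrow> 'a finseq \<Rightarrow> 'a finseq"
  is "\<lambda>c f i. c *\<^sub>R f i"
  subgoal for c f
    by (rule finite_subset[of _ "{i. f i \<noteq> 0}"]) auto
  done

instance
  by standard (transfer; auto simp: algebra_simps)+

end

lemma coord_simps [simp]:
  "coord 0 i = 0"
  "coord (x + y) i = coord x i + coord y i"
  "coord (x - y) i = coord x i - coord y i"
  "coord (- x) i = - coord x i"
  "coord (c *\<^sub>R x) i = c *\<^sub>R coord x i"
  by (transfer; simp)+

instantiation finseq :: (real_inner) real_inner
begin

definition inner_finseq :: "'a finseq \<Rightarrow> 'a finseq \<Rightarrow> real"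
  where "inner_finseq x y = (\<Sum>i | coord x i \<noteq> 0. coord x i \<bullet> coord y i)"

definition norm_finseq :: "'a finseq \<Rightarrow> real"
  where "norm_finseq x = sqrt (x \<bullet> x)"

definition dist_finseq :: "'a finseq \<Rightarrow> 'a finseq \<Rightarrow> real"
  where "dist_finseq x y = norm (x - y)"

definition sgn_finseq :: "'a finseq \<Rightarrow> 'a finseq"
  where "sgn_finseq x = x /\<^sub>R norm x"

definition uniformity_finseq :: "('a finseq \<times> 'a finseq) filter"
  where "uniformity_finseq = (INF e\<in>{0<..}. principal {(x, y :: 'a finseq). dist x y < e})"

definition open_finseq :: "'a finseq set \<Rightarrow> bool"
  where "open_finseq U \<longleftrightarrow> (\<forall>x\<in>U. \<forall>\<^sub>F (x', y) in uniformity. x' = x \<longrightarrow> y \<in> U)"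

lemma inner_finseq_on:
  assumes "finite S" "{i. coord x i \<noteq> 0} \<subseteq> S"
  shows "x \<bullet> y = (\<Sum>i\<in>S. coord x i \<bullet> coord (y :: 'a finseq) i)"
  unfolding inner_finseq_def using assms by (intro sum.mono_neutral_left) auto

instance
proof
  fix x y z :: "'a finseq" and r :: real and U :: "'a finseq set"
  show "dist x y = norm (x - y)"
    by (rule dist_finseq_def)
  show "sgn x = x /\<^sub>R norm x"
    by (rule sgn_finseq_def)
  show "uniformity = (INF e\<in>{0<..}. principal {(x, y :: 'a finseq). dist x y < e})"
    by (rule uniformity_finseq_def)
  show "open U = (\<forall>x\<in>U. \<forall>\<^sub>F (x', y) in uniformity. x' = x \<longrightarrow> y \<in> U)"
    by (rule open_finseq_def)
  show "norm x = sqrt (x \<bullet> x)"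
    by (rule norm_finseq_def)
  let ?S = "{i. coord x i \<noteq> 0} \<union> {i. coord y i \<noteq> 0}"
  have S: "finite ?S"
    using finite_support by auto
  show "x \<bullet> y = y \<bullet> x"
    using inner_finseq_on[OF S, of x y] inner_finseq_on[OF S, of y x]
    by (simp add: inner_commute)
  have "{i. coord (x + y) i \<noteq> 0} \<subseteq> ?S"
    by auto
  then show "(x + y) \<bullet> z = x \<bullet> z + y \<bullet> z"
    using inner_finseq_on[OF S, of x z] inner_finseq_on[OF S, of y z]
      inner_finseq_on[OF S, of "x + y" z]
    by (simp add: inner_add_left sum.distrib)
  have "{i. coord (r *\<^sub>R x) i \<noteq> 0} \<subseteq> ?S"
    by auto
  then show "(r *\<^sub>R x) \<bullet> y = r * (x \<bullet> y)"
    using inner_finseq_on[OF S, of x y] inner_finseq_on[OF S, of "r *\<^sub>R x" y]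
    by (simp add: sum_distrib_left)
  show "0 \<le> x \<bullet> x"
    unfolding inner_finseq_def by (intro sum_nonneg) simp
  show "x \<bullet> x = 0 \<longleftrightarrow> x = 0"
    unfolding inner_finseq_def
    by (subst sum_nonneg_eq_0_iff) (auto intro: finseq_eqI finite_support)
qed

end

definition Rn :: "nat \<Rightarrow> real finseq set"
  where "Rn n = {x. \<forall>i\<ge>n. coord x i = 0}"

lemma subspace_Rn: "subspace (Rn n)"
  by (auto simp: Rn_def subspace_def)

lemma norm_finseq_eq_L2_set:
  fixes x :: "'a::real_inner finseq"
  assumes "\<forall>i\<ge>n. coord x i = 0"
  shows "norm x = L2_set (\<lambda>i. norm (coord x i)) {..<n}"
proof -
  have "{i. coord x i \<noteq> 0} \<subseteq> {..<n}"
    using assms by (auto simp: not_le[symmetric])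
  then show ?thesis
    by (simp add: norm_eq_sqrt_inner[of x] inner_finseq_on[of "{..<n}"] L2_set_def
        power2_norm_eq_inner)
qed

definition finpower :: "nat \<Rightarrow> 'a::zero set \<Rightarrow> 'a finseq set"
  where "finpower l A = {y. (\<forall>i<l. coord y i \<in> A) \<and> (\<forall>i\<ge>l. coord y i = 0)}"


section \<open>Hausdorff measure\<close>

text \<open>
  The normalisation is the one for which the $m$-dimensional Hausdorff measure on an
  $m$-dimensional plane is Lebesgue measure. The cases of the gauge make the $0$-dimensional
  measure the counting measure (in Isabelle, \<open>0 powr 0 = 0\<close>).
\<close>

definition hausdorff_gauge :: "real \<Rightarrow> 'a::metric_space set \<Rightarrow> ennreal"
  where "hausdorff_gauge s C =
    (if C = {} then 0 else if s = 0 then 1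
     else ennreal (unit_ball_vol s * (diameter C / 2) powr s))"

text \<open>Boundedness is required because \<^const>\<open>diameter\<close> is not meaningful for unbounded sets.\<close>

definition hausdorff_cover :: "real \<Rightarrow> 'a::metric_space set \<Rightarrow> (nat \<Rightarrow> 'a set) set"
  where "hausdorff_cover d A =
    {C. A \<subseteq> (\<Union>i. C i) \<and> (\<forall>i. bounded (C i) \<and> diameter (C i) \<le> d)}"

definition hausdorff_pre :: "real \<Rightarrow> real \<Rightarrow> 'a::metric_space set \<Rightarrow> ennreal"
  where "hausdorff_pre s d A = (INF C\<in>hausdorff_cover d A. \<Sum>i. hausdorff_gauge s (C i))"

definition hausdorff_outer :: "real \<Rightarrow> 'a::metric_space set \<Rightarrow> ennreal"
  where "hausdorff_outer s A = (SUP d\<in>{0<..}. hausdorff_pre s d A)"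

definition hausdorff_measure :: "real \<Rightarrow> 'a::metric_space measure"
  where "hausdorff_measure s =
    measure_of UNIV (lambda_system UNIV (Pow UNIV) (hausdorff_outer s)) (hausdorff_outer s)"

lemma hausdorff_pre_empty: "d > 0 \<Longrightarrow> hausdorff_pre s d {} = 0"
  unfolding hausdorff_pre_def
  by (rule antisym[OF INF_lower2[of "\<lambda>_. {}"]])
     (auto simp: hausdorff_cover_def hausdorff_gauge_def)

lemma hausdorff_pre_mono: "A \<subseteq> B \<Longrightarrow> hausdorff_pre s d A \<le> hausdorff_pre s d B"
  unfolding hausdorff_pre_def by (rule INF_superset_mono) (auto simp: hausdorff_cover_def)

lemma hausdorff_pre_UN:
  fixes A :: "nat \<Rightarrow> 'a::metric_space set"
  shows "hausdorff_pre s d (\<Union>n. A n) \<le> (\<Sum>n. hausdorff_pre s d (A n))"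
proof (rule ennreal_le_epsilon)
  fix e :: real assume e: "0 < e" and fin: "(\<Sum>n. hausdorff_pre s d (A n)) < top"
  have "\<exists>C\<in>hausdorff_cover d (A n). (\<Sum>i. hausdorff_gauge s (C i))
          < hausdorff_pre s d (A n) + e * (1/2) ^ Suc n" for n
  proof -
    have "hausdorff_pre s d (A n) < hausdorff_pre s d (A n) + e * (1/2) ^ Suc n"
      using e fin by (auto simp: less_top dest!: ennreal_suminf_lessD)
    then show ?thesis
      unfolding hausdorff_pre_def INF_less_iff by blast
  qed
  then obtain B where B: "\<And>n. B n \<in> hausdorff_cover d (A n)"
    and le: "\<And>n. (\<Sum>i. hausdorff_gauge s (B n i))
               \<le> hausdorff_pre s d (A n) + e * (1/2) ^ Suc n"
    by (metis less_imp_le)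
  define C where "C = case_prod B \<circ> prod_decode"
  have B': "A n \<subseteq> (\<Union>i. B n i)" "bounded (B n i)" "diameter (B n i) \<le> d" for n i
    using B[of n] by (auto simp: hausdorff_cover_def)
  have "(\<Union>n. A n) \<subseteq> (\<Union>i. C i)"
  proof
    fix x assume "x \<in> (\<Union>n. A n)"
    then obtain n i where "x \<in> B n i"
      using B'(1) by blast
    then have "x \<in> C (prod_encode (n, i))"
      by (simp add: C_def)
    then show "x \<in> (\<Union>i. C i)"
      by blast
  qed
  then have "C \<in> hausdorff_cover d (\<Union>n. A n)"
    using B' by (auto simp: hausdorff_cover_def C_def split: prod.split)
  then have "hausdorff_pre s d (\<Union>n. A n) \<le> (\<Sum>i. hausdorff_gauge s (C i))"
    unfolding hausdorff_pre_def by (rule INF_lower)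
  also have "\<dots> = (\<Sum>n. \<Sum>i. hausdorff_gauge s (B n i))"
    unfolding C_def comp_def by (intro suminf_ennreal_2dimen) auto
  also have "\<dots> \<le> (\<Sum>n. hausdorff_pre s d (A n) + e * (1/2) ^ Suc n)"
    by (intro suminf_le allI le) auto
  also have "\<dots> = (\<Sum>n. hausdorff_pre s d (A n)) + (\<Sum>n. ennreal e * ennreal ((1/2) ^ Suc n))"
    using e by (subst suminf_add[symmetric])
      (auto simp del: ennreal_suminf_cmult simp add: ennreal_mult[symmetric])
  also have "\<dots> = (\<Sum>n. hausdorff_pre s d (A n)) + e"
    unfolding ennreal_suminf_cmult
    by (subst suminf_ennreal_eq[OF zero_le_power power_half_series]) auto
  finally show "hausdorff_pre s d (\<Union>n. A n) \<le> (\<Sum>n. hausdorff_pre s d (A n)) + e" .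
qed

lemma hausdorff_outer_UN: "hausdorff_outer s (\<Union>n::nat. A n) \<le> (\<Sum>n. hausdorff_outer s (A n))"
  unfolding hausdorff_outer_def[of s "\<Union>n. A n"]
proof (rule SUP_least)
  fix d :: real assume "d \<in> {0<..}"
  then have "(\<Sum>n. hausdorff_pre s d (A n)) \<le> (\<Sum>n. hausdorff_outer s (A n))"
    by (intro suminf_le) (auto simp: hausdorff_outer_def intro: SUP_upper)
  then show "hausdorff_pre s d (\<Union>n. A n) \<le> (\<Sum>n. hausdorff_outer s (A n))"
    using hausdorff_pre_UN order_trans by blast
qed

lemma hausdorff_outer_mono: "A \<subseteq> B \<Longrightarrow> hausdorff_outer s A \<le> hausdorff_outer s B"
  unfolding hausdorff_outer_def by (auto intro!: SUP_mono hausdorff_pre_mono)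

lemma hausdorff_outer_empty: "hausdorff_outer s {} = 0"
  by (simp add: hausdorff_outer_def hausdorff_pre_empty)

lemma hausdorff_outer_Un: "hausdorff_outer s (A \<union> B) \<le> hausdorff_outer s A + hausdorff_outer s B"
proof -
  have "A \<union> B = (\<Union>n. binaryset A B n)"
    by (simp add: UN_binaryset_eq)
  also have "hausdorff_outer s \<dots> \<le> (\<Sum>n. hausdorff_outer s (binaryset A B n))"
    by (rule hausdorff_outer_UN)
  also have "\<dots> = hausdorff_outer s A + hausdorff_outer s B"
    by (rule suminf_binaryset_eq) (rule hausdorff_outer_empty)
  finally show ?thesis .
qed

lemma outer_measure_space_hausdorff: "outer_measure_space (Pow UNIV) (hausdorff_outer s)"
  unfolding outer_measure_space_def positive_def increasing_def countably_subadditive_def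
  by (auto simp: hausdorff_outer_empty intro: hausdorff_outer_mono hausdorff_outer_UN)

lemma measure_space_hausdorff:
  "measure_space UNIV (lambda_system UNIV (Pow UNIV) (hausdorff_outer s)) (hausdorff_outer s)"
  by (rule sigma_algebra.caratheodory_lemma[OF sigma_algebra_Pow outer_measure_space_hausdorff])

lemma space_hausdorff_measure: "space (hausdorff_measure s) = UNIV"
  by (simp add: hausdorff_measure_def)

lemma sets_hausdorff_measure:
  "sets (hausdorff_measure s) = lambda_system UNIV (Pow UNIV) (hausdorff_outer s)"
  unfolding hausdorff_measure_def using measure_space_hausdorff[of s]
  by (auto simp: measure_space_def dest: sigma_algebra.sigma_sets_eq)

lemma emeasure_hausdorff_measure:
  assumes "A \<in> sets (hausdorff_measure s)"
  shows "emeasure (hausdorff_measure s) A = hausdorff_outer s A"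
  unfolding hausdorff_measure_def
  using measure_space_hausdorff[of s] assms
  by (intro emeasure_measure_of_sigma)
     (auto simp: measure_space_def sets_hausdorff_measure)

lemma hausdorff_pre_separated:
  assumes sep: "\<And>a b. a \<in> A \<Longrightarrow> b \<in> B \<Longrightarrow> d < dist a b" and d: "0 < d"
  shows "hausdorff_pre s d A + hausdorff_pre s d B \<le> hausdorff_pre s d (A \<union> B)"
  unfolding hausdorff_pre_def[of s d "A \<union> B"]
proof (rule INF_greatest)
  fix C assume C: "C \<in> hausdorff_cover d (A \<union> B)"
  define CA where "CA i = (if C i \<inter> A = {} then {} else C i)" for i
  define CB where "CB i = (if C i \<inter> A = {} then C i else {})" for i
  have disj: "C i \<inter> B = {}" if "C i \<inter> A \<noteq> {}" for i
  proof (rule ccontr)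
    assume "C i \<inter> B \<noteq> {}"
    with that obtain a b where "a \<in> C i" "a \<in> A" "b \<in> C i" "b \<in> B"
      by blast
    moreover have "bounded (C i)" "diameter (C i) \<le> d"
      using C by (auto simp: hausdorff_cover_def)
    ultimately show False
      using sep[of a b] diameter_bounded_bound[of "C i" a b] by auto
  qed
  have bd: "bounded (C i)" "diameter (C i) \<le> d" for i
    using C by (auto simp: hausdorff_cover_def)
  have "A \<subseteq> (\<Union>i. CA i)"
  proof
    fix a assume "a \<in> A"
    moreover then obtain i where "a \<in> C i"
      using C by (auto simp: hausdorff_cover_def)
    ultimately have "a \<in> CA i"
      by (auto simp: CA_def)
    then show "a \<in> (\<Union>i. CA i)"
      by blast
  qed
  then have CA: "CA \<in> hausdorff_cover d A"
    using bd d by (auto simp: hausdorff_cover_def CA_def)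
  have "B \<subseteq> (\<Union>i. CB i)"
  proof
    fix b assume "b \<in> B"
    moreover then obtain i where "b \<in> C i"
      using C by (auto simp: hausdorff_cover_def)
    ultimately have "b \<in> CB i"
      using disj[of i] by (auto simp: CB_def)
    then show "b \<in> (\<Union>i. CB i)"
      by blast
  qed
  then have CB: "CB \<in> hausdorff_cover d B"
    using bd d by (auto simp: hausdorff_cover_def CB_def)
  have "hausdorff_pre s d A + hausdorff_pre s d B
      \<le> (\<Sum>i. hausdorff_gauge s (CA i)) + (\<Sum>i. hausdorff_gauge s (CB i))"
    unfolding hausdorff_pre_def using CA CB by (intro add_mono INF_lower)
  also have "\<dots> = (\<Sum>i. hausdorff_gauge s (CA i) + hausdorff_gauge s (CB i))"
    by (rule suminf_add) auto
  also have "\<dots> = (\<Sum>i. hausdorff_gauge s (C i))"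
    by (intro arg_cong[of _ _ suminf] ext) (auto simp: CA_def CB_def hausdorff_gauge_def)
  finally show "hausdorff_pre s d A + hausdorff_pre s d B \<le> (\<Sum>i. hausdorff_gauge s (C i))" .
qed

lemma hausdorff_pre_antimono: "d \<le> d' \<Longrightarrow> hausdorff_pre s d' A \<le> hausdorff_pre s d A"
  unfolding hausdorff_pre_def
  by (rule INF_superset_mono) (auto simp: hausdorff_cover_def intro: order_trans)

lemma hausdorff_outer_separated:
  assumes sep: "\<And>a b. a \<in> A \<Longrightarrow> b \<in> B \<Longrightarrow> e \<le> dist a b" and e: "0 < e"
  shows "hausdorff_outer s A + hausdorff_outer s B \<le> hausdorff_outer s (A \<union> B)"
proof -
  have "hausdorff_outer s A + hausdorff_outer s B
      = (SUP d\<in>{0<..}. hausdorff_pre s d A + hausdorff_pre s d B)"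
    unfolding hausdorff_outer_def
  proof (rule SUP_add_directed_ennreal[symmetric])
    fix i j :: real assume "i \<in> {0<..}" "j \<in> {0<..}"
    then show "\<exists>k\<in>{0<..}. hausdorff_pre s i A + hausdorff_pre s j B
        \<le> hausdorff_pre s k A + hausdorff_pre s k B"
      by (intro bexI[of _ "min i j"] add_mono hausdorff_pre_antimono) auto
  qed
  also have "\<dots> \<le> hausdorff_outer s (A \<union> B)"
  proof (rule SUP_least)
    fix d :: real assume d: "d \<in> {0<..}"
    have "hausdorff_pre s d A + hausdorff_pre s d B
        \<le> hausdorff_pre s (min d (e / 2)) A + hausdorff_pre s (min d (e / 2)) B"
      by (intro add_mono hausdorff_pre_antimono) auto
    also have "\<dots> \<le> hausdorff_pre s (min d (e / 2)) (A \<union> B)"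
    proof (rule hausdorff_pre_separated)
      show "min d (e / 2) < dist a b" if "a \<in> A" "b \<in> B" for a b
        using sep[OF that] e by linarith
    qed (use d e in auto)
    also have "\<dots> \<le> hausdorff_outer s (A \<union> B)"
      unfolding hausdorff_outer_def using d e by (intro SUP_upper) auto
    finally show "hausdorff_pre s d A + hausdorff_pre s d B \<le> hausdorff_outer s (A \<union> B)" .
  qed
  finally show ?thesis .
qed

lemma hausdorff_outer_chain:
  fixes R :: "nat \<Rightarrow> 'a::metric_space set"
  assumes "\<And>i j a b. \<lbrakk>Suc i < j; a \<in> R i; b \<in> R j\<rbrakk> \<Longrightarrow> e i \<le> dist a b" "\<And>i. 0 < (e i :: real)"
  shows "(\<Sum>k<n. hausdorff_outer s (R (2 * k + c))) \<le> hausdorff_outer s (\<Union>k<n. R (2 * k + c))"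
proof (induction n)
  case (Suc n)
  define \<epsilon> where "\<epsilon> = Min (insert 1 ((\<lambda>k. e (2 * k + c)) ` {..<n}))"
  have \<epsilon>: "0 < \<epsilon>"
    unfolding \<epsilon>_def using assms(2) by (subst Min_gr_iff) auto
  have "(\<Sum>k<Suc n. hausdorff_outer s (R (2 * k + c)))
      \<le> hausdorff_outer s (\<Union>k<n. R (2 * k + c)) + hausdorff_outer s (R (2 * n + c))"
    using Suc by (simp add: add_right_mono)
  also have "\<dots> \<le> hausdorff_outer s ((\<Union>k<n. R (2 * k + c)) \<union> R (2 * n + c))"
  proof (rule hausdorff_outer_separated[OF _ \<epsilon>])
    fix a b assume "a \<in> (\<Union>k<n. R (2 * k + c))" "b \<in> R (2 * n + c)"
    then obtain k where k: "k < n" "a \<in> R (2 * k + c)"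
      by auto
    have "\<epsilon> \<le> e (2 * k + c)"
      unfolding \<epsilon>_def using k by (intro Min_le) auto
    also have "\<dots> \<le> dist a b"
      using k \<open>b \<in> _\<close> by (intro assms(1)[of _ "2 * n + c"]) auto
    finally show "\<epsilon> \<le> dist a b" .
  qed
  also have "(\<Union>k<n. R (2 * k + c)) \<union> R (2 * n + c) = (\<Union>k<Suc n. R (2 * k + c))"
    by (auto simp: lessThan_Suc)
  finally show ?case .
qed simp

lemma closed_hausdorff_measurable:
  fixes F :: "'a::metric_space set"
  assumes "closed F"
  shows "F \<in> sets (hausdorff_measure s)"
proof -
  let ?\<mu> = "hausdorff_outer s :: 'a set \<Rightarrow> ennreal"
  have *: "?\<mu> (X \<inter> F) + ?\<mu> (X - F) \<le> ?\<mu> X" for X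
  proof (cases "F = {} \<or> ?\<mu> X = \<infinity>")
    case True
    then show ?thesis
      by (auto simp: hausdorff_outer_empty)
  next
    case False
    then have ne: "F \<noteq> {}" and fin: "?\<mu> X < \<infinity>"
      by (auto simp: less_top)
    define t where "t k = 1 / real (Suc k)" for k
    define A where "A k = {x \<in> X. t k \<le> infdist x F}" for k
    define R where "R k = A (Suc k) - A k" for k
    have t_pos: "0 < t k" and t_dec: "t (Suc k) < t k" for k
      by (auto simp: t_def field_simps)
    have t_mono: "t j \<le> t i" if "i \<le> j" for i j
      using that by (simp add: t_def frac_le)
    have A_mono: "A i \<subseteq> A j" if "i \<le> j" for i j
      using t_mono[OF that] by (auto simp: A_def)
    have sepR: "t (Suc i) - t (Suc (Suc i)) \<le> dist a b"
      if "Suc i < j" "a \<in> R i" "b \<in> R j" for i j a b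
    proof -
      have "t (Suc i) \<le> infdist a F"
        using that by (auto simp: R_def A_def)
      moreover have "infdist b F < t j"
        using that by (auto simp: R_def A_def)
      moreover have "t j \<le> t (Suc (Suc i))"
        using that by (intro t_mono) auto
      moreover have "infdist a F \<le> infdist b F + dist a b"
        by (rule infdist_triangle)
      ultimately show ?thesis
        by linarith
    qed
    have R_X: "R k \<subseteq> X" for k
      by (auto simp: R_def A_def)
    have half: "(\<Sum>k. ?\<mu> (R (2 * k + c))) \<le> ?\<mu> X" for c
    proof (rule suminf_le_const)
      fix n
      have "(\<Sum>k<n. ?\<mu> (R (2 * k + c))) \<le> ?\<mu> (\<Union>k<n. R (2 * k + c))"
        by (rule hausdorff_outer_chain[OF sepR]) (use t_dec in auto)
      also have "\<dots> \<le> ?\<mu> X"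
        using R_X by (intro hausdorff_outer_mono) auto
      finally show "(\<Sum>k<n. ?\<mu> (R (2 * k + c))) \<le> ?\<mu> X" .
    qed simp
    have sum_fin: "(\<Sum>k. ?\<mu> (R k)) < \<infinity>"
    proof -
      have "(\<Sum>k. ?\<mu> (R k)) \<le> ?\<mu> X + ?\<mu> X"
      proof (rule suminf_le_const)
        fix n
        have "(\<Sum>k<n. ?\<mu> (R k)) \<le> (\<Sum>k<2 * n. ?\<mu> (R k))"
          by (intro sum_mono2) auto
        also have "\<dots> = (\<Sum>k<n. ?\<mu> (R (2 * k + 0))) + (\<Sum>k<n. ?\<mu> (R (2 * k + 1)))"
          by (induction n) (auto simp: algebra_simps)
        also have "\<dots> \<le> (\<Sum>k. ?\<mu> (R (2 * k + 0))) + (\<Sum>k. ?\<mu> (R (2 * k + 1)))"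
          by (intro add_mono sum_le_suminf) auto
        also have "\<dots> \<le> ?\<mu> X + ?\<mu> X"
          by (intro add_mono half)
        finally show "(\<Sum>k<n. ?\<mu> (R k)) \<le> ?\<mu> X + ?\<mu> X" .
      qed simp
      also have "\<dots> < \<infinity>"
        using fin by (simp add: less_top)
      finally show ?thesis .
    qed
    have "?\<mu> (X \<inter> F) + ?\<mu> (X - F) \<le> ?\<mu> X + (\<Sum>i. ?\<mu> (R (i + n)))" for n
    proof -
      have "X - F \<subseteq> A n \<union> (\<Union>i. R (i + n))"
      proof
        fix x assume x: "x \<in> X - F"
        then have "0 < infdist x F"
          using assms ne in_closed_iff_infdist_zero[of F x] infdist_nonneg[of x F]
          by (auto simp: less_le)
        then obtain k where "inverse (real (Suc k)) < infdist x F"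
          using reals_Archimedean by blast
        then have k: "x \<in> A k"
          using x by (auto simp: A_def t_def divide_simps)
        show "x \<in> A n \<union> (\<Union>i. R (i + n))"
        proof (cases "x \<in> A n")
          case False
          define j where "j = (LEAST j. x \<in> A j)"
          have j: "x \<in> A j"
            unfolding j_def using k by (rule LeastI)
          have "n < j"
            using False j A_mono[of j n] by (cases "n < j") auto
          then obtain i where i: "j = Suc (i + n)"
            using less_imp_Suc_add[of n j] by (auto simp: add.commute)
          have "x \<notin> A (i + n)"
            using not_less_Least[of "i + n" "\<lambda>j. x \<in> A j"] i unfolding j_def by auto
          then have "x \<in> R (i + n)"
            using j i by (auto simp: R_def)
          then show ?thesis
            by blast
        qed simp
      qed
      then have "?\<mu> (X - F) \<le> ?\<mu> (A n \<union> (\<Union>i. R (i + n)))"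
        by (rule hausdorff_outer_mono)
      also have "\<dots> \<le> ?\<mu> (A n) + ?\<mu> (\<Union>i. R (i + n))"
        by (rule hausdorff_outer_Un)
      also have "\<dots> \<le> ?\<mu> (A n) + (\<Sum>i. ?\<mu> (R (i + n)))"
        by (intro add_left_mono hausdorff_outer_UN)
      finally have "?\<mu> (X \<inter> F) + ?\<mu> (X - F)
          \<le> (?\<mu> (X \<inter> F) + ?\<mu> (A n)) + (\<Sum>i. ?\<mu> (R (i + n)))"
        by (simp add: add.assoc add_left_mono)
      also have "?\<mu> (X \<inter> F) + ?\<mu> (A n) \<le> ?\<mu> ((X \<inter> F) \<union> A n)"
      proof (rule hausdorff_outer_separated[of _ _ "t n"])
        fix a b assume "a \<in> X \<inter> F" "b \<in> A n"
        then show "t n \<le> dist a b"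
          using infdist_le[of a F b] by (auto simp: A_def dist_commute)
      qed (rule t_pos)
      also have "\<dots> \<le> ?\<mu> X"
        by (intro hausdorff_outer_mono) (auto simp: A_def)
      finally show ?thesis
        by (simp add: add_right_mono)
    qed
    moreover have "(\<lambda>n. ?\<mu> X + (\<Sum>i. ?\<mu> (R (i + n)))) \<longlonglongrightarrow> ?\<mu> X + 0"
    proof (intro tendsto_add tendsto_const)
      have f: "?\<mu> (R k) < \<infinity>" for k
        using hausdorff_outer_mono[OF R_X[of k], of s] fin by (rule le_less_trans)
      define g where "g k = enn2real (?\<mu> (R k))" for k
      have g: "?\<mu> (R k) = ennreal (g k)" "0 \<le> g k" for k
        using f[of k] by (auto simp: g_def less_top)
      have sg: "summable g"
        using sum_fin g by (intro summable_suminf_not_top) auto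
      then have "(\<lambda>n. \<Sum>i. g (i + n)) \<longlonglongrightarrow> 0"
        by (rule suminf_exist_split2)
      then have "(\<lambda>n. ennreal (\<Sum>i. g (i + n))) \<longlonglongrightarrow> ennreal 0"
        by (rule tendsto_ennrealI)
      moreover have "(\<Sum>i. ?\<mu> (R (i + n))) = ennreal (\<Sum>i. g (i + n))" for n
        unfolding g(1) using sg g(2) by (intro suminf_ennreal2) (auto simp: summable_iff_shift)
      ultimately show "(\<lambda>n. \<Sum>i. ?\<mu> (R (i + n))) \<longlonglongrightarrow> 0"
        by simp
    qed
    ultimately have "?\<mu> (X \<inter> F) + ?\<mu> (X - F) \<le> ?\<mu> X + 0"
      by (intro LIMSEQ_le_const) auto
    then show ?thesis
      by simp
  qed
  have "?\<mu> (F \<inter> X) + ?\<mu> ((UNIV - F) \<inter> X) = ?\<mu> X" for X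
  proof (rule antisym)
    have [simp]: "(UNIV - F) \<inter> X = X - F" "F \<inter> X = X \<inter> F"
      by auto
    show "?\<mu> (F \<inter> X) + ?\<mu> ((UNIV - F) \<inter> X) \<le> ?\<mu> X"
      using *[of X] by simp
    have "?\<mu> X = ?\<mu> ((X \<inter> F) \<union> (X - F))"
      by (simp add: Int_Diff_Un)
    then show "?\<mu> X \<le> ?\<mu> (F \<inter> X) + ?\<mu> ((UNIV - F) \<inter> X)"
      using hausdorff_outer_Un[of s "X \<inter> F" "X - F"] by simp
  qed
  then show ?thesis
    by (simp add: sets_hausdorff_measure lambda_system_def)
qed

lemma borel_subset_hausdorff_measure:
  "sets (borel :: 'a::metric_space measure) \<subseteq> sets (hausdorff_measure s)"
  unfolding borel_eq_closed
  using sets.sigma_sets_subset[of "Collect closed" "hausdorff_measure s :: 'a measure"]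
    closed_hausdorff_measurable[of _ s]
  by (auto simp: space_hausdorff_measure)

definition hausdorff_dim :: "'a::metric_space set \<Rightarrow> ennreal"
  where "hausdorff_dim A = Inf {ennreal s | s. 0 \<le> s \<and> hausdorff_outer s A = 0}"


section \<open>Menger-type curvature energies\<close>

text \<open>
  If all points coincide, the denominator is \<open>0\<close> and the quotient is \<open>0\<close>. A simplex has finite
  measure, so no information is lost in the passage to the reals.
\<close>

definition curvK :: "nat \<Rightarrow> (nat \<Rightarrow> real finseq) \<Rightarrow> real"
  where "curvK m x =
    enn2real (hausdorff_outer (real (m + 1)) (convex hull (x ` {..m + 1})))
      / diameter (x ` {..m + 1}) ^ (m + 2)"

text \<open>For \<open>l = m + 2\<close> the supremum is over functions whose values are irrelevant.\<close>

definition energy :: "nat \<Rightarrow> real \<Rightarrow> nat \<Rightarrow> real finseq set \<Rightarrow> ennreal"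
  where "energy m p l \<Sigma> =
    (\<integral>\<^sup>+ y \<in> finpower l \<Sigma>.
       (SUP z \<in> {z. \<forall>i\<in>{l..m + 1}. z i \<in> \<Sigma>}.
          ennreal (curvK m (\<lambda>i. if i < l then coord y i else z i) powr p))
     \<partial>hausdorff_measure (real (m * l)))"


section \<open>Flatness numbers and fine sets\<close>

definition grassmannian :: "nat \<Rightarrow> nat \<Rightarrow> real finseq set set"
  where "grassmannian n m = {H. subspace H \<and> H \<subseteq> Rn n \<and> dim H = m}"

definition beta_number :: "nat \<Rightarrow> nat \<Rightarrow> real finseq set \<Rightarrow> real finseq \<Rightarrow> real \<Rightarrow> real"
  where "beta_number n m \<Sigma> x r =
    (1 / r) * (INF H\<in>grassmannian n m. SUP z\<in>\<Sigma> \<inter> cball x r. infdist z ((+) x ` H))"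

text \<open>The sum of the two one-sided distances, not their maximum.\<close>

definition hausdorff_dist :: "'a::metric_space set \<Rightarrow> 'a set \<Rightarrow> real"
  where "hausdorff_dist A B = (SUP y\<in>A. infdist y B) + (SUP y\<in>B. infdist y A)"

definition theta_number :: "nat \<Rightarrow> nat \<Rightarrow> real finseq set \<Rightarrow> real finseq \<Rightarrow> real \<Rightarrow> real"
  where "theta_number n m \<Sigma> x r =
    (1 / r) * (INF H\<in>grassmannian n m.
       hausdorff_dist (\<Sigma> \<inter> cball x r) (((+) x ` H) \<inter> cball x r))"

definition m_fine :: "nat \<Rightarrow> nat \<Rightarrow> real finseq set \<Rightarrow> bool"
  where "m_fine n m \<Sigma> \<longleftrightarrow>
    \<Sigma> \<subseteq> Rn n \<and> hausdorff_dim \<Sigma> = of_nat m \<and> compact \<Sigma> \<and>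
    (\<exists>R>0. \<exists>A>0. \<forall>x\<in>\<Sigma>. \<forall>r. 0 < r \<and> r \<le> R \<longrightarrow>
       hausdorff_outer (real m) (\<Sigma> \<inter> ball x r) \<ge> ennreal (A * r ^ m)) \<and>
    (\<exists>R>0. \<exists>M>1. \<forall>x\<in>\<Sigma>. \<forall>r. 0 < r \<and> r \<le> R \<longrightarrow>
       theta_number n m \<Sigma> x r \<le> M * beta_number n m \<Sigma> x r)"

end

theory Submission
  imports Defs
begin

text \<open>
  If no \<open>m\<close>-plane is \<open>\<delta>\<close>-close to \<open>\<Sigma>\<close> in a ball of radius \<open>r\<close>, then \<open>\<Sigma>\<close> contains the vertices of a
  fat \<open>(m + 1)\<close>-simplex there, and all simplices with nearby vertices have curvature at least a
  power of \<open>\<delta>\<close> divided by \<open>r\<close>. Together with a lower Ahlfors bound with constant \<open>A\<close> the energy then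
  exceeds \<open>E\<close> unless \<open>\<delta> \<le> C r\<^sup>\<kappa>\<close>, where \<open>C\<close> depends on \<open>\<Sigma>\<close> only through \<open>A\<close>.

  Such a decay makes the tilts of the approximating planes over dyadic scales summable. If moreover
  the planes have no large holes near \<open>\<Sigma>\<close>, the projection of \<open>\<Sigma>\<close> onto the plane at scale \<open>r\<close> covers a
  disc of almost full radius, which gives the Ahlfors bound with the constant of the theorem (the
  isodiametric inequality shows that Hausdorff measure is at least Lebesgue measure).

  Both facts feed each other. The fineness of \<open>\<Sigma>\<close> yields them at some scale depending on \<open>\<Sigma>\<close>, with
  bad constants; but the Ahlfors constant obtained is universal, hence so is the next \<open>C\<close>, and the
  surjectivity of the projections excludes large holes at a scale larger by the factor \<open>33 / 32\<close>.
  Iterating reaches a scale that depends only on the universal \<open>C\<close>.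
\<close>

section \<open>The isodiametric inequality\<close>

text \<open>Finite energy only pulls \<open>\<Sigma>\<close> towards planes. It says nothing about
  holes, since every subset of an \<open>m\<close>-plane has energy zero. Absence of holes is
  therefore carried along as a separate and deliberately crude condition (constant 1/16), which has
  to be regenerated at each larger scale. The gain per round is limited to 33/32 because the disc
  covered by the projection at the old scale must nearly fill the disc at the new one. Decay of the
  flatness, rather than mere smallness, bounds the total tilt over infinitely many scales by a
  multiple of the flatness at the top scale; the decay exponent is positive because
  \<open>p > m * l\<close>. The number sqrt 15 / 4 is about 0.968, and the numerical losses are
  arranged so that a covered radius of about 0.975 remains. The energy integrates against the
  Hausdorff measure of a power of \<open>\<Sigma>\<close>, which is not a product measure in
  general. The mass of a product of small balls is therefore bounded below by a weighted covering
  argument.\<close>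

definition steiner :: "nat set \<Rightarrow> nat \<Rightarrow> (nat \<Rightarrow> real) set \<Rightarrow> (nat \<Rightarrow> real) set"
  where "steiner I i A = {f \<in> space (Pi\<^sub>M I (\<lambda>_. lborel)).
    ennreal (2 * \<bar>f i\<bar>) < emeasure lborel {y. f(i := y) \<in> A}}"

lemma slice_measurable:
  fixes I J :: "nat set"
  assumes "finite I" "i \<in> I" "A \<in> sets (Pi\<^sub>M I (\<lambda>_. lborel))" "f \<in> space (Pi\<^sub>M J (\<lambda>_. lborel))"
    and J: "J = I \<or> insert i J = I"
  shows "{y::real. f(i := y) \<in> A} \<in> sets borel"
proof -
  have "(\<lambda>y. f(i := y)) \<in> measurable borel (Pi\<^sub>M I (\<lambda>_. lborel))"
    by (rule measurable_fun_upd[of _ J]) (use assms in auto)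
  from measurable_sets[OF this assms(3)] show ?thesis
    by (simp add: vimage_def)
qed

lemma slice_emeasure_measurable:
  fixes I :: "nat set"
  assumes "finite I" "i \<in> I" "A \<in> sets (Pi\<^sub>M I (\<lambda>_. lborel))"
  shows "(\<lambda>f. emeasure lborel {y::real. f(i := y) \<in> A}) \<in> borel_measurable (Pi\<^sub>M I (\<lambda>_. lborel))"
proof (rule lborel.measurable_emeasure)
  let ?N = "Pi\<^sub>M I (\<lambda>_. lborel) :: (nat \<Rightarrow> real) measure"
  have "(\<lambda>x. (fst x)(i := snd x)) \<in> measurable (?N \<Otimes>\<^sub>M lborel) (Pi\<^sub>M I (\<lambda>_. lborel))"
    by (rule measurable_fun_upd[of _ I]) (use assms in auto)
  from measurable_sets[OF this assms(3)]
  show "{x \<in> space (?N \<Otimes>\<^sub>M lborel). snd x \<in> {y. (fst x)(i := y) \<in> A}} \<in> sets (?N \<Otimes>\<^sub>M lborel)"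
    by (simp add: vimage_def Int_def conj_commute)
qed auto

lemma steiner_sets:
  assumes "finite I" "i \<in> I" "A \<in> sets (Pi\<^sub>M I (\<lambda>_. lborel))"
  shows "steiner I i A \<in> sets (Pi\<^sub>M I (\<lambda>_. lborel))"
proof -
  note [measurable] = slice_emeasure_measurable[OF assms]
  have [measurable]: "(\<lambda>f. f i) \<in> borel_measurable (Pi\<^sub>M I (\<lambda>_. lborel :: real measure))"
    using measurable_component_singleton[OF assms(2), of "\<lambda>_. lborel :: real measure"] by simp
  show ?thesis
    unfolding steiner_def by measurable
qed

text \<open>This explains the form of \<open>steiner\<close>: the strict inequality in
  \<open>ennreal\<close> yields the centred open interval of the length of the slice, the whole line
  for a slice of infinite measure and nothing for a null slice, without a case distinction.\<close>

lemma emeasure_symmetric_interval: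
  "emeasure lborel {y::real. ennreal (2 * \<bar>y\<bar>) < c} = c"
proof (cases c)
  case (real r)
  have "{y::real. ennreal (2 * \<bar>y\<bar>) < c} = {- r / 2 <..< r / 2}"
    using real by (auto simp: ennreal_less_iff)
  then show ?thesis
    using real by (simp)
qed simp

lemma emeasure_slices:
  fixes I :: "nat set"
  assumes "finite I" "i \<in> I" "A \<in> sets (Pi\<^sub>M I (\<lambda>_. lborel))"
  shows "emeasure (Pi\<^sub>M I (\<lambda>_. lborel)) A
    = (\<integral>\<^sup>+ x. emeasure lborel {y::real. x(i := y) \<in> A} \<partial>Pi\<^sub>M (I - {i}) (\<lambda>_. lborel))"
proof -
  interpret product_sigma_finite "\<lambda>_::nat. lborel :: real measure"
    by standard
  let ?J = "I - {i}"
  have I: "insert i ?J = I"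
    using assms(2) by auto
  have "emeasure (Pi\<^sub>M I (\<lambda>_. lborel)) A = (\<integral>\<^sup>+ x. indicator A x \<partial>Pi\<^sub>M (insert i ?J) (\<lambda>_. lborel))"
    using assms(3) by (subst nn_integral_indicator) (simp_all only: I)
  also have "\<dots> = (\<integral>\<^sup>+ x. (\<integral>\<^sup>+ y. indicator A (x(i := y)) \<partial>lborel) \<partial>Pi\<^sub>M ?J (\<lambda>_. lborel))"
    by (rule product_nn_integral_insert) (use assms I in auto)
  also have "\<dots> = (\<integral>\<^sup>+ x. emeasure lborel {y::real. x(i := y) \<in> A} \<partial>Pi\<^sub>M ?J (\<lambda>_. lborel))"
  proof (rule nn_integral_cong)
    fix x assume "x \<in> space (Pi\<^sub>M ?J (\<lambda>_. lborel :: real measure))"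
    then have "{y::real. x(i := y) \<in> A} \<in> sets lborel"
      using slice_measurable[OF assms, of x ?J] I by simp
    moreover have "(\<lambda>y. indicator A (x(i := y)) :: ennreal) = indicator {y. x(i := y) \<in> A}"
      by (auto simp: indicator_def)
    ultimately show "(\<integral>\<^sup>+ y. indicator A (x(i := y)) \<partial>lborel) = emeasure lborel {y. x(i := y) \<in> A}"
      by simp
  qed
  finally show ?thesis .
qed

lemma emeasure_steiner:
  assumes "finite I" "i \<in> I" "A \<in> sets (Pi\<^sub>M I (\<lambda>_. lborel))"
  shows "emeasure (Pi\<^sub>M I (\<lambda>_. lborel)) (steiner I i A) = emeasure (Pi\<^sub>M I (\<lambda>_. lborel)) A"
  unfolding emeasure_slices[OF assms] emeasure_slices[OF assms(1,2) steiner_sets[OF assms]]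
proof (rule nn_integral_cong)
  fix x assume "x \<in> space (Pi\<^sub>M (I - {i}) (\<lambda>_. lborel :: real measure))"
  then have "x(i := y) \<in> space (Pi\<^sub>M I (\<lambda>_. lborel))" for y
    using assms(2) by (auto simp: space_PiM PiE_iff extensional_def)
  then have "{y. x(i := y) \<in> steiner I i A}
      = {y. ennreal (2 * \<bar>y\<bar>) < emeasure lborel {y. x(i := y) \<in> A}}"
    by (simp add: steiner_def)
  then show "emeasure lborel {y. x(i := y) \<in> steiner I i A} = emeasure lborel {y. x(i := y) \<in> A}"
    by (simp add: emeasure_symmetric_interval)
qed

text \<open>The slices \<open>F\<close> and \<open>G\<close> of \<open>A\<close> through
  \<open>f\<close> and \<open>g\<close> contain points at least as far apart as \<open>f i\<close>
  and \<open>g i\<close>. Otherwise \<open>Sup F - Inf G\<close> and \<open>Sup G - Inf F\<close>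
  are both at most \<open>\<bar>f i - g i\<bar>\<close>, although their sum is the total length of
  the two hulls and exceeds \<open>2 * \<bar>f i\<bar> + 2 * \<bar>g i\<bar>\<close>. Moving
  coordinate \<open>i\<close> to such points gives members of \<open>A\<close> that are no
  closer.\<close>

lemma steiner_dist_le:
  assumes fin: "finite I" and i: "i \<in> I"
    and A: "\<And>f g. f \<in> A \<Longrightarrow> g \<in> A \<Longrightarrow> L2_set (\<lambda>j. f j - g j) I \<le> d"
    and f: "f \<in> steiner I i A" and g: "g \<in> steiner I i A"
  shows "L2_set (\<lambda>j. f j - g j) I \<le> d"
proof -
  define F where "F = {y. f(i := y) \<in> A}"
  define G where "G = {y. g(i := y) \<in> A}"
  have F: "ennreal (2 * \<bar>f i\<bar>) < emeasure lborel F" and G: "ennreal (2 * \<bar>g i\<bar>) < emeasure lborel G"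
    using f g by (auto simp: steiner_def F_def G_def)
  then have ne: "F \<noteq> {}" "G \<noteq> {}"
    by auto
  have "\<exists>y\<in>F. \<exists>z\<in>G. \<bar>f i - g i\<bar> \<le> \<bar>y - z\<bar>"
  proof (rule ccontr)
    assume "\<not> ?thesis"
    then have lt: "\<bar>y - z\<bar> < \<bar>f i - g i\<bar>" if "y \<in> F" "z \<in> G" for y z
      using that by force
    obtain y0 z0 where yz: "y0 \<in> F" "z0 \<in> G"
      using ne by auto
    have y_bounds: "z0 - \<bar>f i - g i\<bar> \<le> y" "y \<le> z0 + \<bar>f i - g i\<bar>" if "y \<in> F" for y
      using lt[OF that yz(2)] by auto
    have z_bounds: "y0 - \<bar>f i - g i\<bar> \<le> z" "z \<le> y0 + \<bar>f i - g i\<bar>" if "z \<in> G" for z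
      using lt[OF yz(1) that] by auto
    have bdd: "bdd_above F" "bdd_below F" "bdd_above G" "bdd_below G"
      using y_bounds z_bounds by (meson bdd_above.I bdd_below.I)+
    have "Sup F \<le> Inf G + \<bar>f i - g i\<bar>"
    proof (rule cSup_least[OF ne(1)])
      fix y assume y: "y \<in> F"
      have "y - \<bar>f i - g i\<bar> \<le> Inf G"
      proof (rule cInf_greatest[OF ne(2)])
        show "y - \<bar>f i - g i\<bar> \<le> z" if "z \<in> G" for z
          using lt[OF y that] by linarith
      qed
      then show "y \<le> Inf G + \<bar>f i - g i\<bar>" by linarith
    qed
    moreover have "Sup G \<le> Inf F + \<bar>f i - g i\<bar>"
    proof (rule cSup_least[OF ne(2)])
      fix z assume z: "z \<in> G"
      have "z - \<bar>f i - g i\<bar> \<le> Inf F"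
      proof (rule cInf_greatest[OF ne(1)])
        show "z - \<bar>f i - g i\<bar> \<le> y" if "y \<in> F" for y
          using lt[OF that z] by linarith
      qed
      then show "z \<le> Inf F + \<bar>f i - g i\<bar>" by linarith
    qed
    moreover have "2 * \<bar>c\<bar> < Sup X - Inf X"
      if "ennreal (2 * \<bar>c\<bar>) < emeasure lborel X" "bdd_above X" "bdd_below X" "X \<noteq> {}" for c and X :: "real set"
    proof -
      have "X \<subseteq> {Inf X..Sup X}"
        using that by (auto intro: cInf_lower cSup_upper)
      then have "emeasure lborel X \<le> emeasure lborel {Inf X..Sup X}"
        by (intro emeasure_mono) auto
      also have "\<dots> = ennreal (Sup X - Inf X)"
        using cInf_le_cSup[OF that(4,2,3)] by simp
      finally have "ennreal (2 * \<bar>c\<bar>) < ennreal (Sup X - Inf X)"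
        by (rule less_le_trans[OF that(1)])
      then show ?thesis
        by (simp add: ennreal_less_iff)
    qed
    ultimately show False
      using F G bdd ne by (smt (verit))
  qed
  then obtain y z where yz: "y \<in> F" "z \<in> G" "\<bar>f i - g i\<bar> \<le> \<bar>y - z\<bar>"
    by blast
  have "L2_set (\<lambda>j. f j - g j) I \<le> L2_set (\<lambda>j. (f(i := y)) j - (g(i := z)) j) I"
    unfolding L2_set_def using yz(3)
    by (intro real_sqrt_le_mono sum_mono) (auto simp: abs_le_square_iff)
  also have "\<dots> \<le> d"
    using A[of "f(i := y)" "g(i := z)"] yz(1,2) by (simp add: F_def G_def)
  finally show ?thesis .
qed

definition reflection_symmetric :: "nat \<Rightarrow> (nat \<Rightarrow> real) set \<Rightarrow> bool"
  where "reflection_symmetric j A \<longleftrightarrow> (\<forall>f\<in>A. f(j := - f j) \<in> A)"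

lemma steiner_symmetric:
  assumes "i \<in> I"
  shows "reflection_symmetric i (steiner I i A)"
  using assms by (auto simp: reflection_symmetric_def steiner_def space_PiM PiE_iff extensional_def)

text \<open>If \<open>A\<close> is symmetric in \<open>j\<close>, reflecting coordinate
  \<open>j\<close> does not change the slices in direction \<open>i\<close>, hence not their
  lengths. This allows the coordinates to be symmetrized one after the other.\<close>

lemma steiner_preserves_symmetric:
  assumes "j \<in> I" "j \<noteq> i" "reflection_symmetric j A"
  shows "reflection_symmetric j (steiner I i A)"
proof -
  have *: "g(j := - g j) \<in> A \<longleftrightarrow> g \<in> A" for g
  proof
    assume "g(j := - g j) \<in> A"
    then have "(g(j := - g j))(j := - (g(j := - g j)) j) \<in> A"
      using assms(3) unfolding reflection_symmetric_def by blast
    then show "g \<in> A" by simp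
  qed (use assms(3) in \<open>auto simp: reflection_symmetric_def\<close>)
  have "(f(j := - f j))(i := y) \<in> A \<longleftrightarrow> f(i := y) \<in> A" for f y
    using *[of "f(i := y)"] assms(2) by (simp add: fun_upd_twist)
  then show ?thesis
    using assms by (auto simp: reflection_symmetric_def steiner_def space_PiM PiE_iff extensional_def)
qed

lemma symmetrization_exists:
  fixes I :: "nat set"
  assumes "finite I" "A \<in> sets (Pi\<^sub>M I (\<lambda>_. lborel))"
    and "\<And>f g. f \<in> A \<Longrightarrow> g \<in> A \<Longrightarrow> L2_set (\<lambda>j. f j - g j) I \<le> d"
    and "finite J" "J \<subseteq> I"
  shows "\<exists>B\<in>sets (Pi\<^sub>M I (\<lambda>_. lborel)). emeasure (Pi\<^sub>M I (\<lambda>_. lborel)) B = emeasure (Pi\<^sub>M I (\<lambda>_. lborel)) A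
    \<and> (\<forall>f\<in>B. \<forall>g\<in>B. L2_set (\<lambda>j. f j - g j) I \<le> d) \<and> (\<forall>j\<in>J. reflection_symmetric j B)"
  using assms(4,5)
proof (induction J)
  case empty
  then show ?case
    using assms(2,3) by auto
next
  case (insert i J)
  then obtain B where B: "B \<in> sets (Pi\<^sub>M I (\<lambda>_. lborel))"
      "emeasure (Pi\<^sub>M I (\<lambda>_. lborel)) B = emeasure (Pi\<^sub>M I (\<lambda>_. lborel)) A"
      "\<And>f g. f \<in> B \<Longrightarrow> g \<in> B \<Longrightarrow> L2_set (\<lambda>j. f j - g j) I \<le> d"
      "\<And>j. j \<in> J \<Longrightarrow> reflection_symmetric j B"
    by auto
  have i: "i \<in> I"
    using insert by auto
  have "reflection_symmetric j (steiner I i B)" if "j \<in> insert i J" for j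
    using that B(4) insert.prems steiner_symmetric[OF i] steiner_preserves_symmetric[of j I i B]
    by (cases "j = i") auto
  moreover have "\<forall>f\<in>steiner I i B. \<forall>g\<in>steiner I i B. L2_set (\<lambda>j. f j - g j) I \<le> d"
    using steiner_dist_le[OF assms(1) i B(3)] by simp
  ultimately show ?case
    using steiner_sets[OF assms(1) i B(1)] emeasure_steiner[OF assms(1) i B(1)] B(2)
    by (intro bexI[of _ "steiner I i B"]) auto
qed

text \<open>A set of diameter \<open>d\<close> need not lie in a ball of radius
  \<open>d / 2\<close>, but its full symmetrization does: it contains with each point also the
  antipode, at twice the distance from the origin.\<close>

theorem isodiametric_inequality:
  fixes I :: "nat set"
  assumes "finite I" "A \<in> sets (Pi\<^sub>M I (\<lambda>_. lborel))" "0 < d"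
    and "\<And>f g. f \<in> A \<Longrightarrow> g \<in> A \<Longrightarrow> L2_set (\<lambda>j. f j - g j) I \<le> d"
  shows "emeasure (Pi\<^sub>M I (\<lambda>_. lborel)) A \<le> ennreal (unit_ball_vol (card I) * (d / 2) ^ card I)"
proof -
  obtain B where B: "B \<in> sets (Pi\<^sub>M I (\<lambda>_. lborel))"
      "emeasure (Pi\<^sub>M I (\<lambda>_. lborel)) B = emeasure (Pi\<^sub>M I (\<lambda>_. lborel)) A"
      "\<And>f g. f \<in> B \<Longrightarrow> g \<in> B \<Longrightarrow> L2_set (\<lambda>j. f j - g j) I \<le> d"
      "\<And>j. j \<in> I \<Longrightarrow> reflection_symmetric j B"
    using symmetrization_exists[OF assms(1,2,4,1) subset_refl] by blast
  have neg: "(\<lambda>i. if i \<in> J then - f i else f i) \<in> B" if "finite J" "J \<subseteq> I" "f \<in> B" for J f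
    using that
  proof (induction J)
    case (insert j J)
    let ?g = "\<lambda>i. if i \<in> J then - f i else f i"
    have "?g(j := - ?g j) \<in> B"
      using insert B(4)[of j] by (auto simp: reflection_symmetric_def)
    also have "?g(j := - ?g j) = (\<lambda>i. if i \<in> insert j J then - f i else f i)"
      using insert.hyps by auto
    finally show ?case .
  qed simp
  have "L2_set f I \<le> d / 2" if "f \<in> B" for f
  proof -
    let ?g = "\<lambda>i. if i \<in> I then - f i else f i"
    have "L2_set (\<lambda>j. f j - ?g j) I = L2_set (\<lambda>j. 2 * f j) I"
      by (rule L2_set_cong) auto
    also have "\<dots> = 2 * L2_set f I"
      by (simp add: L2_set_right_distrib)
    finally show ?thesis
      using B(3)[OF that neg[OF assms(1) subset_refl that]] by simp
  qed
  then have "B \<subseteq> {f. sqrt (\<Sum>i\<in>I. (f i)\<^sup>2) \<le> d / 2} \<inter> space (Pi\<^sub>M I (\<lambda>_. lborel))"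
    using sets.sets_into_space[OF B(1)] by (auto simp: L2_set_def)
  then have "emeasure (Pi\<^sub>M I (\<lambda>_. lborel)) B
      \<le> emeasure (Pi\<^sub>M I (\<lambda>_. lborel)) ({f. sqrt (\<Sum>i\<in>I. (f i)\<^sup>2) \<le> d / 2} \<inter> space (Pi\<^sub>M I (\<lambda>_. lborel)))"
    by (rule emeasure_mono) measurable
  also have "\<dots> = ennreal (unit_ball_vol (card I) * (d / 2) ^ card I)"
    by (rule emeasure_cball_aux) (use assms in auto)
  finally show ?thesis
    using B(2) by simp
qed

section \<open>Hausdorff measure dominates Lebesgue measure\<close>

definition embed_Rn :: "nat \<Rightarrow> (nat \<Rightarrow> real) \<Rightarrow> real finseq"
  where "embed_Rn m f = Finseq (\<lambda>i. if i < m then f i else 0)"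

lemma coord_Finseq: "finite {i. f i \<noteq> 0} \<Longrightarrow> coord (Finseq f) = f"
  by (simp add: Finseq_inverse)

lemma coord_embed_Rn: "coord (embed_Rn m f) i = (if i < m then f i else 0)"
proof -
  have "finite {i. (if i < m then f i else 0) \<noteq> 0}"
    by (rule finite_subset[of _ "{..<m}"]) auto
  then show ?thesis
    by (simp add: embed_Rn_def coord_Finseq)
qed

lemma dist_embed_Rn: "dist (embed_Rn m f) (embed_Rn m g) = L2_set (\<lambda>i. f i - g i) {..<m}"
  unfolding dist_norm
  by (subst norm_finseq_eq_L2_set[of m])
    (auto simp: coord_embed_Rn L2_set_def)

lemma norm_embed_Rn: "norm (embed_Rn m f) = L2_set f {..<m}"
  by (subst norm_finseq_eq_L2_set[of m]) (auto simp: coord_embed_Rn L2_set_def)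

lemma embed_Rn_in_Rn: "embed_Rn m f \<in> Rn m"
  by (simp add: Rn_def coord_embed_Rn)

text \<open>The sets of a Hausdorff cover are arbitrary, while the isodiametric inequality wants
  measurable ones. The grid cells of side \<open>1 / N\<close> that meet the set are measurable and
  countably many, and their union exceeds the diameter by at most \<open>2 * m / N\<close>.\<close>

lemma measurable_superset_cells:
  fixes C :: "real finseq set"
  assumes "bounded C" "0 < e"
  shows "\<exists>B\<in>sets (Pi\<^sub>M {..<m} (\<lambda>_. lborel)). {f \<in> space (Pi\<^sub>M {..<m} (\<lambda>_. lborel)). embed_Rn m f \<in> C} \<subseteq> B \<and>
    (\<forall>f\<in>B. \<forall>g\<in>B. L2_set (\<lambda>j. f j - g j) {..<m} \<le> diameter C + e)"
proof -
  let ?M = "Pi\<^sub>M {..<m} (\<lambda>_. lborel) :: (nat \<Rightarrow> real) measure"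
  obtain N :: nat where N: "2 * real m / e < real N" "0 < N"
    using reals_Archimedean2[of "max 1 (2 * real m / e)"] by auto
  define cell where "cell f = restrict (\<lambda>j. \<lfloor>real N * f j\<rfloor>) {..<m}" for f :: "nat \<Rightarrow> real"
  define K where "K = cell ` {f \<in> space ?M. embed_Rn m f \<in> C}"
  define B where "B = (\<Union>k\<in>K. {f \<in> space ?M. \<forall>j\<in>{..<m}. \<lfloor>real N * f j\<rfloor> = k j})"
  have "countable (Pi\<^sub>E {..<m} (\<lambda>_. UNIV :: int set))"
    by (rule countable_PiE) auto
  moreover have "K \<subseteq> Pi\<^sub>E {..<m} (\<lambda>_. UNIV)"
    unfolding K_def cell_def by (auto simp only: image_subset_iff restrict_PiE_iff UNIV_I)
  ultimately have "countable K"
    by (rule countable_subset[rotated])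
  moreover have "{f \<in> space ?M. \<forall>j\<in>{..<m}. \<lfloor>real N * f j\<rfloor> = k j} \<in> sets ?M" for k
    by measurable
  ultimately have "B \<in> sets ?M"
    unfolding B_def by (intro sets.countable_UN') auto
  moreover have "{f \<in> space ?M. embed_Rn m f \<in> C} \<subseteq> B"
  proof
    fix f assume f: "f \<in> {f \<in> space ?M. embed_Rn m f \<in> C}"
    then show "f \<in> B"
      unfolding B_def by (intro UN_I[of "cell f"]) (auto simp: K_def cell_def)
  qed
  moreover have "L2_set (\<lambda>j. f j - g j) {..<m} \<le> diameter C + e" if f: "f \<in> B" and g: "g \<in> B" for f g
  proof -
    have near: "\<exists>f'. embed_Rn m f' \<in> C \<and> L2_set (\<lambda>j. f j - f' j) {..<m} \<le> real m / real N" if "f \<in> B" for f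
    proof -
      obtain k where "k \<in> K" and k: "\<forall>j\<in>{..<m}. \<lfloor>real N * f j\<rfloor> = k j"
        using \<open>f \<in> B\<close> unfolding B_def by blast
      then obtain f' where f': "embed_Rn m f' \<in> C" "k = cell f'"
        unfolding K_def by blast
      have f'2: "\<lfloor>real N * f j\<rfloor> = \<lfloor>real N * f' j\<rfloor>" if "j < m" for j
        using k f'(2) that by (simp add: cell_def)
      have "L2_set (\<lambda>j. f j - f' j) {..<m} \<le> (\<Sum>j<m. \<bar>f j - f' j\<bar>)"
        by (rule L2_set_le_sum_abs)
      also have "\<dots> \<le> (\<Sum>j<m. 1 / real N)"
      proof (rule sum_mono)
        fix j assume "j \<in> {..<m}"
        then have "\<bar>real N * f j - real N * f' j\<bar> < 1"
          using f'2[of j] by (simp, linarith)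
        then have "real N * \<bar>f j - f' j\<bar> < 1"
          by (metis abs_mult abs_of_nat right_diff_distrib)
        then show "\<bar>f j - f' j\<bar> \<le> 1 / real N"
          using N by (simp add: field_simps)
      qed
      finally show ?thesis
        using f'(1) by auto
    qed
    obtain f' g' where f': "embed_Rn m f' \<in> C" "L2_set (\<lambda>j. f j - f' j) {..<m} \<le> real m / real N"
      and g': "embed_Rn m g' \<in> C" "L2_set (\<lambda>j. g j - g' j) {..<m} \<le> real m / real N"
      using near[OF f] near[OF g] by auto
    have "dist (embed_Rn m f) (embed_Rn m g) \<le> dist (embed_Rn m f) (embed_Rn m f') + dist (embed_Rn m f') (embed_Rn m g')
        + dist (embed_Rn m g) (embed_Rn m g')"
      by metric
    also have "dist (embed_Rn m f') (embed_Rn m g') \<le> diameter C"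
      using f' g' assms by (intro diameter_bounded_bound)
    finally have "L2_set (\<lambda>j. f j - g j) {..<m} \<le> diameter C + 2 * (real m / real N)"
      using f' g' by (simp add: dist_embed_Rn)
    also have "2 * (real m / real N) \<le> e"
      using N assms by (simp add: field_simps)
    finally show ?thesis by simp
  qed
  ultimately show ?thesis by blast
qed

lemma hausdorff_gauge_nat:
  assumes "1 \<le> m" "C \<noteq> {}" "bounded C"
  shows "hausdorff_gauge (real m) C = ennreal (unit_ball_vol m * (diameter C / 2) ^ m)"
proof (cases "diameter C = 0")
  case False
  then have "0 < diameter C"
    using diameter_ge_0[OF assms(3)] by simp
  then show ?thesis
    using assms by (simp add: hausdorff_gauge_def powr_realpow)
qed (use assms in \<open>simp add: hausdorff_gauge_def\<close>)

theorem lebesgue_le_hausdorff: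
  assumes m: "1 \<le> m" and B: "B \<in> sets (Pi\<^sub>M {..<m} (\<lambda>_. lborel))" and sub: "embed_Rn m ` B \<subseteq> A"
  shows "emeasure (Pi\<^sub>M {..<m} (\<lambda>_. lborel)) B \<le> hausdorff_outer (real m) A"
proof -
  let ?M = "Pi\<^sub>M {..<m} (\<lambda>_. lborel) :: (nat \<Rightarrow> real) measure"
  \<comment> \<open>Scale 1 is an arbitrary choice: the isodiametric inequality compares a covering
    set with its gauge whatever its diameter is.\<close>
  have "emeasure ?M B \<le> hausdorff_pre (real m) 1 A"
    unfolding hausdorff_pre_def
  proof (rule INF_greatest)
    fix C assume C: "C \<in> hausdorff_cover 1 A"
    show "emeasure ?M B \<le> (\<Sum>i. hausdorff_gauge (real m) (C i))"
    proof (rule ennreal_le_epsilon)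
      fix e :: real assume e: "0 < e"
      have "\<exists>D\<in>sets ?M. {f \<in> space ?M. embed_Rn m f \<in> C i} \<subseteq> D \<and>
          emeasure ?M D \<le> hausdorff_gauge (real m) (C i) + ennreal (e * (1/2) ^ Suc i)" for i
      proof (cases "C i = {}")
        case False
        have bd: "bounded (C i)"
          using C by (auto simp: hausdorff_cover_def)
        \<comment> \<open>The passage to grid cells enlarges the diameter by some
          \<open>t > 0\<close>; continuity of \<open>\<phi>\<close> at 0 keeps the cost below the
          \<open>i\<close>-th term of a series with sum \<open>e\<close>.\<close>
        define \<phi> where "\<phi> t = unit_ball_vol m * ((diameter (C i) + t) / 2) ^ m" for t
        have "(\<phi> \<longlongrightarrow> \<phi> 0) (at_right 0)"
          unfolding \<phi>_def by (intro tendsto_intros) auto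
        moreover have "\<phi> 0 < \<phi> 0 + e * (1/2) ^ Suc i"
          using e by simp
        ultimately have "eventually (\<lambda>t. \<phi> t < \<phi> 0 + e * (1/2) ^ Suc i) (at_right 0)"
          by (rule order_tendstoD)
        moreover have "eventually (\<lambda>t::real. 0 < t) (at_right 0)"
          by (simp add: eventually_at_right_less)
        ultimately have "eventually (\<lambda>t. \<phi> t < \<phi> 0 + e * (1/2) ^ Suc i \<and> 0 < t) (at_right 0)"
          by eventually_elim auto
        then obtain t where t: "\<phi> t < \<phi> 0 + e * (1/2) ^ Suc i" "0 < t"
          using eventually_happens'[of "at_right (0::real)"] by auto
        obtain D where D: "D \<in> sets ?M"
          and D': "{f \<in> space ?M. embed_Rn m f \<in> C i} \<subseteq> D \<and>
            (\<forall>f\<in>D. \<forall>g\<in>D. L2_set (\<lambda>j. f j - g j) {..<m} \<le> diameter (C i) + t)"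
          using measurable_superset_cells[OF bd t(2), of m] by (rule bexE)
        have "emeasure ?M D \<le> ennreal (unit_ball_vol (card {..<m}) * ((diameter (C i) + t) / 2) ^ card {..<m})"
        proof (rule isodiametric_inequality[OF _ D])
          show "0 < diameter (C i) + t"
            using t(2) diameter_ge_0[OF bd] by linarith
        qed (use D' in blast)+
        also have "\<dots> = ennreal (\<phi> t)"
          by (simp add: \<phi>_def)
        finally have "emeasure ?M D \<le> ennreal (\<phi> t)" .
        also have "\<dots> \<le> ennreal (\<phi> 0 + e * (1/2) ^ Suc i)"
          using t by (intro ennreal_leI) auto
        also have "\<dots> = hausdorff_gauge (real m) (C i) + ennreal (e * (1/2) ^ Suc i)"
          using e diameter_ge_0[OF bd] by (subst ennreal_plus) (auto simp: \<phi>_def hausdorff_gauge_nat[OF m False bd])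
        finally show ?thesis
          using D D' by (intro bexI[of _ D]) simp_all
      next
        case True
        then show ?thesis
          by (intro bexI[of _ "{}"]) auto
      qed
      then have "\<forall>i. \<exists>D. D \<in> sets ?M \<and> {f \<in> space ?M. embed_Rn m f \<in> C i} \<subseteq> D \<and>
          emeasure ?M D \<le> hausdorff_gauge (real m) (C i) + ennreal (e * (1/2) ^ Suc i)"
        by (simp only: Bex_def) blast
      from choice[OF this] obtain D where "\<forall>i. D i \<in> sets ?M \<and> {f \<in> space ?M. embed_Rn m f \<in> C i} \<subseteq> D i \<and>
          emeasure ?M (D i) \<le> hausdorff_gauge (real m) (C i) + ennreal (e * (1/2) ^ Suc i)"
        by (rule exE)
      then have D: "\<And>i. D i \<in> sets ?M" "\<And>i. {f \<in> space ?M. embed_Rn m f \<in> C i} \<subseteq> D i"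
        "\<And>i. emeasure ?M (D i) \<le> hausdorff_gauge (real m) (C i) + ennreal (e * (1/2) ^ Suc i)"
        by blast+
      have "B \<subseteq> (\<Union>i. D i)"
      proof
        fix f assume f: "f \<in> B"
        then have "embed_Rn m f \<in> A" "f \<in> space ?M"
          using sub sets.sets_into_space[OF B] by auto
        moreover have "A \<subseteq> (\<Union>i. C i)"
          using C by (auto simp: hausdorff_cover_def)
        ultimately show "f \<in> (\<Union>i. D i)"
          using D(2) by blast
      qed
      then have "emeasure ?M B \<le> emeasure ?M (\<Union>i. D i)"
        using D(1) by (intro emeasure_mono) auto
      also have "\<dots> \<le> (\<Sum>i. emeasure ?M (D i))"
        using D(1) by (intro emeasure_subadditive_countably) auto
      also have "\<dots> \<le> (\<Sum>i. hausdorff_gauge (real m) (C i) + ennreal (e * (1/2) ^ Suc i))"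
        by (intro suminf_le D(3)) auto
      also have "\<dots> = (\<Sum>i. hausdorff_gauge (real m) (C i)) + (\<Sum>i. ennreal e * ennreal ((1/2) ^ Suc i))"
        using e by (subst suminf_add[symmetric])
          (auto simp del: ennreal_suminf_cmult simp add: ennreal_mult[symmetric])
      also have "\<dots> = (\<Sum>i. hausdorff_gauge (real m) (C i)) + ennreal e"
        unfolding ennreal_suminf_cmult
        by (subst suminf_ennreal_eq[OF zero_le_power power_half_series]) auto
      finally show "emeasure ?M B \<le> (\<Sum>i. hausdorff_gauge (real m) (C i)) + ennreal e" .
    qed
  qed
  also have "\<dots> \<le> hausdorff_outer (real m) A"
    unfolding hausdorff_outer_def by (rule SUP_upper) simp
  finally show ?thesis .
qed

corollary hausdorff_cball_Rn_ge:
  assumes "1 \<le> m" "0 < \<rho>" "\<And>u. u \<in> Rn m \<Longrightarrow> norm u \<le> \<rho> \<Longrightarrow> u \<in> A"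
  shows "ennreal (unit_ball_vol m * \<rho> ^ m) \<le> hausdorff_outer (real m) A"
proof -
  let ?M = "Pi\<^sub>M {..<m} (\<lambda>_. lborel) :: (nat \<Rightarrow> real) measure"
  let ?B = "{f. sqrt (\<Sum>i\<in>{..<m}. (f i)\<^sup>2) \<le> \<rho>} \<inter> space ?M"
  have "emeasure ?M ?B \<le> hausdorff_outer (real m) A"
  proof (rule lebesgue_le_hausdorff[OF assms(1)])
    show "embed_Rn m ` ?B \<subseteq> A"
      using embed_Rn_in_Rn by (auto intro!: assms(3) simp: norm_embed_Rn L2_set_def)
  qed measurable
  then show ?thesis
    using emeasure_cball_aux[of "{..<m}" \<rho>] assms by simp
qed

corollary hausdorff_box_ge:
  assumes "1 \<le> m" "0 \<le> a" "\<And>u. u \<in> Rn m \<Longrightarrow> (\<And>i. i < m \<Longrightarrow> 0 \<le> coord u i \<and> coord u i \<le> a) \<Longrightarrow> u \<in> A"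
  shows "ennreal (a ^ m) \<le> hausdorff_outer (real m) A"
proof -
  interpret product_sigma_finite "\<lambda>_::nat. lborel :: real measure"
    by standard
  let ?M = "Pi\<^sub>M {..<m} (\<lambda>_. lborel) :: (nat \<Rightarrow> real) measure"
  have "emeasure ?M (Pi\<^sub>E {..<m} (\<lambda>_. {0..a})) \<le> hausdorff_outer (real m) A"
  proof (rule lebesgue_le_hausdorff[OF assms(1)])
    show "Pi\<^sub>E {..<m} (\<lambda>_. {0..a}) \<in> sets ?M"
      by (rule sets_PiM_I_finite) auto
    show "embed_Rn m ` Pi\<^sub>E {..<m} (\<lambda>_. {0..a}) \<subseteq> A"
      using assms(3)[OF embed_Rn_in_Rn] by (fastforce simp: coord_embed_Rn PiE_iff)
  qed
  then show ?thesis
    using emeasure_PiM[of "{..<m}" "\<lambda>_. {0..a}"] assms(2) by (simp add: ennreal_power)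
qed

section \<open>Hausdorff measures under Lipschitz maps and in products\<close>

lemma diameter_le_dist:
  fixes S :: "'a::metric_space set"
  assumes "0 \<le> d" "\<And>x y. x \<in> S \<Longrightarrow> y \<in> S \<Longrightarrow> dist x y \<le> d"
  shows "diameter S \<le> d"
  using assms by (auto simp: diameter_def intro!: cSUP_least)

lemma bounded_dist_le:
  fixes S :: "'a::metric_space set"
  assumes "\<And>x y. x \<in> S \<Longrightarrow> y \<in> S \<Longrightarrow> dist x y \<le> d"
  shows "bounded S"
  using assms by (meson bounded_def ex_in_conv)

lemma hausdorff_gauge_le:
  assumes "0 < s" "bounded C" "diameter C \<le> D"
  shows "hausdorff_gauge s C \<le> ennreal (unit_ball_vol s * (D / 2) powr s)"
proof (cases "C = {}")
  case False
  then show ?thesis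
    using assms diameter_ge_0[OF assms(2)]
    by (auto simp: hausdorff_gauge_def intro!: ennreal_leI mult_left_mono powr_mono2)
qed (simp add: hausdorff_gauge_def)

lemma hausdorff_pre_le_sum:
  assumes "finite F" "A \<subseteq> (\<Union>i\<in>F. C i)" "0 \<le> d" "\<And>i. i \<in> F \<Longrightarrow> bounded (C i) \<and> diameter (C i) \<le> d"
  shows "hausdorff_pre s d A \<le> (\<Sum>i\<in>F. hausdorff_gauge s (C i))"
proof -
  obtain h where h: "bij_betw h {..<card F} F"
    using ex_bij_betw_nat_finite[OF assms(1)] atLeast0LessThan by auto
  define C' where "C' i = (if i < card F then C (h i) else {})" for i
  have hF: "h i \<in> F" if "i < card F" for i
    using h that by (auto simp: bij_betw_def)
  have "A \<subseteq> (\<Union>i. C' i)"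
  proof
    fix a assume "a \<in> A"
    then obtain j where j: "j \<in> F" "a \<in> C j"
      using assms(2) by auto
    then obtain i where "i < card F" "h i = j"
      using h unfolding bij_betw_def by (metis imageE lessThan_iff)
    then show "a \<in> (\<Union>i. C' i)"
      using j by (auto simp: C'_def)
  qed
  then have "C' \<in> hausdorff_cover d A"
    using assms(3,4) hF by (auto simp: hausdorff_cover_def C'_def)
  then have "hausdorff_pre s d A \<le> (\<Sum>i. hausdorff_gauge s (C' i))"
    unfolding hausdorff_pre_def by (rule INF_lower)
  also have "\<dots> = (\<Sum>i<card F. hausdorff_gauge s (C' i))"
    by (rule suminf_finite) (auto simp: C'_def hausdorff_gauge_def)
  also have "\<dots> = (\<Sum>i<card F. hausdorff_gauge s (C (h i)))"
    by (rule sum.cong) (auto simp: C'_def)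
  also have "\<dots> = (\<Sum>i\<in>F. hausdorff_gauge s (C i))"
    by (rule sum.reindex_bij_betw[OF h])
  finally show ?thesis .
qed

lemma hausdorff_outer_gt_pre:
  assumes "h < hausdorff_outer s A"
  shows "\<exists>d>0. h < hausdorff_pre s d A"
  using assms unfolding hausdorff_outer_def less_SUP_iff by auto

lemma hausdorff_pre_le_outer: "0 < d \<Longrightarrow> hausdorff_pre s d A \<le> hausdorff_outer s A"
  unfolding hausdorff_outer_def by (rule SUP_upper) simp

lemma hausdorff_outer_image_le:
  fixes f :: "'a::metric_space \<Rightarrow> 'b::metric_space"
  assumes s: "0 < s" and L: "0 < L" and f: "\<And>x y. x \<in> A \<Longrightarrow> y \<in> A \<Longrightarrow> dist (f x) (f y) \<le> L * dist x y"
  shows "hausdorff_outer s (f ` A) \<le> ennreal (L powr s) * hausdorff_outer s A"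
  unfolding hausdorff_outer_def[of s "f ` A"]
proof (rule SUP_least)
  fix d :: real assume "d \<in> {0<..}"
  then have d: "0 < d" by simp
  have "hausdorff_pre s d (f ` A) \<le> ennreal (L powr s) * (\<Sum>i. hausdorff_gauge s (C i))"
    if C: "C \<in> hausdorff_cover (d / L) A" for C
  proof -
    \<comment> \<open>The cut with \<open>A\<close> is there because \<open>f\<close> is Lipschitz
      only on \<open>A\<close>.\<close>
    define C' where "C' i = f ` (C i \<inter> A)" for i
    have bd: "bounded (C i)" "diameter (C i) \<le> d / L" "A \<subseteq> (\<Union>i. C i)" for i
      using C by (auto simp: hausdorff_cover_def)
    have dist: "dist x y \<le> L * diameter (C i)" if xy: "x \<in> C' i" "y \<in> C' i" for i x y
    proof -
      obtain x' y' where x': "x' \<in> C i" "x' \<in> A" "x = f x'" and y': "y' \<in> C i" "y' \<in> A" "y = f y'"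
        using xy by (auto simp: C'_def)
      have "dist x y \<le> L * dist x' y'"
        using f x' y' by simp
      also have "\<dots> \<le> L * diameter (C i)"
        using L x' y' by (intro mult_left_mono diameter_bounded_bound[OF bd(1)]) auto
      finally show ?thesis .
    qed
    have b': "bounded (C' i)" for i
      using bounded_dist_le[OF dist] .
    have d': "diameter (C' i) \<le> L * diameter (C i)" for i
      using L diameter_ge_0[OF bd(1)] by (intro diameter_le_dist dist) auto
    have "diameter (C' i) \<le> d" for i
    proof -
      have "L * diameter (C i) \<le> L * (d / L)"
        using L bd(2) by (intro mult_left_mono) auto
      then show ?thesis
        using d'[of i] L by simp
    qed
    moreover have "f ` A \<subseteq> (\<Union>i. C' i)"
      using bd(3) unfolding C'_def by blast
    ultimately have "C' \<in> hausdorff_cover d (f ` A)"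
      using b' by (auto simp: hausdorff_cover_def)
    then have "hausdorff_pre s d (f ` A) \<le> (\<Sum>i. hausdorff_gauge s (C' i))"
      unfolding hausdorff_pre_def by (rule INF_lower)
    also have "\<dots> \<le> (\<Sum>i. ennreal (L powr s) * hausdorff_gauge s (C i))"
    proof (intro suminf_le allI)
      fix i
      show "hausdorff_gauge s (C' i) \<le> ennreal (L powr s) * hausdorff_gauge s (C i)"
      proof (cases "C i = {}")
        case False
        have "hausdorff_gauge s (C' i) \<le> ennreal (unit_ball_vol s * (L * diameter (C i) / 2) powr s)"
          by (rule hausdorff_gauge_le[OF s b' d'])
        also have "unit_ball_vol s * (L * diameter (C i) / 2) powr s
            = L powr s * (unit_ball_vol s * (diameter (C i) / 2) powr s)"
          using L diameter_ge_0[OF bd(1)] by (simp add: powr_mult powr_divide)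
        also have "ennreal \<dots> = ennreal (L powr s) * hausdorff_gauge s (C i)"
          using False s by (simp add: hausdorff_gauge_def ennreal_mult)
        finally show ?thesis .
      qed (simp add: C'_def hausdorff_gauge_def)
    qed auto
    also have "\<dots> = ennreal (L powr s) * (\<Sum>i. hausdorff_gauge s (C i))"
      by (rule ennreal_suminf_cmult)
    finally show ?thesis .
  qed
  then have "hausdorff_pre s d (f ` A) / ennreal (L powr s) \<le> hausdorff_pre s (d / L) A"
    unfolding hausdorff_pre_def[of s "d / L"] using L
    by (intro INF_greatest divide_le_posI_ennreal) (auto simp: mult.commute)
  also have "\<dots> \<le> hausdorff_outer s A"
    using d L by (intro hausdorff_pre_le_outer) simp
  finally have "ennreal (L powr s) * (hausdorff_pre s d (f ` A) / ennreal (L powr s))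
      \<le> ennreal (L powr s) * hausdorff_outer s A"
    by (rule mult_left_mono) simp
  also have "ennreal (L powr s) * (hausdorff_pre s d (f ` A) / ennreal (L powr s)) = hausdorff_pre s d (f ` A)"
    using L mult_divide_eq_ennreal[of "ennreal (L powr s)" "hausdorff_pre s d (f ` A)"]
    by (simp add: ennreal_times_divide mult.commute[of "ennreal (L powr s)"])
  finally show "hausdorff_pre s d (f ` A) \<le> ennreal (L powr s) * hausdorff_outer s A" .
qed

corollary hausdorff_outer_image_le_1:
  fixes f :: "'a::metric_space \<Rightarrow> 'b::metric_space"
  assumes "0 < s" "\<And>x y. x \<in> A \<Longrightarrow> y \<in> A \<Longrightarrow> dist (f x) (f y) \<le> dist x y"
  shows "hausdorff_outer s (f ` A) \<le> hausdorff_outer s A"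
  using hausdorff_outer_image_le[of s 1 A f] assms by simp

lemma norm_coord_le: "norm (coord x i) \<le> norm (x :: 'a::real_inner finseq)"
proof -
  obtain N where N: "\<forall>j\<in>{j. coord x j \<noteq> 0}. j < N"
    using finite_nat_bounded[OF finite_support[of x]] by auto
  have "norm x = L2_set (\<lambda>i. norm (coord x i)) {..<max N (Suc i)}"
    using N by (intro norm_finseq_eq_L2_set) force
  moreover have "norm (coord x i) \<le> L2_set (\<lambda>i. norm (coord x i)) {..<max N (Suc i)}"
    by (rule member_le_L2_set) auto
  ultimately show ?thesis by simp
qed

lemma dist_coord_le: "dist (coord x i) (coord y i) \<le> dist x (y :: 'a::real_inner finseq)"
  using norm_coord_le[of "x - y" i] by (simp add: dist_norm)

lemma norm_le_sum_coord:
  assumes "\<forall>i\<ge>n. coord x i = 0"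
  shows "norm x \<le> (\<Sum>i<n. norm (coord (x :: 'a::real_inner finseq) i))"
  using L2_set_le_sum_abs[of "\<lambda>i. norm (coord x i)" "{..<n}"] norm_finseq_eq_L2_set[OF assms] by simp

definition unit_cube :: "nat \<Rightarrow> real finseq set"
  where "unit_cube k = {u \<in> Rn k. \<forall>i<k. 0 \<le> coord u i \<and> coord u i \<le> 1}"

text \<open>The \<open>N ^ k\<close> subcubes of side \<open>1 / N\<close> have diameter at most
  \<open>k / N\<close>, so their total gauge bound does not depend on \<open>N\<close>. The result
  guarantees that simplices have finite measure.\<close>

lemma hausdorff_unit_cube_finite:
  assumes k: "1 \<le> k"
  shows "hausdorff_outer (real k) (unit_cube k) < \<infinity>"
proof -
  let ?K = "unit_ball_vol k * (real k / 2) ^ k"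
  have "hausdorff_outer (real k) (unit_cube k) \<le> ennreal ?K"
    unfolding hausdorff_outer_def
  proof (rule SUP_least)
    fix d :: real assume "d \<in> {0<..}"
    then have d: "0 < d" by simp
    obtain N :: nat where N: "max 1 (real k / d) < real N"
      using reals_Archimedean2 by blast
    then have N0: "0 < real N" and Nd: "real k / real N \<le> d"
      using d by (auto simp: field_simps)
    define F where "F = Pi\<^sub>E {..<k} (\<lambda>_. {..<N})"
    define C where "C \<phi> = {u \<in> Rn k. \<forall>i<k. real (\<phi> i) / N \<le> coord u i \<and> coord u i \<le> (real (\<phi> i) + 1) / N}"
      for \<phi> :: "nat \<Rightarrow> nat"
    have F: "finite F" "card F = N ^ k"
      unfolding F_def by (auto intro!: finite_PiE simp: card_PiE)
    have dist: "dist u v \<le> real k / N" if "u \<in> C \<phi>" "v \<in> C \<phi>" for u v \<phi>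
    proof -
      have "dist u v \<le> (\<Sum>i<k. norm (coord (u - v) i))"
        unfolding dist_norm using that by (intro norm_le_sum_coord) (auto simp: C_def Rn_def)
      also have "\<dots> \<le> (\<Sum>i<k. 1 / real N)"
      proof (rule sum_mono)
        fix i assume "i \<in> {..<k}"
        then show "norm (coord (u - v) i) \<le> 1 / real N"
          using that by (auto simp: C_def add_divide_distrib abs_le_iff algebra_simps) (smt (verit))+
      qed
      finally show ?thesis by simp
    qed
    have bC: "bounded (C \<phi>)" "diameter (C \<phi>) \<le> real k / N" for \<phi>
      using dist by (auto intro: bounded_dist_le diameter_le_dist)
    have cov: "unit_cube k \<subseteq> (\<Union>\<phi>\<in>F. C \<phi>)"
    proof
      fix u assume u: "u \<in> unit_cube k"
      have "\<exists>j<N. real j / N \<le> coord u i \<and> coord u i \<le> (real j + 1) / N" if "i < k" for i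
      proof -
        have c: "0 \<le> coord u i" "coord u i \<le> 1"
          using u that by (auto simp: unit_cube_def)
        show ?thesis
        proof (cases "coord u i = 1")
          case True
          then show ?thesis
            using N0 by (intro exI[of _ "N - 1"]) (auto simp: of_nat_diff)
        next
          case False
          define j where "j = nat \<lfloor>real N * coord u i\<rfloor>"
          have "0 \<le> real N * coord u i" "real N * coord u i < real N"
            using c False N0 by auto
          then have "real j \<le> real N * coord u i" "real N * coord u i < real j + 1" "j < N"
            unfolding j_def by linarith+
          then show ?thesis
            using N0 by (intro exI[of _ j]) (auto simp: field_simps)
        qed
      qed
      then obtain \<phi> where \<phi>: "\<And>i. i < k \<Longrightarrow> \<phi> i < N \<and> real (\<phi> i) / N \<le> coord u i \<and> coord u i \<le> (real (\<phi> i) + 1) / N"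
        by metis
      have "restrict \<phi> {..<k} \<in> F"
        using \<phi> by (auto simp: F_def)
      moreover have "u \<in> C (restrict \<phi> {..<k})"
        using \<phi> u by (auto simp: C_def unit_cube_def)
      ultimately show "u \<in> (\<Union>\<phi>\<in>F. C \<phi>)" by blast
    qed
    have "hausdorff_pre (real k) d (unit_cube k) \<le> (\<Sum>\<phi>\<in>F. hausdorff_gauge (real k) (C \<phi>))"
      using F cov d bC Nd by (intro hausdorff_pre_le_sum) (auto intro: order_trans)
    also have "\<dots> \<le> (\<Sum>\<phi>\<in>F. ennreal (unit_ball_vol k * (real k / N / 2) powr k))"
      using k bC by (intro sum_mono hausdorff_gauge_le) auto
    also have "\<dots> = ennreal (real (N ^ k) * (unit_ball_vol k * (real k / N / 2) ^ k))"
      using k N0 F by (simp add: powr_realpow ennreal_mult ennreal_of_nat_eq_real_of_nat)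
    also have "real (N ^ k) * (unit_ball_vol k * (real k / N / 2) ^ k) = ?K"
      using N0 by (simp add: power_divide)
    finally show "hausdorff_pre (real k) d (unit_cube k) \<le> ennreal ?K" .
  qed
  then show ?thesis
    by (rule le_less_trans) simp
qed

section \<open>Vitali coverings and lower bounds for the measure of products\<close>

lemma finite_disjoint_balls:
  fixes c :: "'i \<Rightarrow> 'a::metric_space"
  assumes "finite J" "\<And>i. i \<in> J \<Longrightarrow> 0 < \<rho> i"
  shows "\<exists>F\<subseteq>J. (\<forall>i\<in>F. \<forall>j\<in>F. i \<noteq> j \<longrightarrow> ball (c i) (\<rho> i) \<inter> ball (c j) (\<rho> j) = {}) \<and>
    (\<Union>j\<in>J. ball (c j) (\<rho> j)) \<subseteq> (\<Union>i\<in>F. ball (c i) (3 * \<rho> i))"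
  using assms
proof (induction J rule: finite_psubset_induct)
  case (psubset J)
  show ?case
  proof (cases "J = {}")
    case False
    \<comment> \<open>A ball meeting the largest one has no larger radius and so lies in its
      threefold enlargement; the balls disjoint from it are left to the induction.\<close>
    have "Max (\<rho> ` J) \<in> \<rho> ` J"
      using psubset False by (intro Max_in) auto
    then obtain i where "i \<in> J" "Max (\<rho> ` J) = \<rho> i"
      by blast
    then have i: "i \<in> J" "\<And>j. j \<in> J \<Longrightarrow> \<rho> j \<le> \<rho> i"
      using Max_ge[OF finite_imageI[OF psubset.hyps(1), of \<rho>]] by auto
    define J' where "J' = {j \<in> J. ball (c j) (\<rho> j) \<inter> ball (c i) (\<rho> i) = {}}"
    have "c i \<in> ball (c i) (\<rho> i)"
      using psubset.prems i by auto
    then have "i \<notin> J'"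
      by (auto simp: J'_def)
    moreover have "J' \<subseteq> J"
      by (auto simp: J'_def)
    ultimately have "J' \<subset> J"
      using i by blast
    then obtain F where F: "F \<subseteq> J'" "\<forall>i\<in>F. \<forall>j\<in>F. i \<noteq> j \<longrightarrow> ball (c i) (\<rho> i) \<inter> ball (c j) (\<rho> j) = {}"
      "(\<Union>j\<in>J'. ball (c j) (\<rho> j)) \<subseteq> (\<Union>i\<in>F. ball (c i) (3 * \<rho> i))"
      using psubset.IH[of J'] psubset.prems by (auto simp: J'_def)
    have "ball (c j) (\<rho> j) \<subseteq> (\<Union>i\<in>insert i F. ball (c i) (3 * \<rho> i))" if j: "j \<in> J" for j
    proof (cases "j \<in> J'")
      case False
      then obtain y where y: "dist (c j) y < \<rho> j" "dist (c i) y < \<rho> i"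
        using j by (auto simp: J'_def)
      have "ball (c j) (\<rho> j) \<subseteq> ball (c i) (3 * \<rho> i)"
      proof
        fix z assume "z \<in> ball (c j) (\<rho> j)"
        then have "dist (c j) z < \<rho> j" by simp
        moreover have "dist (c i) z \<le> dist (c i) y + dist (c j) y + dist (c j) z"
          by metric
        ultimately show "z \<in> ball (c i) (3 * \<rho> i)"
          using y i(2)[OF j] by simp
      qed
      then show ?thesis by blast
    qed (use F(3) in blast)
    then show ?thesis
      using F i by (intro exI[of _ "insert i F"]) (auto simp: J'_def)
  qed auto
qed

text \<open>Weighted coverings are as expensive as unweighted ones, up to enlarging the balls: layers of
  disjoint balls are peeled off, so that every point loses at most the weight of one ball.\<close>

lemma weighted_covering:
  fixes c :: "'i \<Rightarrow> 'a::metric_space"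
  assumes I: "finite I" "\<And>i. i \<in> I \<Longrightarrow> 0 < \<rho> i" and g: "\<And>i. i \<in> I \<Longrightarrow> 0 \<le> g i" and h: "0 \<le> h"
    and cov: "\<And>F. F \<subseteq> I \<Longrightarrow> A \<subseteq> (\<Union>i\<in>F. ball (c i) (3 * \<rho> i)) \<Longrightarrow> h \<le> (\<Sum>i\<in>F. g i)"
    and w: "\<And>i. i \<in> I \<Longrightarrow> 0 \<le> w i"
    and T: "\<And>a. a \<in> A \<Longrightarrow> T \<le> (\<Sum>i | i \<in> I \<and> a \<in> ball (c i) (\<rho> i). w i)"
  shows "T * h \<le> (\<Sum>i\<in>I. w i * (g i :: real))"
  using w T
proof (induction "card {i \<in> I. 0 < w i}" arbitrary: w T rule: less_induct)
  case less
  have nonneg: "0 \<le> (\<Sum>i\<in>I. w i * g i)"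
    using less.prems g by (intro sum_nonneg) auto
  define J where "J = {i \<in> I. 0 < w i}"
  have J: "finite J" "\<And>i. i \<in> J \<Longrightarrow> 0 < \<rho> i"
    using I by (auto simp: J_def)
  obtain F where F': "F \<subseteq> J \<and> (\<forall>i\<in>F. \<forall>j\<in>F. i \<noteq> j \<longrightarrow> ball (c i) (\<rho> i) \<inter> ball (c j) (\<rho> j) = {}) \<and>
    (\<Union>j\<in>J. ball (c j) (\<rho> j)) \<subseteq> (\<Union>i\<in>F. ball (c i) (3 * \<rho> i))"
    using finite_disjoint_balls[of J \<rho> c, OF J] by (rule exE)
  then have F: "F \<subseteq> J" "\<And>i j. i \<in> F \<Longrightarrow> j \<in> F \<Longrightarrow> i \<noteq> j \<Longrightarrow> ball (c i) (\<rho> i) \<inter> ball (c j) (\<rho> j) = {}"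
    "(\<Union>j\<in>J. ball (c j) (\<rho> j)) \<subseteq> (\<Union>i\<in>F. ball (c i) (3 * \<rho> i))"
    by blast+
  have FI: "F \<subseteq> I" "finite F"
    using F(1) I(1) by (auto simp: J_def intro: finite_subset)
  show ?case
  proof (cases "T \<le> 0 \<or> F = {} \<and> A = {}")
    case True
    then have "T * h \<le> 0"
      using h cov[of "{}"] by (auto simp: mult_nonpos_nonneg)
    then show ?thesis
      using nonneg by linarith
  next
    case False
    have "A \<subseteq> (\<Union>j\<in>J. ball (c j) (\<rho> j))"
    proof (rule ccontr)
      assume "\<not> ?thesis"
      then obtain a where a: "a \<in> A" "\<And>j. j \<in> J \<Longrightarrow> a \<notin> ball (c j) (\<rho> j)"
        by blast
      have "(\<Sum>i | i \<in> I \<and> a \<in> ball (c i) (\<rho> i). w i) = 0"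
        using a(2) less.prems(1) by (intro sum.neutral) (force simp: J_def)
      then show False
        using less.prems(2)[OF a(1)] False a by auto
    qed
    then have AF: "A \<subseteq> (\<Union>i\<in>F. ball (c i) (3 * \<rho> i))"
      using F(3) by blast
    then have hF: "h \<le> (\<Sum>i\<in>F. g i)"
      using cov FI by blast
    have "F \<noteq> {}"
      using AF False by auto
    \<comment> \<open>The amount peeled off either exhausts \<open>T\<close> or equals the least
      weight in \<open>F\<close>. In the second case that weight vanishes, which decreases the
      number of positive weights, the measure of the induction.\<close>
    define t where "t = min T (Min (w ` F))"
    have t0: "0 < t"
      using False F(1) FI \<open>F \<noteq> {}\<close> by (auto simp: t_def J_def)
    have tw: "t \<le> w i" if "i \<in> F" for i
      using that FI by (auto simp: t_def min_le_iff_disj)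
    define w' where "w' i = (if i \<in> F then w i - t else w i)" for i
    have w': "0 \<le> w' i" if "i \<in> I" for i
      using that tw less.prems(1) by (auto simp: w'_def)
    have sum_w': "(\<Sum>i\<in>I. w' i * g i) = (\<Sum>i\<in>I. w i * g i) - t * (\<Sum>i\<in>F. g i)"
    proof -
      have "(\<Sum>i\<in>I. w' i * g i) = (\<Sum>i\<in>I. w i * g i - (if i \<in> F then t * g i else 0))"
        by (rule sum.cong) (auto simp: w'_def algebra_simps)
      also have "\<dots> = (\<Sum>i\<in>I. w i * g i) - (\<Sum>i\<in>I. if i \<in> F then t * g i else 0)"
        by (rule sum_subtractf)
      also have "(\<Sum>i\<in>I. if i \<in> F then t * g i else 0) = (\<Sum>i\<in>F. t * g i)"
        using FI I by (subst sum.inter_restrict[symmetric]) (auto simp: Int_absorb1)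
      finally show ?thesis
        by (simp add: sum_distrib_left)
    qed
    have T': "T - t \<le> (\<Sum>i | i \<in> I \<and> a \<in> ball (c i) (\<rho> i). w' i)" if a: "a \<in> A" for a
    proof -
      let ?S = "{i. i \<in> I \<and> a \<in> ball (c i) (\<rho> i)}"
      have fS: "finite ?S"
        using I by simp
      have "card (?S \<inter> F) \<le> Suc 0"
      proof (subst card_le_Suc0_iff_eq)
        show "\<forall>i\<in>?S \<inter> F. \<forall>j\<in>?S \<inter> F. i = j"
          using F(2) by blast
      qed (use fS in simp)
      then have "real (card (?S \<inter> F)) * t \<le> 1 * t"
        using t0 by (intro mult_right_mono) auto
      moreover have "(\<Sum>i\<in>?S. w' i) = (\<Sum>i\<in>?S. w i - (if i \<in> F then t else 0))"
        by (rule sum.cong) (auto simp: w'_def)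
      then have "(\<Sum>i\<in>?S. w' i) = (\<Sum>i\<in>?S. w i) - (\<Sum>i\<in>?S. if i \<in> F then t else 0)"
        by (simp add: sum_subtractf)
      moreover have "(\<Sum>i\<in>?S. if i \<in> F then t else 0) = real (card (?S \<inter> F)) * t"
        using fS by (simp flip: sum.inter_restrict)
      ultimately show ?thesis
        using less.prems(2)[OF a] by simp
    qed
    have "(T - t) * h \<le> (\<Sum>i\<in>I. w' i * g i)"
    proof (cases "t = T")
      case True
      then show ?thesis
        using w' g by (auto intro!: sum_nonneg)
    next
      case False
      then have "t = Min (w ` F)"
        by (auto simp: t_def)
      then have "t \<in> w ` F"
        using FI \<open>F \<noteq> {}\<close> by simp
      then obtain j where j: "j \<in> F" "w j = t"
        by auto
      have "{i \<in> I. 0 < w' i} \<subset> {i \<in> I. 0 < w i}"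
      proof
        show "{i \<in> I. 0 < w' i} \<subseteq> {i \<in> I. 0 < w i}"
          using t0 by (auto simp: w'_def split: if_splits)
        show "{i \<in> I. 0 < w' i} \<noteq> {i \<in> I. 0 < w i}"
          using j F(1) by (auto simp: w'_def J_def)
      qed
      then have "card {i \<in> I. 0 < w' i} < card {i \<in> I. 0 < w i}"
        using I by (intro psubset_card_mono) auto
      then show ?thesis
        using w' T' by (rule less.hyps)
    qed
    moreover have "t * h \<le> t * (\<Sum>i\<in>F. g i)"
      using t0 hF by (intro mult_left_mono) auto
    ultimately show ?thesis
      unfolding sum_w' by (simp add: algebra_simps)
  qed
qed

text \<open>A substitute for Fubini. Given a cover of \<open>W\<close> by sets \<open>C i\<close> of
  diameter \<open>\<delta> i\<close>, the weight \<open>w i\<close>, which is the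
  \<open>t\<close>-gauge for this diameter, is placed on a ball around the first projection of
  \<open>C i\<close>. Over a point \<open>a\<close> of \<open>A\<close>, the second projections of
  those \<open>C i\<close> whose first projection contains \<open>a\<close> cover \<open>B\<close>,
  so the weights at \<open>a\<close> add up to more than \<open>hB\<close>. The weighted covering
  bound, with the \<open>s\<close>-gauge of the enlarged balls as price, turns this into the
  product.\<close>

lemma hausdorff_product:
  fixes f :: "'z::metric_space \<Rightarrow> 'x::metric_space" and g :: "'z \<Rightarrow> 'y::metric_space"
  assumes s: "0 < s" and t: "0 < t"
    and f: "\<And>z z'. dist (f z) (f z') \<le> dist z z'" and g: "\<And>z z'. dist (g z) (g z') \<le> dist z z'"
    and A: "compact A" and W: "\<And>a b. a \<in> A \<Longrightarrow> b \<in> B \<Longrightarrow> \<exists>w\<in>W. f w = a \<and> g w = b"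
    and h: "0 \<le> hA" "0 \<le> hB" "ennreal hA < hausdorff_outer s A" "ennreal hB < hausdorff_outer t B"
  shows "ennreal (hA * hB)
    \<le> ennreal (unit_ball_vol s * unit_ball_vol t * 12 powr s / unit_ball_vol (s + t)) * hausdorff_outer (s + t) W"
proof -
  define K where "K = unit_ball_vol s * unit_ball_vol t * 12 powr s / unit_ball_vol (s + t)"
  have \<omega>: "0 < unit_ball_vol s" "0 < unit_ball_vol t" "0 < unit_ball_vol (s + t)"
    using s t by auto
  have K0: "0 < K"
    unfolding K_def using \<omega> by simp
  obtain dA dB where dA: "0 < dA" "ennreal hA < hausdorff_pre s dA A"
    and dB: "0 < dB" "ennreal hB < hausdorff_pre t dB B"
    using hausdorff_outer_gt_pre[OF h(3)] hausdorff_outer_gt_pre[OF h(4)] by auto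
  define d where "d = min dA dB"
  have d: "0 < d" "ennreal hA < hausdorff_pre s d A" "ennreal hB < hausdorff_pre t d B"
    using dA dB hausdorff_pre_antimono[of d dA s A] hausdorff_pre_antimono[of d dB t B]
    by (auto simp: d_def intro: less_le_trans)
  \<comment> \<open>Balls of radius \<open>2 * \<delta> i\<close>, when tripled, have diameter at
    most \<open>12 * \<delta> i\<close>. This is the origin of the scale \<open>d / 12\<close> and
    of the factor \<open>12 powr s\<close>.\<close>
  have "ennreal (hA * hB) \<le> ennreal K * (\<Sum>i. hausdorff_gauge (s + t) (C i))"
    if C: "C \<in> hausdorff_cover (d / 12) W" for C
  proof -
    have bd: "bounded (C i)" "diameter (C i) \<le> d / 12" "W \<subseteq> (\<Union>i. C i)" for i
      using C by (auto simp: hausdorff_cover_def)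
    define \<delta> where "\<delta> i = diameter (C i)" for i
    have \<delta>0: "0 \<le> \<delta> i" for i
      unfolding \<delta>_def by (rule diameter_ge_0[OF bd(1)])
    define c where "c i = f (SOME z. z \<in> C i)" for i
    \<comment> \<open>Sets of diameter 0 are dropped: their weight is 0 because
      \<open>t > 0\<close>, and their balls would be empty.\<close>
    define P where "P = {i. C i \<noteq> {} \<and> 0 < \<delta> i}"
    define w where "w i = unit_ball_vol t * (\<delta> i / 2) powr t" for i
    \<comment> \<open>The first projection of \<open>C i\<close> lies within
      \<open>\<delta> i\<close> of \<open>c i\<close>; twice this radius puts it inside an open
      ball, and openness feeds the compactness argument.\<close>
    define v where "v a i = (if i \<in> P \<and> a \<in> ball (c i) (2 * \<delta> i) then w i else 0)" for a i
    have w0: "0 \<le> w i" for i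
      using \<omega> by (simp add: w_def)
    have v0: "0 \<le> v a i" for a i
      using w0 by (simp add: v_def)
    have near: "dist (c i) (f z) \<le> \<delta> i" if "z \<in> C i" for i z
    proof -
      have "(SOME z. z \<in> C i) \<in> C i"
        using that by (rule someI)
      then have "dist (SOME z. z \<in> C i) z \<le> \<delta> i"
        unfolding \<delta>_def using that by (intro diameter_bounded_bound[OF bd(1)])
      then show ?thesis
        unfolding c_def using f order_trans by blast
    qed
    have hBv: "ennreal hB < (\<Sum>i. ennreal (v a i))" if a: "a \<in> A" for a
    proof -
      define D where "D i = (if a \<in> f ` C i then g ` C i else {})" for i
      have D_dist: "dist x y \<le> \<delta> i" if xy: "x \<in> D i" "y \<in> D i" for x y i
      proof -
        obtain x' y' where xy': "x' \<in> C i" "y' \<in> C i" "x = g x'" "y = g y'"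
          using xy by (auto simp: D_def split: if_splits)
        have "dist x' y' \<le> \<delta> i"
          unfolding \<delta>_def using xy' by (intro diameter_bounded_bound[OF bd(1)])
        then show ?thesis
          using g[of x' y'] xy' by simp
      qed
      have D: "bounded (D i)" "diameter (D i) \<le> \<delta> i" for i
        using D_dist \<delta>0 by (auto intro: bounded_dist_le diameter_le_dist)
      have \<delta>d: "\<delta> i \<le> d" for i
        using bd(2)[of i] d(1) by (simp add: \<delta>_def)
      have "B \<subseteq> (\<Union>i. D i)"
      proof
        fix b assume "b \<in> B"
        then obtain z where z: "z \<in> W" "f z = a" "g z = b"
          using W[OF a] by blast
        then obtain i where i: "z \<in> C i"
          using bd(3) by blast
        then have "b \<in> D i"
          using z by (auto simp: D_def)
        then show "b \<in> (\<Union>i. D i)" by blast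
      qed
      then have "D \<in> hausdorff_cover d B"
        using D order_trans[OF D(2) \<delta>d] by (simp add: hausdorff_cover_def)
      then have "hausdorff_pre t d B \<le> (\<Sum>i. hausdorff_gauge t (D i))"
        unfolding hausdorff_pre_def by (rule INF_lower)
      also have "\<dots> \<le> (\<Sum>i. ennreal (v a i))"
      proof (intro suminf_le allI)
        fix i
        show "hausdorff_gauge t (D i) \<le> ennreal (v a i)"
        proof (cases "D i = {}")
          case False
          then obtain z where z: "z \<in> C i" "f z = a"
            by (auto simp: D_def split: if_splits)
          have "hausdorff_gauge t (D i) \<le> ennreal (w i)"
            unfolding w_def by (rule hausdorff_gauge_le[OF t D])
          moreover have "v a i = w i"
          proof (cases "0 < \<delta> i")
            case True
            then show ?thesis
              using near[OF z(1)] z by (auto simp: v_def P_def)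
          next
            case False
            then have "\<delta> i = 0"
              using \<delta>0[of i] by simp
            then show ?thesis
              by (simp add: v_def w_def)
          qed
          ultimately show ?thesis by simp
        qed (simp add: hausdorff_gauge_def)
      qed auto
      finally show ?thesis
        using d(3) by simp
    qed
    have "\<exists>n. hB \<le> (\<Sum>i<n. v a i)" if a: "a \<in> A" for a
    proof -
      obtain n where "ennreal hB < (\<Sum>i<n. ennreal (v a i))"
        using hBv[OF a] unfolding suminf_eq_SUP less_SUP_iff by auto
      also have "\<dots> = ennreal (\<Sum>i<n. v a i)"
        by (rule sum_ennreal) (rule v0)
      finally have "hB \<le> (\<Sum>i<n. v a i)"
        using h(2) by (simp add: ennreal_less_iff)
      then show ?thesis ..
    qed
    then obtain N where N: "\<And>a. a \<in> A \<Longrightarrow> hB \<le> (\<Sum>i<N a. v a i)"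
      by metis
    \<comment> \<open>On this neighbourhood of \<open>a\<close> none of the first \<open>N a\<close>
      weights present at \<open>a\<close> is lost. Compactness of \<open>A\<close> then bounds the
      number of indices uniformly, so that the finite covering lemma applies.\<close>
    define U where "U a = (\<Inter>i\<in>{i. i < N a \<and> i \<in> P \<and> a \<in> ball (c i) (2 * \<delta> i)}. ball (c i) (2 * \<delta> i))" for a
    have U_open: "open (U a)" for a
      unfolding U_def by (intro open_INT) auto
    have U: "hB \<le> (\<Sum>i<N a. v b i)" if "a \<in> A" "b \<in> U a" for a b
    proof -
      have "(\<Sum>i<N a. v a i) \<le> (\<Sum>i<N a. v b i)"
        using that w0 by (intro sum_mono) (auto simp: v_def U_def)
      then show ?thesis
        using N[OF that(1)] by simp
    qed
    have "A \<subseteq> (\<Union>a\<in>A. U a)"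
      by (auto simp: U_def)
    then obtain A' where A': "A' \<subseteq> A" "finite A'" "A \<subseteq> (\<Union>a\<in>A'. U a)"
      using compactE_image[OF A, of A U] U_open by blast
    define n where "n = Max (insert 0 (N ` A'))"
    define I where "I = {i \<in> P. i < n}"
    have I: "finite I" "\<And>i. i \<in> I \<Longrightarrow> 0 < 2 * \<delta> i"
      by (auto simp: I_def P_def)
    have T: "hB \<le> (\<Sum>i | i \<in> I \<and> b \<in> ball (c i) (2 * \<delta> i). w i)" if b: "b \<in> A" for b
    proof -
      obtain a where a: "a \<in> A'" "b \<in> U a"
        using A'(3) b by blast
      have "N a \<le> n"
        unfolding n_def using a A' by (intro Max_ge) auto
      have "hB \<le> (\<Sum>i<N a. v b i)"
        using U a A' by blast
      also have "\<dots> \<le> (\<Sum>i<n. v b i)"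
        using \<open>N a \<le> n\<close> v0 by (intro sum_mono2) auto
      also have "\<dots> = (\<Sum>i | i \<in> I \<and> b \<in> ball (c i) (2 * \<delta> i). w i)"
        unfolding v_def by (subst sum.inter_filter[symmetric]) (auto simp: I_def intro!: sum.cong)
      finally show ?thesis .
    qed
    define G where "G i = unit_ball_vol s * (6 * \<delta> i) powr s" for i
    have "hB * hA \<le> (\<Sum>i\<in>I. w i * G i)"
    proof (rule weighted_covering[where \<rho> = "\<lambda>i. 2 * \<delta> i" and c = c and A = A])
      fix F assume F: "F \<subseteq> I" and cov: "A \<subseteq> (\<Union>i\<in>F. ball (c i) (3 * (2 * \<delta> i)))"
      have fF: "finite F"
        using F I finite_subset by blast
      have ball_d: "diameter (ball (c i) (3 * (2 * \<delta> i))) \<le> 12 * \<delta> i" for i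
      proof (rule diameter_le_dist)
        fix x y assume "x \<in> ball (c i) (3 * (2 * \<delta> i))" "y \<in> ball (c i) (3 * (2 * \<delta> i))"
        then show "dist x y \<le> 12 * \<delta> i"
          using dist_triangle3[of x y "c i"] by simp
      qed (use \<delta>0 in simp)
      have "hausdorff_pre s d A \<le> (\<Sum>i\<in>F. hausdorff_gauge s (ball (c i) (3 * (2 * \<delta> i))))"
      proof (intro hausdorff_pre_le_sum conjI)
        show "diameter (ball (c i) (3 * (2 * \<delta> i))) \<le> d" for i
          using ball_d[of i] bd(2)[of i] by (simp add: \<delta>_def)
      qed (use fF cov d(1) in auto)
      also have "\<dots> \<le> (\<Sum>i\<in>F. ennreal (unit_ball_vol s * (12 * \<delta> i / 2) powr s))"
        using ball_d s by (intro sum_mono hausdorff_gauge_le) auto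
      also have "\<dots> = ennreal (\<Sum>i\<in>F. G i)"
        using \<omega> by (subst sum_ennreal) (auto simp: G_def)
      finally have "ennreal hA < ennreal (\<Sum>i\<in>F. G i)"
        using d(2) by simp
      then show "hA \<le> (\<Sum>i\<in>F. G i)"
        using h(1) by (simp add: ennreal_less_iff)
    qed (use I T w0 h \<omega> in \<open>auto simp: G_def\<close>)
    also have "\<dots> = (\<Sum>i\<in>I. K * (unit_ball_vol (s + t) * (\<delta> i / 2) powr (s + t)))"
    proof (rule sum.cong)
      fix i assume "i \<in> I"
      then have "0 < \<delta> i"
        using I(2) by fastforce
      have "(6 * \<delta> i) powr s = 12 powr s * (\<delta> i / 2) powr s"
        using \<open>0 < \<delta> i\<close> by (subst powr_mult[symmetric]) auto
      then show "w i * G i = K * (unit_ball_vol (s + t) * (\<delta> i / 2) powr (s + t))"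
        using \<omega> by (simp add: w_def G_def K_def powr_add)
    qed simp
    finally have "ennreal (hA * hB) \<le> ennreal (\<Sum>i\<in>I. K * (unit_ball_vol (s + t) * (\<delta> i / 2) powr (s + t)))"
      by (intro ennreal_leI) (simp add: mult.commute)
    also have "\<dots> = (\<Sum>i\<in>I. ennreal K * hausdorff_gauge (s + t) (C i))"
      using \<omega> K0 s t by (subst sum_ennreal[symmetric])
        (auto simp: hausdorff_gauge_def \<delta>_def I_def P_def ennreal_mult intro!: sum.cong)
    also have "\<dots> \<le> (\<Sum>i. ennreal K * hausdorff_gauge (s + t) (C i))"
      using I by (intro sum_le_suminf) auto
    also have "\<dots> = ennreal K * (\<Sum>i. hausdorff_gauge (s + t) (C i))"
      by (rule ennreal_suminf_cmult)
    finally show ?thesis .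
  qed
  then have "ennreal (hA * hB) / ennreal K \<le> hausdorff_pre (s + t) (d / 12) W"
    unfolding hausdorff_pre_def using K0
    by (intro INF_greatest divide_le_posI_ennreal) (auto simp: mult.commute)
  also have "\<dots> \<le> hausdorff_outer (s + t) W"
    using d by (intro hausdorff_pre_le_outer) simp
  finally have "ennreal K * (ennreal (hA * hB) / ennreal K) \<le> ennreal K * hausdorff_outer (s + t) W"
    by (rule mult_left_mono) simp
  also have "ennreal K * (ennreal (hA * hB) / ennreal K) = ennreal (hA * hB)"
    using K0 mult_divide_eq_ennreal[of "ennreal K" "ennreal (hA * hB)"]
    by (simp add: ennreal_times_divide mult.commute[of "ennreal K"])
  finally show ?thesis
    unfolding K_def .
qed

text \<open>Unlike in \<open>finpower\<close> the factors may differ: they will be pieces of the set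
  near the different vertices of a simplex.\<close>

definition product_set :: "nat \<Rightarrow> (nat \<Rightarrow> 'a::zero set) \<Rightarrow> 'a finseq set"
  where "product_set l A = {y. (\<forall>i<l. coord y i \<in> A i) \<and> (\<forall>i\<ge>l. coord y i = 0)}"

lemma truncation_exists:
  fixes y :: "'a::real_inner finseq"
  shows "\<exists>y'. (\<forall>i. coord y' i = (if i < l then coord y i else 0))"
proof
  have "finite {i. (if i < l then coord y i else 0) \<noteq> 0}"
    by (rule finite_subset[of _ "{..<l}"]) auto
  then show "\<forall>i. coord (Finseq (\<lambda>i. if i < l then coord y i else 0)) i = (if i < l then coord y i else 0)"
    by (simp add: coord_Finseq)
qed

text \<open>The constant is chosen before the factors, as a radius independent of the set demands.
  Each induction step loses a factor 4 besides \<open>K\<close>, because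
  \<open>hausdorff_product\<close> takes strict lower bounds and both factors are halved to obtain
  them.\<close>

lemma hausdorff_product_set_ge:
  assumes m: "1 \<le> m" and l: "1 \<le> l"
  shows "\<exists>c>0. \<forall>(A :: nat \<Rightarrow> 'a::real_inner set) a. 0 < a \<longrightarrow>
    (\<forall>i<l. compact (A i) \<and> ennreal a \<le> hausdorff_outer (real m) (A i)) \<longrightarrow>
    ennreal (c * a ^ l) \<le> hausdorff_outer (real (m * l)) (product_set l A)"
  using l
proof (induction l rule: dec_induct)
  case base
  have "ennreal (1 * a ^ 1) \<le> hausdorff_outer (real (m * 1)) (product_set 1 A)"
    if "ennreal a \<le> hausdorff_outer (real m) (A 0)" for A :: "nat \<Rightarrow> 'a set" and a
  proof -
    have "A 0 \<subseteq> (\<lambda>y. coord y 0) ` product_set 1 A"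
    proof
      fix x assume x: "x \<in> A 0"
      have "finite {i::nat. (if i = 0 then x else 0) \<noteq> 0}"
        by (rule finite_subset[of _ "{0::nat}"]) auto
      then have "coord (Finseq (\<lambda>i. if i = 0 then x else 0)) i = (if i = 0 then x else 0)" for i
        by (simp add: coord_Finseq)
      then show "x \<in> (\<lambda>y. coord y 0) ` product_set 1 A"
        using x by (intro image_eqI[of _ _ "Finseq (\<lambda>i. if i = 0 then x else 0)"]) (auto simp: product_set_def)
    qed
    then have "hausdorff_outer (real m) (A 0) \<le> hausdorff_outer (real m) ((\<lambda>y. coord y 0) ` product_set 1 A)"
      by (rule hausdorff_outer_mono)
    also have "\<dots> \<le> hausdorff_outer (real m) (product_set 1 A)"
      using m by (intro hausdorff_outer_image_le_1 dist_coord_le) auto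
    finally show ?thesis
      using that by simp
  qed
  then show ?case
    by (intro exI[of _ 1]) auto
next
  case (step l)
  then obtain c where c: "0 < c" "\<And>(A :: nat \<Rightarrow> 'a set) a. 0 < a \<Longrightarrow>
    (\<forall>i<l. compact (A i) \<and> ennreal a \<le> hausdorff_outer (real m) (A i)) \<Longrightarrow>
    ennreal (c * a ^ l) \<le> hausdorff_outer (real (m * l)) (product_set l A)"
    by blast
  define s t where "s = real m" and "t = real (m * l)"
  have st: "0 < s" "0 < t"
    using m step by (auto simp: s_def t_def)
  define K where "K = unit_ball_vol s * unit_ball_vol t * 12 powr s / unit_ball_vol (s + t)"
  have K0: "0 < K"
    unfolding K_def using st by simp
  have "ennreal (c / (4 * K) * a ^ Suc l) \<le> hausdorff_outer (real (m * Suc l)) (product_set (Suc l) A)"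
    if a: "0 < a" and A: "\<forall>i<Suc l. compact (A i) \<and> ennreal a \<le> hausdorff_outer (real m) (A i)"
    for A :: "nat \<Rightarrow> 'a set" and a
  proof -
    obtain tr :: "'a finseq \<Rightarrow> 'a finseq" where tr: "\<And>y i. coord (tr y) i = (if i < l then coord y i else 0)"
      using truncation_exists[where 'a = 'a and l = l] by metis
    have tr_lip: "dist (tr y) (tr z) \<le> dist y z" for y z
    proof -
      obtain N where N: "\<forall>j\<in>{j. coord (y - z) j \<noteq> 0}. j < N"
        using finite_nat_bounded[OF finite_support[of "y - z"]] by auto
      have N': "\<forall>i\<ge>N. coord (y - z) i = 0"
        using N by force
      have "norm (tr y - tr z) = L2_set (\<lambda>i. norm (coord (tr y - tr z) i)) {..<N}"
        using N' by (intro norm_finseq_eq_L2_set) (auto simp: tr)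
      also have "\<dots> \<le> L2_set (\<lambda>i. norm (coord (y - z) i)) {..<N}"
        by (intro L2_set_mono) (auto simp: tr)
      also have "\<dots> = norm (y - z)"
        by (rule norm_finseq_eq_L2_set[OF N', symmetric])
      finally show ?thesis
        by (simp add: dist_norm)
    qed
    have lt: "ennreal (a / 2) < hausdorff_outer s (A l)"
      using A a by (rule_tac less_le_trans[of _ "ennreal a"]) (auto simp: ennreal_less_iff s_def)
    have lt': "ennreal (c * a ^ l / 2) < hausdorff_outer t (product_set l A)"
    proof (rule less_le_trans[of _ "ennreal (c * a ^ l)"])
      show "ennreal (c * a ^ l) \<le> hausdorff_outer t (product_set l A)"
        unfolding t_def using a A by (intro c(2)) auto
    qed (use a c in \<open>auto simp: ennreal_less_iff\<close>)
    have W: "\<exists>w\<in>product_set (Suc l) A. coord w l = x \<and> tr w = b" if x: "x \<in> A l" and b: "b \<in> product_set l A" for x b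
    proof -
      have "finite {i. ((coord b)(l := x)) i \<noteq> 0}"
        by (rule finite_subset[of _ "insert l {i. coord b i \<noteq> 0}"]) (auto simp: finite_support)
      then have w: "coord (Finseq ((coord b)(l := x))) = (coord b)(l := x)"
        by (rule coord_Finseq)
      have "Finseq ((coord b)(l := x)) \<in> product_set (Suc l) A"
        using x b by (auto simp: product_set_def w less_Suc_eq)
      moreover have "tr (Finseq ((coord b)(l := x))) = b"
        using b by (intro finseq_eqI) (auto simp: tr w product_set_def)
      ultimately show ?thesis
        using w by (intro bexI[of _ "Finseq ((coord b)(l := x))"]) auto
    qed
    have "ennreal ((a / 2) * (c * a ^ l / 2)) \<le> ennreal K * hausdorff_outer (s + t) (product_set (Suc l) A)"
      unfolding K_def
    proof (rule hausdorff_product[where f = "\<lambda>y. coord y l" and g = tr and A = "A l" and B = "product_set l A"])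
      show "compact (A l)" "0 \<le> a / 2" "0 \<le> c * a ^ l / 2"
        using A a c(1) by auto
      show "dist (coord z l) (coord z' l) \<le> dist z z'" for z z' :: "'a finseq"
        by (rule dist_coord_le)
    qed (fact st lt lt' tr_lip | rule W, assumption, assumption)+
    then have "ennreal (1 / K) * ennreal ((a / 2) * (c * a ^ l / 2))
        \<le> ennreal (1 / K) * (ennreal K * hausdorff_outer (s + t) (product_set (Suc l) A))"
      by (rule mult_left_mono) simp
    also have "\<dots> = hausdorff_outer (s + t) (product_set (Suc l) A)"
      using K0 by (simp add: mult.assoc[symmetric] ennreal_mult[symmetric])
    also have "ennreal (1 / K) * ennreal ((a / 2) * (c * a ^ l / 2)) = ennreal (c / (4 * K) * a ^ Suc l)"
    proof -
      have "1 / K * ((a / 2) * (c * a ^ l / 2)) = c / (4 * K) * a ^ Suc l"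
        using K0 by (simp add: field_simps)
      then show ?thesis
        using K0 a c(1) by (subst ennreal_mult[symmetric]) simp_all
    qed
    also have "s + t = real (m * Suc l)"
      by (simp add: s_def t_def)
    finally show ?thesis .
  qed
  moreover have "0 < c / (4 * K)"
    using c(1) K0 by simp
  ultimately show ?case
    by blast
qed

section \<open>Planes and their tilts\<close>

definition orthonormal :: "nat \<Rightarrow> (nat \<Rightarrow> 'a::real_inner) \<Rightarrow> bool"
  where "orthonormal m e \<longleftrightarrow> (\<forall>i<m. \<forall>j<m. e i \<bullet> e j = (if i = j then 1 else 0))"

definition plane :: "nat \<Rightarrow> (nat \<Rightarrow> 'a::real_inner) \<Rightarrow> 'a set"
  where "plane m e = span (e ` {..<m})"

definition oproj :: "nat \<Rightarrow> (nat \<Rightarrow> 'a::real_inner) \<Rightarrow> 'a \<Rightarrow> 'a"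
  where "oproj m e v = (\<Sum>i<m. (v \<bullet> e i) *\<^sub>R e i)"

definition perp :: "nat \<Rightarrow> (nat \<Rightarrow> 'a::real_inner) \<Rightarrow> 'a \<Rightarrow> 'a"
  where "perp m e v = v - oproj m e v"

lemma linear_oproj: "linear (oproj m e)"
  by (rule linearI) (simp_all add: oproj_def inner_add_left scaleR_add_left sum.distrib scaleR_sum_right)

lemma linear_perp: "linear (perp m e)"
  unfolding perp_def by (intro linear_compose_sub linear_ident linear_oproj)

lemmas oproj_simps = linear_add[OF linear_oproj] linear_diff[OF linear_oproj] linear_cmul[OF linear_oproj]
  linear_0[OF linear_oproj]
lemmas perp_simps = linear_add[OF linear_perp] linear_diff[OF linear_perp] linear_cmul[OF linear_perp]
  linear_0[OF linear_perp]

lemma oproj_plus_perp: "oproj m e v + perp m e v = v"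
  by (simp add: perp_def)

lemma subspace_plane: "subspace (plane m e)"
  by (simp add: plane_def)

lemma oproj_in_plane: "oproj m e v \<in> plane m e"
  unfolding oproj_def plane_def by (intro span_sum span_mul span_base) auto

lemma inner_perp_basis:
  assumes "orthonormal m e" "j < m"
  shows "perp m e v \<bullet> e j = 0"
proof -
  have "oproj m e v \<bullet> e j = (\<Sum>i<m. (v \<bullet> e i) * (if i = j then 1 else 0))"
    unfolding oproj_def inner_sum_left using assms by (intro sum.cong) (auto simp: orthonormal_def)
  also have "\<dots> = (\<Sum>i<m. if i = j then v \<bullet> e j else 0)"
    by (rule sum.cong) auto
  also have "\<dots> = v \<bullet> e j"
    using assms(2) by simp
  finally show ?thesis
    by (simp add: perp_def inner_diff_left)
qed

lemma inner_perp_plane: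
  assumes "orthonormal m e" "u \<in> plane m e"
  shows "perp m e v \<bullet> u = 0"
  using assms(2) unfolding plane_def
proof (induction rule: span_induct_alt)
  case base
  then show ?case by simp
next
  case (step c x y)
  then show ?case
    using inner_perp_basis[OF assms(1)] by (auto simp: inner_add_right)
qed

lemma pythagoras_plane:
  assumes "orthonormal m e" "u \<in> plane m e"
  shows "(norm (v - u))\<^sup>2 = (norm (oproj m e v - u))\<^sup>2 + (norm (perp m e v))\<^sup>2"
proof -
  have "oproj m e v - u \<in> plane m e"
    using assms oproj_in_plane subspace_diff[OF subspace_plane] by blast
  then have "perp m e v \<bullet> (oproj m e v - u) = 0"
    by (rule inner_perp_plane[OF assms(1)])
  moreover have "v - u = (oproj m e v - u) + perp m e v"
    by (simp add: perp_def)
  ultimately show ?thesis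
    by (simp only: power2_norm_eq_inner inner_add_left inner_add_right inner_commute)
qed

lemma norm_perp_le_dist:
  assumes "orthonormal m e" "u \<in> plane m e"
  shows "norm (perp m e v) \<le> norm (v - u)"
  using pythagoras_plane[OF assms, of v] by (rule_tac power2_le_imp_le) auto

lemma zero_in_plane: "0 \<in> plane m e"
  by (simp add: plane_def span_zero)

lemma norm_perp_le: "orthonormal m e \<Longrightarrow> norm (perp m e v) \<le> norm v"
  using norm_perp_le_dist[OF _ zero_in_plane, of m e v] by simp

lemma norm_oproj_le:
  assumes "orthonormal m e"
  shows "norm (oproj m e v) \<le> norm v"
  using pythagoras_plane[OF assms zero_in_plane, of v] by (rule_tac power2_le_imp_le) auto

lemma perp_plane:
  assumes "orthonormal m e" "u \<in> plane m e"
  shows "perp m e u = 0"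
  using norm_perp_le_dist[OF assms, of u] by simp

lemma oproj_plane:
  assumes "orthonormal m e" "u \<in> plane m e"
  shows "oproj m e u = u"
  using perp_plane[OF assms] unfolding perp_def by (metis right_minus_eq)

lemma norm_oproj_eq_L2_set:
  assumes "orthonormal m e"
  shows "norm (oproj m e v) = L2_set (\<lambda>i. v \<bullet> e i) {..<m}"
proof -
  have inner_oproj: "x \<bullet> oproj m e v = (\<Sum>i<m. (v \<bullet> e i) * (x \<bullet> e i))" for x
    by (simp add: oproj_def inner_sum_right)
  have "oproj m e v \<bullet> e i = v \<bullet> e i" if "i < m" for i
    using inner_perp_basis[OF assms that, of v] by (simp add: perp_def inner_diff_left)
  then have "oproj m e v \<bullet> oproj m e v = (\<Sum>i<m. (v \<bullet> e i)\<^sup>2)"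
    unfolding inner_oproj[of "oproj m e v"] by (simp add: power2_eq_square)
  then show ?thesis
    by (simp add: norm_eq_sqrt_inner L2_set_def)
qed

lemma orthonormal_inj:
  assumes "orthonormal m e"
  shows "inj_on e {..<m}"
proof (rule inj_onI)
  fix i j assume ij: "i \<in> {..<m}" "j \<in> {..<m}" "e i = e j"
  then have "e i \<bullet> e j = e i \<bullet> e i"
    by simp
  also have "\<dots> = 1"
    using ij assms by (simp add: orthonormal_def)
  finally have "e i \<bullet> e j = 1" .
  moreover have "e i \<bullet> e j = (if i = j then 1 else 0)"
    using ij(1,2) assms unfolding orthonormal_def by blast
  ultimately show "i = j"
    by (metis zero_neq_one)
qed

lemma orthonormal_independent:
  assumes "orthonormal m e"
  shows "independent (e ` {..<m})"
proof (rule pairwise_orthogonal_independent)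
  show "pairwise orthogonal (e ` {..<m})"
    using assms by (auto simp: pairwise_def orthogonal_def orthonormal_def)
  have "e i \<noteq> 0" if "i < m" for i
  proof
    assume "e i = 0"
    then have "e i \<bullet> e i = 0"
      by (simp only: inner_zero_left)
    moreover have "e i \<bullet> e i = 1"
      using assms that by (simp add: orthonormal_def)
    ultimately show False
      by simp
  qed
  then show "0 \<notin> e ` {..<m}"
    by force
qed

lemma dim_plane: "orthonormal m e \<Longrightarrow> dim (plane m e) = m"
  unfolding plane_def
  by (simp add: dim_span dim_eq_card_independent orthonormal_independent orthonormal_inj card_image)

section \<open>Extension of orthonormal families and the Grassmannian\<close>

lemma orthonormal_extend:
  assumes e: "orthonormal k e" "\<forall>i<k. e i \<in> V" and V: "subspace V" "v \<in> V" "v \<notin> plane k e"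
  shows "\<exists>e'. orthonormal (Suc k) e' \<and> (\<forall>i<Suc k. e' i \<in> V) \<and> v \<in> plane (Suc k) e' \<and>
    plane k e \<subseteq> plane (Suc k) e'"
proof -
  define u where "u = perp k e v"
  have "oproj k e v \<noteq> v"
    using V(3) oproj_in_plane by metis
  then have u0: "u \<noteq> 0"
    by (simp add: u_def perp_def)
  define b where "b = u /\<^sub>R norm u"
  define e' where "e' = e(k := b)"
  have "oproj k e v \<in> V"
    unfolding oproj_def using e(2) V(1) by (intro subspace_sum subspace_scale) auto
  then have "b \<in> V"
    unfolding b_def u_def perp_def using V by (intro subspace_scale subspace_diff)
  then have in_V: "\<forall>i<Suc k. e' i \<in> V"
    using e(2) by (auto simp: e'_def less_Suc_eq)
  have bb: "b \<bullet> b = 1"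
    using u0 by (simp add: b_def dot_square_norm power2_eq_square)
  have be: "b \<bullet> e i = 0" "e i \<bullet> b = 0" if "i < k" for i
    using inner_perp_basis[OF e(1) that] by (simp_all add: b_def u_def inner_commute)
  have "e' i \<bullet> e' j = (if i = j then 1 else 0)" if "i < Suc k" "j < Suc k" for i j
    using that e(1) bb be by (auto simp: e'_def orthonormal_def less_Suc_eq)
  then have "orthonormal (Suc k) e'"
    unfolding orthonormal_def by blast
  moreover have sub: "plane k e \<subseteq> plane (Suc k) e'"
    unfolding plane_def by (rule span_mono) (auto simp: e'_def)
  moreover have "v \<in> plane (Suc k) e'"
  proof -
    have "e' k \<in> plane (Suc k) e'"
      unfolding plane_def by (rule span_base) auto
    then have "b \<in> plane (Suc k) e'"
      by (simp add: e'_def)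
    moreover have "v = oproj k e v + norm u *\<^sub>R b"
      using u0 by (simp add: b_def u_def perp_def)
    ultimately show ?thesis
      using sub oproj_in_plane[of k e v] subspace_plane[of "Suc k" e']
      by (metis subsetD subspace_add subspace_scale)
  qed
  ultimately show ?thesis
    using in_V by blast
qed

lemma Rn_basis: "\<exists>b. orthonormal n b \<and> (\<forall>i<n. b i \<in> Rn n)"
proof -
  define b where "b i = Finseq (\<lambda>j. if j = i then 1 else (0::real))" for i :: nat
  have "finite {j. (if j = i then 1 else (0::real)) \<noteq> 0}" for i :: nat
    by (rule finite_subset[of _ "{i}"]) auto
  then have c: "coord (b i) = (\<lambda>j. if j = i then 1 else 0)" for i
    unfolding b_def by (rule Finseq_inverse[OF CollectI])
  have "b i \<bullet> b j = (\<Sum>k\<in>{i}. coord (b i) k \<bullet> coord (b j) k)" for i j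
    by (rule inner_finseq_on) (auto simp: c)
  then have "orthonormal n b"
    by (simp add: orthonormal_def c)
  then show ?thesis
    by (intro exI[of _ b]) (auto simp: Rn_def c)
qed

lemma Rn_not_subset_plane:
  assumes "k < n"
  shows "\<exists>v\<in>Rn n. v \<notin> plane k e"
proof (rule ccontr)
  assume "\<not> ?thesis"
  moreover obtain b where b: "orthonormal n b" "\<forall>i<n. b i \<in> Rn n"
    using Rn_basis by blast
  ultimately have "b ` {..<n} \<subseteq> span (e ` {..<k})"
    by (auto simp: plane_def)
  then have "card (b ` {..<n}) \<le> card (e ` {..<k})"
    using independent_span_bound[of "e ` {..<k}"] orthonormal_independent[OF b(1)] by auto
  also have "\<dots> \<le> k"
    using card_image_le[of "{..<k}" e] by simp
  finally show False
    using assms by (simp add: card_image[OF orthonormal_inj[OF b(1)]])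
qed

lemma orthonormal_contains_finite:
  assumes "finite S" "S \<subseteq> V" "subspace V"
  shows "\<exists>k\<le>card S. \<exists>e. orthonormal k e \<and> (\<forall>i<k. e i \<in> V) \<and> S \<subseteq> plane k e"
  using assms(1,2)
proof (induction S rule: finite_induct)
  case empty
  then show ?case
    by (auto simp: orthonormal_def)
next
  case (insert v S)
  then obtain k e where ke: "k \<le> card S" "orthonormal k e" "\<forall>i<k. e i \<in> V" "S \<subseteq> plane k e"
    by auto
  have card: "card (insert v S) = Suc (card S)"
    using insert.hyps by simp
  show ?case
  proof (cases "v \<in> plane k e")
    case True
    have "k \<le> card (insert v S)" "insert v S \<subseteq> plane k e"
      using ke True card by auto
    then show ?thesis
      using ke(2,3) by blast
  next
    case False
    obtain e' where e': "orthonormal (Suc k) e'" "\<forall>i<Suc k. e' i \<in> V" "v \<in> plane (Suc k) e'"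
      "plane k e \<subseteq> plane (Suc k) e'"
      using orthonormal_extend[OF ke(2,3) assms(3) _ False] insert.prems by auto
    have "Suc k \<le> card (insert v S)" "insert v S \<subseteq> plane (Suc k) e'"
      using ke e' card by auto
    then show ?thesis
      using e'(1,2) by blast
  qed
qed

lemma orthonormal_extend_to:
  assumes "k \<le> m" "m \<le> n" "orthonormal k e" "\<forall>i<k. e i \<in> Rn n"
  shows "\<exists>e'. orthonormal m e' \<and> (\<forall>i<m. e' i \<in> Rn n) \<and> plane k e \<subseteq> plane m e'"
  using assms(1,2)
proof (induction m rule: dec_induct)
  case base
  then show ?case
    using assms by blast
next
  case (step m)
  then obtain e' where e': "orthonormal m e'" "\<forall>i<m. e' i \<in> Rn n" "plane k e \<subseteq> plane m e'"
    by auto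
  obtain v where v: "v \<in> Rn n" "v \<notin> plane m e'"
    using Rn_not_subset_plane[of m n e'] step.prems by auto
  show ?case
    using orthonormal_extend[OF e'(1,2) subspace_Rn v] e'(3) by (meson order_trans)
qed

lemma grassmannian_plane:
  assumes "orthonormal m e" "\<forall>i<m. e i \<in> Rn n"
  shows "plane m e \<in> grassmannian n m"
  using assms dim_plane[OF assms(1)] span_minimal[OF _ subspace_Rn, of "e ` {..<m}" n]
  by (auto simp: grassmannian_def subspace_plane plane_def)

lemma grassmannian_orthonormal:
  assumes m: "1 \<le> m" and H: "H \<in> grassmannian n m"
  shows "\<exists>e. orthonormal m e \<and> (\<forall>i<m. e i \<in> Rn n) \<and> plane m e = H"
proof -
  have H': "subspace H" "H \<subseteq> Rn n" "dim H = m"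
    using H by (auto simp: grassmannian_def)
  obtain B where B: "B \<subseteq> H" "independent B" "H \<subseteq> span B" "card B = m"
    using basis_exists[of H] H'(3) by metis
  \<comment> \<open>An infinite set has \<open>card\<close> 0, which \<open>1 \<le> m\<close> rules
    out.\<close>
  have "finite B"
    using B(4) m card.infinite by fastforce
  then obtain k e where ke: "orthonormal k e" "\<forall>i<k. e i \<in> H" "B \<subseteq> plane k e"
    using orthonormal_contains_finite[OF _ B(1) H'(1)] by blast
  have sub: "plane k e \<subseteq> H"
    unfolding plane_def using ke(2) H'(1) by (intro span_minimal) auto
  have "H \<subseteq> plane k e"
    using B(3) span_minimal[OF ke(3) subspace_plane] by blast
  then have eq: "plane k e = H"
    using sub by blast
  then have "k = m"
    using dim_plane[OF ke(1)] H'(3) by simp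
  then show ?thesis
    using ke eq H'(2) by blast
qed

section \<open>The tilt of one plane against another\<close>

definition tilt_le :: "nat \<Rightarrow> real \<Rightarrow> (nat \<Rightarrow> 'a::real_inner) \<Rightarrow> (nat \<Rightarrow> 'a) \<Rightarrow> bool"
  where "tilt_le m q e' e \<longleftrightarrow> (\<forall>u\<in>plane m e'. norm (perp m e u) \<le> q * norm u)"

lemma tilt_le_mono: "tilt_le m q e' e \<Longrightarrow> q \<le> q' \<Longrightarrow> tilt_le m q' e' e"
  unfolding tilt_le_def by (meson mult_right_mono norm_ge_zero order_trans)

text \<open>\<open>tilt_le\<close> is one-sided, but between planes of equal dimension a tilt below
  1 makes the projection injective on the first plane, hence onto the second by counting dimensions.
  The lifts it provides allow the relation to be reversed.\<close>

lemma tilt_le_surj: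
  assumes e: "orthonormal m e" and e': "orthonormal m e'" and q: "tilt_le m q e' e" "q < 1"
    and w: "w \<in> plane m e"
  shows "\<exists>u\<in>plane m e'. oproj m e u = w \<and> (1 - q) * norm u \<le> norm w"
proof -
  let ?f = "oproj m e" and ?B' = "e' ` {..<m}"
  have inj: "inj_on ?f (span ?B')"
  proof (rule inj_onI)
    fix u v assume uv: "u \<in> span ?B'" "v \<in> span ?B'" "?f u = ?f v"
    then have "u - v \<in> plane m e'"
      unfolding plane_def by (intro span_diff)
    then have "norm (perp m e (u - v)) \<le> q * norm (u - v)"
      using q by (auto simp: tilt_le_def)
    moreover have "perp m e (u - v) = u - v"
      using uv(3) by (simp add: perp_def oproj_simps)
    ultimately have "(1 - q) * norm (u - v) \<le> 0"
      by (simp add: algebra_simps)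
    then show "u = v"
      using q(2) by (simp add: mult_le_0_iff)
  qed
  have ind: "independent (?f ` ?B')"
    by (rule linear_independent_injective_image[OF linear_oproj orthonormal_independent[OF e'] inj])
  have "inj_on ?f ?B'"
    using inj span_superset inj_on_subset by blast
  then have cardB: "card (?f ` ?B') = m"
    using orthonormal_inj[OF e'] by (simp add: card_image)
  have "w \<in> span (?f ` ?B')"
  proof (rule ccontr)
    assume nw: "w \<notin> span (?f ` ?B')"
    then have "independent (insert w (?f ` ?B'))"
      using ind independent_insertI by blast
    moreover have "insert w (?f ` ?B') \<subseteq> span (e ` {..<m})"
      using w oproj_in_plane unfolding plane_def by blast
    ultimately have "card (insert w (?f ` ?B')) \<le> card (e ` {..<m})"
      using independent_span_bound[of "e ` {..<m}"] by auto
    moreover have "w \<notin> ?f ` ?B'"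
      using nw span_base[of w "?f ` ?B'"] by argo
    ultimately show False
      using cardB card_image_le[of "{..<m}" e] by simp
  qed
  then obtain u where u: "u \<in> plane m e'" "?f u = w"
    using linear_span_image[OF linear_oproj, of m e ?B'] by (auto simp: plane_def)
  have "norm u \<le> norm (?f u) + norm (perp m e u)"
    using norm_triangle_ineq[of "?f u" "perp m e u"] by (simp add: oproj_plus_perp)
  moreover have "norm (perp m e u) \<le> q * norm u"
    using q u by (auto simp: tilt_le_def)
  ultimately show ?thesis
    using u by (intro bexI[of _ u]) (auto simp: algebra_simps)
qed

lemma tilt_le_trans:
  assumes "orthonormal m e" "orthonormal m e'" "tilt_le m q1 e'' e'" "tilt_le m q2 e' e" "0 \<le> q2"
  shows "tilt_le m (q1 + q2) e'' e"
  unfolding tilt_le_def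
proof
  fix u assume u: "u \<in> plane m e''"
  have "perp m e u = perp m e (oproj m e' u) + perp m e (perp m e' u)"
    by (simp add: oproj_plus_perp flip: perp_simps)
  then have "norm (perp m e u) \<le> norm (perp m e (oproj m e' u)) + norm (perp m e (perp m e' u))"
    by (simp add: norm_triangle_ineq)
  also have "norm (perp m e (perp m e' u)) \<le> norm (perp m e' u)"
    by (rule norm_perp_le[OF assms(1)])
  also have "norm (perp m e' u) \<le> q1 * norm u"
    using assms(3) u by (simp add: tilt_le_def)
  also have "norm (perp m e (oproj m e' u)) \<le> q2 * norm (oproj m e' u)"
    using assms(4) oproj_in_plane by (auto simp: tilt_le_def)
  also have "\<dots> \<le> q2 * norm u"
    using assms(5) norm_oproj_le[OF assms(2)] by (intro mult_left_mono)
  finally show "norm (perp m e u) \<le> (q1 + q2) * norm u"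
    by (simp add: algebra_simps)
qed

text \<open>Both planes are compared with a third one that tilts little against each. A vector of
  the plane of \<open>e'\<close> is lifted to that of \<open>e''\<close>, where both tilt bounds are
  known; \<open>q1 \<le> 1 / 2\<close> limits the growth of its norm to the factor 2.\<close>

lemma tilt_le_common:
  assumes e: "orthonormal m e" "orthonormal m e'" "orthonormal m e''"
    and q: "tilt_le m q1 e'' e'" "tilt_le m q2 e'' e" "0 \<le> q1" "0 \<le> q2" "q1 \<le> 1 / 2"
  shows "tilt_le m (2 * (q1 + q2)) e' e"
  unfolding tilt_le_def
proof
  fix w assume "w \<in> plane m e'"
  then obtain u where u: "u \<in> plane m e''" "oproj m e' u = w" "(1 - q1) * norm u \<le> norm w"
    using tilt_le_surj[OF e(2,3) q(1)] q(5) by auto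
  have "(1 / 2) * norm u \<le> (1 - q1) * norm u"
    using q(5) by (intro mult_right_mono) auto
  then have nu: "norm u \<le> 2 * norm w"
    using u(3) by simp
  have "w = u - perp m e' u"
    using u(2) by (simp add: perp_def)
  then have "norm (perp m e w) \<le> norm (perp m e u) + norm (perp m e (perp m e' u))"
    by (simp add: perp_simps norm_triangle_ineq4)
  also have "norm (perp m e (perp m e' u)) \<le> norm (perp m e' u)"
    by (rule norm_perp_le[OF e(1)])
  also have "norm (perp m e' u) \<le> q1 * norm u"
    using q(1) u by (simp add: tilt_le_def)
  also have "norm (perp m e u) \<le> q2 * norm u"
    using q(2) u by (simp add: tilt_le_def)
  also have "q2 * norm u + q1 * norm u = (q1 + q2) * norm u"
    by (simp add: algebra_simps)
  also have "\<dots> \<le> (q1 + q2) * (2 * norm w)"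
    using q nu by (intro mult_left_mono) auto
  finally show "norm (perp m e w) \<le> 2 * (q1 + q2) * norm w"
    by (simp add: algebra_simps)
qed

section \<open>Reifenberg flatness with decaying flatness numbers\<close>

definition flat :: "nat \<Rightarrow> 'a::real_inner set \<Rightarrow> (nat \<Rightarrow> 'a) \<Rightarrow> 'a \<Rightarrow> real \<Rightarrow> real \<Rightarrow> bool"
  where "flat m S e x r d \<longleftrightarrow> (\<forall>z\<in>S. norm (z - x) \<le> r \<longrightarrow> norm (perp m e (z - x)) \<le> d * r)"

definition full :: "nat \<Rightarrow> 'a::real_inner set \<Rightarrow> (nat \<Rightarrow> 'a) \<Rightarrow> 'a \<Rightarrow> real \<Rightarrow> real \<Rightarrow> bool"
  where "full m S e x r d \<longleftrightarrow>
    (\<forall>w\<in>plane m e. norm w \<le> r \<longrightarrow> (\<exists>z\<in>S. norm (z - x) \<le> r \<and> norm (z - x - w) \<le> d * r))"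

text \<open>The crude constant in \<^const>\<open>full\<close> does not enter the bound: replacing a vector of the plane
  by the projection of a nearby point of the set reproduces the tilt on the error with a factor
  at most one half.\<close>

lemma tilt_le_of_flat:
  assumes e: "orthonormal m e" "orthonormal m e'" and s: "0 < s"
    and flat: "flat m S e' z s d'" and full: "full m S e' z s \<epsilon>" "\<epsilon> \<le> 1 / 2"
    and d: "0 \<le> d'" "0 \<le> d''"
    and near: "\<And>y. y \<in> S \<Longrightarrow> norm (y - z) \<le> s \<Longrightarrow> norm (perp m e (y - z)) \<le> d'' * s"
  shows "tilt_le m (2 * (d' + d'')) e' e"
proof -
  \<comment> \<open>At \<open>n = 0\<close> this is the trivial tilt bound 1. Each round halves the
    excess over \<open>2 * (d' + d'')\<close>, which disappears in the limit.\<close>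
  have step: "norm (perp m e u) \<le> (2 * (d' + d'') + (1/2) ^ n) * norm u" if "u \<in> plane m e'" for n u
    using that
  proof (induction n arbitrary: u)
    case 0
    have "norm (perp m e u) \<le> 1 * norm u"
      using norm_perp_le[OF e(1)] by simp
    also have "\<dots> \<le> (2 * (d' + d'') + (1/2) ^ 0) * norm u"
      using d by (intro mult_right_mono) auto
    finally show ?case .
  next
    case (Suc n)
    let ?q = "2 * (d' + d'') + (1/2) ^ n"
    have q0: "0 \<le> ?q"
      using d by simp
    show ?case
    proof (cases "u = 0")
      case False
      define c where "c = s / norm u"
      have c: "0 < c"
        using s False by (simp add: c_def)
      define u1 where "u1 = c *\<^sub>R u"
      have u1: "u1 \<in> plane m e'" "norm u1 = s"
        using Suc.prems subspace_scale[OF subspace_plane] s False by (auto simp: u1_def c_def)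
      obtain y where y: "y \<in> S" "norm (y - z) \<le> s" "norm (y - z - u1) \<le> \<epsilon> * s"
        using full(1) u1 unfolding full_def by auto
      define v where "v = oproj m e' (y - z)"
      have v: "v \<in> plane m e'"
        unfolding v_def by (rule oproj_in_plane)
      have "v - u1 = oproj m e' (y - z - u1)"
        unfolding v_def by (simp only: oproj_simps oproj_plane[OF e(2) u1(1)])
      then have "norm (v - u1) = norm (oproj m e' (y - z - u1))"
        by simp
      then have vu: "norm (u1 - v) \<le> \<epsilon> * s"
        using norm_oproj_le[OF e(2), of "y - z - u1"] y(3) norm_minus_commute[of u1 v] by linarith
      have "v = (y - z) - perp m e' (y - z)"
        by (simp add: v_def perp_def)
      then have "norm (perp m e v) \<le> norm (perp m e (y - z)) + norm (perp m e (perp m e' (y - z)))"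
        by (simp only: perp_simps norm_triangle_ineq4)
      also have "norm (perp m e (y - z)) \<le> d'' * s"
        by (rule near[OF y(1,2)])
      also have "norm (perp m e (perp m e' (y - z))) \<le> d' * s"
        using norm_perp_le[OF e(1)] flat y(1,2) unfolding flat_def by (meson order_trans)
      finally have pv: "norm (perp m e v) \<le> d'' * s + d' * s"
        by simp
      have "norm (perp m e (u1 - v)) \<le> ?q * norm (u1 - v)"
        using u1 v subspace_diff[OF subspace_plane] by (intro Suc.IH)
      also have "\<dots> \<le> ?q * (1 / 2 * s)"
      proof (rule mult_left_mono[OF _ q0])
        have "\<epsilon> * s \<le> 1 / 2 * s"
          using full(2) s by (intro mult_right_mono) auto
        then show "norm (u1 - v) \<le> 1 / 2 * s"
          using vu by linarith
      qed
      finally have "norm (perp m e (u1 - v)) \<le> ?q * (1 / 2 * s)" .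
      moreover have "perp m e u1 = perp m e (u1 - v) + perp m e v"
        by (simp add: perp_simps)
      then have "norm (perp m e u1) \<le> norm (perp m e (u1 - v)) + norm (perp m e v)"
        by (simp only: norm_triangle_ineq)
      ultimately have "norm (perp m e u1) \<le> ?q * (1 / 2 * s) + (d'' * s + d' * s)"
        using pv by linarith
      also have "\<dots> = (2 * (d' + d'') + (1/2) ^ Suc n) * s"
        by (simp add: algebra_simps)
      finally have "c * norm (perp m e u) \<le> (2 * (d' + d'') + (1/2) ^ Suc n) * (c * norm u)"
        using c u1(2) by (simp add: u1_def perp_simps)
      then have "c * norm (perp m e u) \<le> c * ((2 * (d' + d'') + (1/2) ^ Suc n) * norm u)"
        by (simp only: mult.left_commute)
      then show ?thesis
        using c by (simp only: mult_le_cancel_left_pos)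
    qed (simp add: perp_simps)
  qed
  show ?thesis
    unfolding tilt_le_def
  proof
    fix u assume u: "u \<in> plane m e'"
    have "(\<lambda>n. (2 * (d' + d'') + (1/2) ^ n) * norm u) \<longlonglongrightarrow> (2 * (d' + d'') + 0) * norm u"
      by (intro tendsto_intros LIMSEQ_power_zero) auto
    then have "norm (perp m e u) \<le> (2 * (d' + d'') + 0) * norm u"
      by (rule LIMSEQ_le_const) (use step[OF u] in blast)
    then show "norm (perp m e u) \<le> 2 * (d' + d'') * norm u"
      by simp
  qed
qed

section \<open>Decaying flatness and summable tilts\<close>

lemma dyadic_scale_exists:
  fixes a r :: real
  assumes "0 < a" "a \<le> r"
  shows "\<exists>k. a \<le> r / 2 ^ k \<and> r / 2 ^ k < 2 * a"
proof -
  have "\<exists>k. r / 2 ^ k < 2 * a"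
  proof -
    obtain k where "r / (2 * a) < 2 ^ k"
      using real_arch_pow[of 2 "r / (2 * a)"] by auto
    then show ?thesis
      using assms by (intro exI[of _ k]) (simp add: field_simps)
  qed
  define k where "k = (LEAST k. r / 2 ^ k < 2 * a)"
  have k: "r / 2 ^ k < 2 * a"
    unfolding k_def using \<open>\<exists>k. r / 2 ^ k < 2 * a\<close> by (rule LeastI_ex)
  have "a \<le> r / 2 ^ k"
  proof (cases k)
    case (Suc j)
    then have "\<not> r / 2 ^ j < 2 * a"
      using not_less_Least[of j "\<lambda>k. r / 2 ^ k < 2 * a"] unfolding k_def by simp
    then show ?thesis
      using Suc by (simp add: field_simps)
  qed (use assms in simp)
  then show ?thesis
    using k by blast
qed

text \<open>The first summand is the geometric series of the tilts under repeated halving of the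
  radius, with first term 6 and ratio \<open>2 powr - \<kappa>\<close>; the second pays for two
  changes of the base point, 72 each.\<close>

definition tilt_const :: "real \<Rightarrow> real"
  where "tilt_const \<kappa> = 6 / (1 - 2 powr - \<kappa>) + 144"

text \<open>The second entry keeps the accumulated tilt at most 1/2. The first keeps the numerical
  losses within the margins of \<open>full_of_flat\<close> and \<open>sqrt15_bound\<close>.\<close>

definition flatness_threshold :: "real \<Rightarrow> real"
  where "flatness_threshold \<kappa> = min (1 / 8192) (1 / (2 * tilt_const \<kappa>))"

lemma tilt_const_pos: "0 < \<kappa> \<Longrightarrow> 0 < tilt_const \<kappa>"
  unfolding tilt_const_def by (intro add_pos_pos divide_pos_pos) (simp_all add: powr_less_one)

lemma flatness_threshold_pos: "0 < \<kappa> \<Longrightarrow> 0 < flatness_threshold \<kappa>"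
  using tilt_const_pos[of \<kappa>] by (simp add: flatness_threshold_def)

text \<open>No compatibility between planes at different points or scales is assumed. It is derived
  by comparing two planes on common points of \<open>S\<close>, of which \<open>full_e\<close>
  provides enough.\<close>

locale flat_field =
  fixes m :: nat and S :: "'a::real_inner set" and e :: "'a \<Rightarrow> real \<Rightarrow> nat \<Rightarrow> 'a" and R C \<kappa> :: real
  assumes \<kappa>: "0 < \<kappa>" and C: "0 \<le> C" and R: "0 < R" and small: "C * R powr \<kappa> \<le> flatness_threshold \<kappa>"
    and S: "compact S"
    and ortho: "\<And>x r. x \<in> S \<Longrightarrow> 0 < r \<Longrightarrow> r \<le> R \<Longrightarrow> orthonormal m (e x r)"
    and flat_e: "\<And>x r. x \<in> S \<Longrightarrow> 0 < r \<Longrightarrow> r \<le> R \<Longrightarrow> flat m S (e x r) x r (C * r powr \<kappa>)"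
    and full_e: "\<And>x r. x \<in> S \<Longrightarrow> 0 < r \<Longrightarrow> r \<le> R \<Longrightarrow> full m S (e x r) x r (1 / 16)"
begin

definition d :: "real \<Rightarrow> real"
  where "d r = C * r powr \<kappa>"

lemma d_nonneg: "0 \<le> d r"
  using C by (simp add: d_def)

lemma d_mono: "0 \<le> r \<Longrightarrow> r \<le> s \<Longrightarrow> d r \<le> d s"
  unfolding d_def using C \<kappa> by (intro mult_left_mono powr_mono2) auto

lemma d_le: "0 \<le> r \<Longrightarrow> r \<le> R \<Longrightarrow> d r \<le> flatness_threshold \<kappa>"
  using d_mono[of r R] small by (simp add: d_def)

lemma d_le_8192: "0 \<le> r \<Longrightarrow> r \<le> R \<Longrightarrow> d r \<le> 1 / 8192"
  using d_le[of r] by (simp add: flatness_threshold_def)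

lemma tilt_d_le_half:
  assumes "0 \<le> r" "r \<le> R"
  shows "tilt_const \<kappa> * d r \<le> 1 / 2"
proof -
  have "d r \<le> 1 / (2 * tilt_const \<kappa>)"
    using d_le[OF assms] by (simp add: flatness_threshold_def)
  then have "tilt_const \<kappa> * d r \<le> tilt_const \<kappa> * (1 / (2 * tilt_const \<kappa>))"
    using tilt_const_pos[OF \<kappa>] by (intro mult_left_mono) auto
  then show ?thesis
    using tilt_const_pos[OF \<kappa>] by simp
qed

lemma flat_d:
  assumes "x \<in> S" "0 < r" "r \<le> R" "z \<in> S" "norm (z - x) \<le> r"
  shows "norm (perp m (e x r) (z - x)) \<le> d r * r"
  using flat_e[OF assms(1-3)] assms(4,5) by (simp add: flat_def d_def)

lemma tilt_halve:
  assumes x: "x \<in> S" and r: "0 < r" "r \<le> R"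
  shows "tilt_le m (6 * d r) (e x (r / 2)) (e x r)"
proof -
  \<comment> \<open>The error \<open>d r * r\<close> is \<open>2 * d r\<close> relative to the
    radius \<open>r / 2\<close>; together with \<open>d (r / 2) \<le> d r\<close> this gives the
    factor 6.\<close>
  have "tilt_le m (2 * (d (r / 2) + 2 * d r)) (e x (r / 2)) (e x r)"
  proof (rule tilt_le_of_flat[where s = "r / 2" and z = x and \<epsilon> = "1 / 16" and S = S])
    show "flat m S (e x (r / 2)) x (r / 2) (d (r / 2))"
      using flat_e[of x "r / 2"] x r by (simp add: d_def)
    fix y assume y: "y \<in> S" "norm (y - x) \<le> r / 2"
    then have "norm (perp m (e x r) (y - x)) \<le> d r * r"
      using x r by (intro flat_d) auto
    then show "norm (perp m (e x r) (y - x)) \<le> 2 * d r * (r / 2)"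
      by simp
  qed (use x r ortho full_e[of x "r / 2"] d_nonneg in auto)
  then show ?thesis
    by (rule tilt_le_mono) (use d_mono[of "r / 2" r] r in simp)
qed

lemma d_half: "0 \<le> r \<Longrightarrow> d (r / 2) = 2 powr - \<kappa> * d r"
  by (simp add: d_def powr_divide powr_minus field_simps)

text \<open>Since halving the radius multiplies \<open>d\<close> by
  \<open>2 powr - \<kappa>\<close>, the tilt \<open>6 * d t\<close> of a single step is exactly
  \<open>6 / (1 - 2 powr - \<kappa>)\<close> times \<open>d t - d (t / 2)\<close>. With the
  difference in the bound the induction telescopes, and the result is bounded uniformly in
  \<open>k\<close>.\<close>

lemma tilt_dyadic:
  assumes x: "x \<in> S" and r: "0 < r" "r \<le> R"
  shows "tilt_le m (6 / (1 - 2 powr - \<kappa>) * (d r - d (r / 2 ^ k))) (e x (r / 2 ^ k)) (e x r)"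
proof (induction k)
  case 0
  then show ?case
    using ortho[OF x r] perp_plane[of m "e x r"] by (auto simp: tilt_le_def)
next
  case (Suc k)
  let ?B = "6 / (1 - 2 powr - \<kappa>)" and ?t = "r / 2 ^ k"
  have p: "2 powr - \<kappa> < 1"
    using \<kappa> by (simp add: powr_less_one)
  have t: "0 < ?t" "?t \<le> r"
    using r by (auto simp: divide_le_eq_1 field_simps)
  have t2: "0 < ?t / 2" "?t / 2 \<le> R"
    using t r by auto
  have "tilt_le m (6 * d ?t + ?B * (d r - d ?t)) (e x (?t / 2)) (e x r)"
  proof (rule tilt_le_trans[OF ortho[OF x r] _ _ Suc.IH])
    show "orthonormal m (e x ?t)"
      using x t r by (intro ortho) auto
    show "tilt_le m (6 * d ?t) (e x (?t / 2)) (e x ?t)"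
      using x t r by (intro tilt_halve) auto
    show "0 \<le> ?B * (d r - d ?t)"
      using p t d_mono[of ?t r] by (intro mult_nonneg_nonneg) auto
  qed
  moreover have "6 * d ?t + ?B * (d r - d ?t) = ?B * (d r - d (?t / 2))"
  proof -
    have "1 - 2 powr - \<kappa> \<noteq> 0"
      using p by linarith
    then have "?B * (1 - 2 powr - \<kappa>) = 6"
      by (rule nonzero_eq_divide_eq[THEN iffD1, OF _ refl])
    then have "6 * d ?t = ?B * (1 - 2 powr - \<kappa>) * d ?t"
      by simp
    then show ?thesis
      using t by (simp only: d_half) (simp add: right_diff_distrib left_diff_distrib)
  qed
  ultimately show ?case
    by (simp add: mult.commute)
qed

text \<open>No plane at scale \<open>2 * r\<close> can be used when \<open>r\<close> is close to
  \<open>R\<close>, and the ball around \<open>z\<close> may stick out of the one around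
  \<open>x\<close>. Fullness at \<open>x\<close> supplies a point \<open>y\<close> of the set near
  the midpoint; the ball of radius \<open>r / 4\<close> around it lies in both balls, and its plane
  is the common third plane.\<close>

lemma tilt_neighbour:
  assumes x: "x \<in> S" and z: "z \<in> S" "norm (z - x) \<le> r" and r: "0 < r" "r \<le> R"
  shows "tilt_le m (72 * d r) (e z r) (e x r)"
proof -
  define w where "w = (1/2) *\<^sub>R oproj m (e x r) (z - x)"
  have w: "w \<in> plane m (e x r)"
    unfolding w_def by (intro subspace_scale[OF subspace_plane] oproj_in_plane)
  have nw: "norm w \<le> r / 2"
    using order_trans[OF norm_oproj_le[OF ortho[OF x r], of "z - x"] z(2)] by (simp add: w_def)
  then have "norm w \<le> r"
    using r by simp
  then obtain y where y: "y \<in> S" "norm (y - x - w) \<le> 1 / 16 * r"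
    using full_e[OF x r] w unfolding full_def by blast
  have pz: "norm (perp m (e x r) (z - x)) \<le> r / 16"
  proof -
    have "norm (perp m (e x r) (z - x)) \<le> d r * r"
      using x z r by (intro flat_d) auto
    also have "\<dots> \<le> 1 / 8192 * r"
      using d_le_8192[of r] r by (intro mult_right_mono) auto
    finally show ?thesis
      using r by simp
  qed
  have zx: "z - x = 2 *\<^sub>R w + perp m (e x r) (z - x)"
    by (simp add: w_def perp_def)
  have yx: "norm (y - x) \<le> 3 / 4 * r"
    using norm_triangle_ineq[of "y - x - w" w] y(2) nw r by simp
  have yz: "norm (y - z) \<le> 3 / 4 * r"
  proof -
    have "y - z = (y - x - w) - w - perp m (e x r) (z - x)"
      using zx by (simp add: algebra_simps scaleR_2)
    then have "norm (y - z) = norm (y - x - w - w - perp m (e x r) (z - x))"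
      by (rule arg_cong)
    then have "norm (y - z) \<le> norm (y - x - w) + norm w + norm (perp m (e x r) (z - x))"
      using norm_triangle_ineq4[of "y - x - w - w" "perp m (e x r) (z - x)"]
        norm_triangle_ineq4[of "y - x - w" w] by linarith
    then show ?thesis
      using y(2) nw pz r by simp
  qed
  \<comment> \<open>Passing from \<open>y\<close> to \<open>v\<close> as base point doubles the
    error to \<open>2 * d r * r\<close>, which is \<open>8 * d r\<close> relative to
    \<open>r / 4\<close>. Hence \<open>18 = 2 * (1 + 8)\<close>, and
    \<open>72 = 2 * (18 + 18)\<close> after comparing with both \<open>x\<close> and
    \<open>z\<close>.\<close>
  have from_y: "tilt_le m (18 * d r) (e y (r / 4)) (e v r)" if v: "v \<in> S" "norm (y - v) \<le> 3 / 4 * r" for v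
  proof -
    have "tilt_le m (2 * (d (r / 4) + 8 * d r)) (e y (r / 4)) (e v r)"
    proof (rule tilt_le_of_flat[where s = "r / 4" and z = y and \<epsilon> = "1 / 16" and S = S])
      show "flat m S (e y (r / 4)) y (r / 4) (d (r / 4))"
        using flat_e[of y "r / 4"] y r by (simp add: d_def)
      fix p assume p: "p \<in> S" "norm (p - y) \<le> r / 4"
      have "norm (p - v) \<le> norm (p - y) + norm (y - v)"
        using norm_triangle_ineq[of "p - y" "y - v"] by simp
      then have "norm (perp m (e v r) (p - v)) \<le> d r * r"
        using v r p by (intro flat_d) auto
      moreover have "norm (perp m (e v r) (y - v)) \<le> d r * r"
        using v r y by (intro flat_d) auto
      moreover have "norm (perp m (e v r) (p - y)) = norm (perp m (e v r) (p - v) - perp m (e v r) (y - v))"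
        by (simp add: perp_simps)
      ultimately have "norm (perp m (e v r) (p - y)) \<le> d r * r + d r * r"
        using norm_triangle_ineq4[of "perp m (e v r) (p - v)" "perp m (e v r) (y - v)"] by linarith
      then show "norm (perp m (e v r) (p - y)) \<le> 8 * d r * (r / 4)"
        by simp
    qed (use v y r ortho full_e[of y "r / 4"] d_nonneg in auto)
    then show ?thesis
      by (rule tilt_le_mono) (use d_mono[of "r / 4" r] r in simp)
  qed
  have "tilt_le m (2 * (18 * d r + 18 * d r)) (e z r) (e x r)"
    using x y z r yx yz d_nonneg d_le_8192[of r]
    by (intro tilt_le_common[where e'' = "e y (r / 4)"] from_y ortho) auto
  then show ?thesis
    by simp
qed

text \<open>The intermediate point \<open>y\<close> is present because \<open>z\<close> may be
  farther than \<open>r\<close> from \<open>x\<close>. The two changes of base point take place at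
  scale \<open>r\<close>; only then is the radius decreased, at the fixed point
  \<open>z\<close>.\<close>

lemma tilt_all_scales:
  assumes x: "x \<in> S" and y: "y \<in> S" "norm (y - x) \<le> r" and z: "z \<in> S" "norm (z - y) \<le> r"
    and r: "0 < r" "r \<le> R"
  shows "tilt_le m (tilt_const \<kappa> * d r) (e z (r / 2 ^ k)) (e x r)"
proof -
  let ?B = "6 / (1 - 2 powr - \<kappa>)"
  have B: "0 \<le> ?B"
    using \<kappa> by (simp add: powr_le_one_le less_imp_le powr_less_one)
  have "tilt_le m (?B * d r) (e z (r / 2 ^ k)) (e z r)"
    using tilt_dyadic[OF z(1) r, of k] by (rule tilt_le_mono) (use B d_nonneg in \<open>intro mult_left_mono, auto\<close>)
  moreover have "tilt_le m (72 * d r + 72 * d r) (e z r) (e x r)"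
    using d_nonneg[of r]
    by (intro tilt_le_trans[OF ortho[OF x r] ortho[OF y(1) r] tilt_neighbour[OF y(1) z r] tilt_neighbour[OF x y r]])
      simp
  ultimately have "tilt_le m (?B * d r + (72 * d r + 72 * d r)) (e z (r / 2 ^ k)) (e x r)"
    using d_nonneg[of r] by (rule_tac tilt_le_trans[OF ortho[OF x r] ortho[OF z(1) r]]) simp_all
  then show ?thesis
    by (simp add: tilt_const_def algebra_simps)
qed

text \<open>No hole can appear in the projection: at a point minimising the distance to the fibre, with a
  penalty for moving away from the start, the set at a comparable scale contains a point that
  does better.\<close>

lemma projection_surj:
  assumes x: "x \<in> S" and r: "0 < r" "r \<le> R"
    and w: "w \<in> plane m (e x r)" "norm w \<le> (1 - 74 * d r) * r"
  shows "\<exists>z\<in>S. norm (z - x) \<le> r \<and> oproj m (e x r) (z - x) = w"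
proof -
  let ?P = "oproj m (e x r)" and ?Q = "perp m (e x r)"
  have o: "orthonormal m (e x r)"
    by (rule ortho[OF x r])
  have "norm w \<le> r"
  proof -
    have "(1 - 74 * d r) * r \<le> 1 * r"
      using d_nonneg[of r] r by (intro mult_right_mono) auto
    then show ?thesis
      using w(2) by linarith
  qed
  then obtain z0 where z0: "z0 \<in> S" "norm (z0 - x) \<le> r" "norm (z0 - x - w) \<le> 1 / 16 * r"
    using full_e[OF x r] w unfolding full_def by blast
  define g where "g z = norm (?P (z - x) - w) + norm (z - z0) / 4" for z
  have P_lip: "norm (?P a - ?P b) \<le> norm (a - b)" for a b
    using norm_oproj_le[OF o, of "a - b"] by (simp add: oproj_simps)
  have "continuous_on S g"
  proof -
    have "continuous_on UNIV ?P"
      unfolding continuous_on_iff using P_lip by (metis dist_norm le_less_trans)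
    then have "continuous_on S (\<lambda>z. ?P (z - x))"
      by (rule continuous_on_compose2) (auto intro!: continuous_intros)
    then show ?thesis
      unfolding g_def by (intro continuous_intros) auto
  qed
  then obtain z where z: "z \<in> S" "\<And>y. y \<in> S \<Longrightarrow> g z \<le> g y"
    using continuous_attains_inf[OF S, of g] x by blast
  define \<rho> where "\<rho> = norm (?P (z - x) - w)"
  have "?P (z0 - x) - w = ?P (z0 - x - w)"
    by (simp only: oproj_simps oproj_plane[OF o w(1)])
  then have "g z0 \<le> 1 / 16 * r"
    using norm_oproj_le[OF o, of "z0 - x - w"] z0(3) by (simp add: g_def)
  then have gz: "g z \<le> 1 / 16 * r"
    using z(2)[OF z0(1)] by linarith
  then have zz0: "norm (z - z0) \<le> r / 4" and \<rho>r: "\<rho> \<le> r / 16"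
    using norm_ge_zero[of "?P (z - x) - w"] norm_ge_zero[of "z - z0"] unfolding g_def \<rho>_def by linarith+
  have "\<rho> = 0"
  proof (rule ccontr)
    assume "\<rho> \<noteq> 0"
    then have \<rho>: "0 < \<rho>"
      by (simp add: \<rho>_def)
    \<comment> \<open>The scale is at least \<open>2 * \<rho>\<close> so that the lift
      \<open>u\<close> below, of norm at most \<open>2 * \<rho>\<close>, is within the range of
      fullness, and at most \<open>4 * \<rho>\<close> so that the error \<open>s / 16\<close> is
      small against \<open>\<rho>\<close>.\<close>
    obtain k where k: "2 * \<rho> \<le> r / 2 ^ k" "r / 2 ^ k < 2 * (2 * \<rho>)"
      using dyadic_scale_exists[of "2 * \<rho>" r] \<rho> \<rho>r r by auto
    define s where "s = r / 2 ^ k"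
    have s: "0 < s" "s \<le> R" "2 * \<rho> \<le> s" "s \<le> 4 * \<rho>"
      using k \<rho> \<rho>r r by (auto simp: s_def)
    have "tilt_le m (tilt_const \<kappa> * d r) (e z s) (e x r)"
      unfolding s_def using x z0 z zz0 r by (intro tilt_all_scales[where y = z0]) auto
    then have tilt: "tilt_le m (1 / 2) (e z s) (e x r)"
      by (rule tilt_le_mono) (use tilt_d_le_half[of r] r in auto)
    have "w - ?P (z - x) \<in> plane m (e x r)"
      using w(1) oproj_in_plane by (intro subspace_diff[OF subspace_plane])
    then obtain u where u: "u \<in> plane m (e z s)" "?P u = w - ?P (z - x)" "(1 - 1 / 2) * norm u \<le> norm (w - ?P (z - x))"
      using tilt_le_surj[OF o ortho[OF z(1) s(1,2)] tilt] by auto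
    have nu: "norm u \<le> 2 * \<rho>"
      using u(3) by (simp add: \<rho>_def norm_minus_commute)
    obtain y where y: "y \<in> S" "norm (y - z - u) \<le> 1 / 16 * s"
      using full_e[OF z(1) s(1,2)] u(1) nu s(3) unfolding full_def by force
    have "?P (y - x) - w = ?P (y - z - u)"
      using u(2) by (simp add: oproj_simps algebra_simps)
    then have Py: "norm (?P (y - x) - w) \<le> 1 / 16 * s"
      using norm_oproj_le[OF o, of "y - z - u"] y(2) by simp
    have "norm (y - z) \<le> norm (y - z - u) + norm u"
      using norm_triangle_ineq[of "y - z - u" u] by simp
    then have "norm (y - z0) \<le> 1 / 16 * s + 2 * \<rho> + norm (z - z0)"
      using norm_triangle_ineq[of "y - z" "z - z0"] y(2) nu by simp
    \<comment> \<open>By \<open>s \<le> 4 * \<rho>\<close> the distance to the fibre drops from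
      \<open>\<rho>\<close> to at most \<open>\<rho> / 4\<close>, while the penalty grows by at most
      \<open>(\<rho> / 4 + 2 * \<rho>) / 4\<close>, that is \<open>9 / 16 * \<rho>\<close>.\<close>
    then have "g y < g z"
      using Py s \<rho> unfolding g_def \<rho>_def[symmetric] by simp
    then show False
      using z(2)[OF y(1)] by simp
  qed
  then have Pz: "?P (z - x) = w"
    by (simp add: \<rho>_def)
  have Qz0: "norm (?Q (z0 - x)) \<le> d r * r"
    using x r z0 by (intro flat_d) auto
  \<comment> \<open>The point \<open>z\<close> is not yet known to lie within \<open>r\<close> of
    \<open>x\<close>, so flatness is used at \<open>z0\<close> and transferred to the plane at
    \<open>x\<close>: 72 for the tilt and 1 for the flatness. The flatness at \<open>x\<close> of
    \<open>z0\<close> itself completes the 74 in the hypothesis on \<open>w\<close>.\<close>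
  have "norm (?Q (z - z0)) \<le> 73 * d r * r"
  proof -
    let ?v = "oproj m (e z0 r) (z - z0)" and ?v' = "perp m (e z0 r) (z - z0)"
    have "norm ?v' \<le> d r * r"
      using z0 z zz0 r by (intro flat_d) auto
    then have 1: "norm (?Q ?v') \<le> d r * r"
      using norm_perp_le[OF o] order_trans by blast
    have "norm (?Q ?v) \<le> 72 * d r * norm ?v"
      using tilt_neighbour[OF x z0(1,2) r] oproj_in_plane by (auto simp: tilt_le_def)
    also have "\<dots> \<le> 72 * d r * r"
      using norm_oproj_le[OF ortho[OF z0(1) r], of "z - z0"] zz0 r d_nonneg[of r] by (intro mult_left_mono) auto
    finally have 2: "norm (?Q ?v) \<le> 72 * d r * r" .
    have "?Q (z - z0) = ?Q (?v + ?v')"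
      by (simp only: oproj_plus_perp)
    also have "\<dots> = ?Q ?v + ?Q ?v'"
      by (rule perp_simps)
    finally show ?thesis
      using 1 2 norm_triangle_ineq[of "?Q ?v" "?Q ?v'"] by simp
  qed
  moreover have "?Q (z - x) = ?Q (z - z0) + ?Q (z0 - x)"
    by (simp add: perp_simps)
  ultimately have Qz: "norm (?Q (z - x)) \<le> 74 * d r * r"
    using Qz0 norm_triangle_ineq[of "?Q (z - z0)" "?Q (z0 - x)"] by simp
  have "norm (z - x) \<le> norm (?P (z - x)) + norm (?Q (z - x))"
    using norm_triangle_ineq[of "?P (z - x)" "?Q (z - x)"] by (simp add: oproj_plus_perp)
  also have "\<dots> \<le> r"
    using Pz Qz w(2) by (simp add: algebra_simps)
  finally show ?thesis
    using Pz z(1) by blast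
qed

text \<open>Slightly beyond \<open>R\<close> no fullness is assumed. It follows from the disc
  covered at scale \<open>t = min r R\<close>, because the given plane and the plane at scale
  \<open>t\<close> are both close to the same points of the set, so that the latter tilts little
  against the former.\<close>

lemma full_of_flat:
  assumes x: "x \<in> S" and r: "0 < r" "r \<le> 33 / 32 * R"
    and e': "orthonormal m e'" "flat m S e' x r \<delta>" "0 \<le> \<delta>" "\<delta> \<le> 1 / 8192"
  shows "full m S e' x r (1 / 16)"
  unfolding full_def
proof (intro ballI impI)
  fix w assume w: "w \<in> plane m e'" "norm w \<le> r"
  define t where "t = min r R"
  have t: "0 < t" "t \<le> R" "t \<le> r" "r \<le> 33 / 32 * t"
    using r R by (auto simp: t_def)
  have dt: "0 \<le> d t" "d t \<le> 1 / 8192"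
    using d_nonneg d_le_8192[of t] t by auto
  have ot: "orthonormal m (e x t)"
    by (rule ortho[OF x t(1,2)])
  have "tilt_le m (2 * (d t + 2 * \<delta>)) (e x t) e'"
  proof (rule tilt_le_of_flat[where s = t and z = x and \<epsilon> = "1 / 16" and S = S])
    show "flat m S (e x t) x t (d t)"
      using flat_e[of x t] x t by (simp add: d_def)
    fix y assume "y \<in> S" "norm (y - x) \<le> t"
    then have "norm (perp m e' (y - x)) \<le> \<delta> * r"
      using e'(2) t unfolding flat_def by auto
    also have "\<dots> \<le> \<delta> * (2 * t)"
      using t e' by (intro mult_left_mono) auto
    finally show "norm (perp m e' (y - x)) \<le> 2 * \<delta> * t"
      by simp
  qed (use x t ot full_e e' dt in auto)
  then have tilt: "tilt_le m (6 / 8192) (e x t) e'"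
    by (rule tilt_le_mono) (use dt e' in simp)
  \<comment> \<open>After this shrinking the norm is at most \<open>61 / 64 * (33 / 32) * t\<close>,
    about \<open>0.983 * t\<close>, so that the lift stays in the covered disc. The shrinking costs
    \<open>3 / 64 * r\<close> of the admissible \<open>r / 16\<close>; the remaining
    \<open>r / 64\<close> pays for flatness and tilt.\<close>
  define w' where "w' = (61 / 64) *\<^sub>R w"
  have "w' \<in> plane m e'"
    unfolding w'_def by (rule subspace_scale[OF subspace_plane w(1)])
  then obtain u where u: "u \<in> plane m (e x t)" "oproj m e' u = w'" "(1 - 6 / 8192) * norm u \<le> norm w'"
    using tilt_le_surj[OF e'(1) ot tilt] by auto
  have "norm w' \<le> 61 / 64 * (33 / 32 * t)"
    using w(2) t by (simp add: w'_def)
  then have nu: "norm u \<le> (1 - 74 / 8192) * t"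
    using u(3) t by simp
  also have "\<dots> \<le> (1 - 74 * d t) * t"
    using dt t by (intro mult_right_mono) auto
  finally obtain z where z: "z \<in> S" "norm (z - x) \<le> t" "oproj m (e x t) (z - x) = u"
    using projection_surj[OF x t(1,2) u(1)] by auto
  have 1: "norm (perp m (e x t) (z - x)) \<le> 1 / 8192 * t"
  proof -
    have "d t * t \<le> 1 / 8192 * t"
      using dt t by (intro mult_right_mono) auto
    then show ?thesis
      using flat_d[OF x t(1,2) z(1,2)] by linarith
  qed
  have "norm (perp m e' u) \<le> 6 / 8192 * norm u"
    using tilt u(1) by (simp add: tilt_le_def)
  then have 2: "norm (perp m e' u) \<le> 6 / 8192 * t"
    using nu t by simp
  have 3: "norm (w' - w) \<le> 3 / 64 * r"
  proof -
    have "w' - w = (- 3 / 64) *\<^sub>R w"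
      using scaleR_left_diff_distrib[of "61 / 64" 1 w] by (simp add: w'_def)
    then show ?thesis
      using w(2) by simp
  qed
  have "z - x - w = perp m (e x t) (z - x) + perp m e' u + (w' - w)"
    using z(3) u(2) by (simp add: perp_def)
  then have "norm (z - x - w) = norm (perp m (e x t) (z - x) + perp m e' u + (w' - w))"
    by (rule arg_cong)
  then have "norm (z - x - w) \<le> norm (perp m (e x t) (z - x)) + norm (perp m e' u) + norm (w' - w)"
    using norm_triangle_ineq[of "perp m (e x t) (z - x) + perp m e' u" "w' - w"]
      norm_triangle_ineq[of "perp m (e x t) (z - x)" "perp m e' u"] by linarith
  also have "\<dots> \<le> 1 / 16 * r"
    using 1 2 3 t by simp
  finally show "\<exists>z\<in>S. norm (z - x) \<le> r \<and> norm (z - x - w) \<le> 1 / 16 * r"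
    using z t by (intro bexI[of _ z]) auto
qed

end

text \<open>The first factor is the part of a radius that the projection covers, the second the
  shrinking of the radius in \<open>hausdorff_ball_ge\<close>; numerically 0.968 against
  0.975.\<close>

lemma sqrt15_bound: "sqrt 15 / 4 \<le> (1 - 74 / 8192) * (63 / 64)"
proof -
  have "sqrt 15 \<le> 4 * ((1 - 74 / 8192) * (63 / 64))"
    by (rule real_le_lsqrt) (simp_all add: power2_eq_square)
  then show ?thesis
    by simp
qed

text \<open>Projecting onto the plane and reading off its coordinates does not increase distances,
  so the measure of the set is at least that of the disc in \<open>Rn m\<close> which the image
  contains.\<close>

lemma hausdorff_ball_ge:
  fixes S :: "real finseq set"
  assumes "flat_field m S e R C \<kappa>" and m: "1 \<le> m" and x: "x \<in> S" and r: "0 < r" "r \<le> R"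
  shows "ennreal ((sqrt 15 / 4) ^ m * unit_ball_vol (real m) * r ^ m) \<le> hausdorff_outer (real m) (S \<inter> ball x r)"
proof -
  interpret flat_field m S e R C \<kappa>
    by fact
  \<comment> \<open>The points supplied by \<open>projection_surj\<close> lie in a closed ball; the
    smaller radius puts them into the open ball of radius \<open>r\<close>.\<close>
  define t where "t = 63 / 64 * r"
  have t: "0 < t" "t \<le> R" "t < r"
    using r by (auto simp: t_def)
  define b where "b = e x t"
  have b: "orthonormal m b"
    unfolding b_def by (rule ortho[OF x t(1,2)])
  define f where "f z = embed_Rn m (\<lambda>i. (z - x) \<bullet> b i)" for z
  have "ennreal (unit_ball_vol m * (sqrt 15 / 4 * r) ^ m) \<le> hausdorff_outer (real m) (f ` (S \<inter> ball x r))"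
  proof (rule hausdorff_cball_Rn_ge[OF m])
    fix u assume u: "u \<in> Rn m" "norm u \<le> sqrt 15 / 4 * r"
    define w where "w = (\<Sum>i<m. coord u i *\<^sub>R b i)"
    have w: "w \<in> plane m b"
      unfolding w_def plane_def by (intro span_sum span_mul span_base) auto
    have wb: "w \<bullet> b i = coord u i" if "i < m" for i
    proof -
      have "w \<bullet> b i = (\<Sum>j<m. if j = i then coord u i else 0)"
        unfolding w_def inner_sum_left using b that by (intro sum.cong) (auto simp: orthonormal_def)
      then show ?thesis
        using that by simp
    qed
    have "norm w = L2_set (\<lambda>i. w \<bullet> b i) {..<m}"
      using norm_oproj_eq_L2_set[OF b, of w] oproj_plane[OF b w] by simp
    also have "\<dots> = L2_set (\<lambda>i. norm (coord u i)) {..<m}"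
      unfolding L2_set_def using wb by (intro arg_cong[of _ _ sqrt] sum.cong) auto
    also have "\<dots> = norm u"
      using u(1) by (intro norm_finseq_eq_L2_set[symmetric]) (simp add: Rn_def)
    also have "\<dots> \<le> sqrt 15 / 4 * r"
      by (rule u(2))
    also have "\<dots> \<le> (1 - 74 / 8192) * (63 / 64) * r"
      using r by (intro mult_right_mono sqrt15_bound) simp
    also have "\<dots> = (1 - 74 / 8192) * t"
      by (simp add: t_def)
    also have "\<dots> \<le> (1 - 74 * d t) * t"
      using d_le_8192[of t] t by (intro mult_right_mono) auto
    finally obtain z where z: "z \<in> S" "norm (z - x) \<le> t" "oproj m b (z - x) = w"
      using projection_surj[OF x t(1,2)] w unfolding b_def by auto
    have zb: "(z - x) \<bullet> b i = coord u i" if "i < m" for i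
      using inner_perp_basis[OF b that, of "z - x"] z(3) wb[OF that] by (simp add: perp_def inner_diff_left)
    have "f z = u"
    proof (rule finseq_eqI)
      fix i
      show "coord (f z) i = coord u i"
        using zb[of i] u(1) by (simp add: f_def coord_embed_Rn Rn_def)
    qed
    moreover have "z \<in> S \<inter> ball x r"
      using z t by (simp add: dist_norm norm_minus_commute)
    ultimately show "u \<in> f ` (S \<inter> ball x r)"
      by blast
  qed (use r in simp)
  also have "\<dots> \<le> hausdorff_outer (real m) (S \<inter> ball x r)"
  proof (rule hausdorff_outer_image_le_1)
    fix y z
    have "dist (f y) (f z) = L2_set (\<lambda>i. (y - z) \<bullet> b i) {..<m}"
      unfolding f_def dist_embed_Rn by (rule L2_set_cong) (auto simp: inner_diff_left)
    also have "\<dots> = norm (oproj m b (y - z))"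
      by (rule norm_oproj_eq_L2_set[OF b, symmetric])
    also have "\<dots> \<le> dist y z"
      unfolding dist_norm by (rule norm_oproj_le[OF b])
    finally show "dist (f y) (f z) \<le> dist y z" .
  qed (use m in simp)
  also have "unit_ball_vol m * (sqrt 15 / 4 * r) ^ m = (sqrt 15 / 4) ^ m * unit_ball_vol (real m) * r ^ m"
    by (simp only: power_mult_distrib mult_ac)
  finally show ?thesis .
qed

section \<open>The energy controls flatness\<close>

text \<open>In edge coordinates the simplex contains the image of a cube of side
  \<open>1 / k\<close>, on which the inverse map has Lipschitz constant \<open>k / \<sigma>\<close>
  by nondegeneracy. The simplex is in turn contained in the image of the unit cube and so has finite
  measure; \<open>enn2real\<close> would turn an infinite value into 0.\<close>

lemma simplex_hausdorff_ge:
  fixes y :: "nat \<Rightarrow> real finseq"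
  assumes k: "1 \<le> k" and \<sigma>: "0 < \<sigma>"
    and nd: "\<And>u i. i < k \<Longrightarrow> \<sigma> * \<bar>u i\<bar> \<le> norm (\<Sum>j<k. u j *\<^sub>R (y (Suc j) - y 0))"
  shows "(\<sigma> / (real k * real k)) ^ k \<le> enn2real (hausdorff_outer (real k) (convex hull (y ` {..k})))"
proof -
  define v where "v j = y (Suc j) - y 0" for j
  define L where "L u = (\<Sum>j<k. coord u j *\<^sub>R v j)" for u
  define T where "T u = y 0 + L u" for u
  have lin: "linear L"
    unfolding L_def by (rule linearI) (simp_all add: scaleR_add_left sum.distrib scaleR_sum_right)
  have "convex (unit_cube k)"
    unfolding convex_def unit_cube_def Rn_def
  proof (intro ballI allI impI, safe)
    fix u w :: "real finseq" and a b :: real and i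
    assume *: "\<forall>i<k. 0 \<le> coord u i \<and> coord u i \<le> 1" "\<forall>i<k. 0 \<le> coord w i \<and> coord w i \<le> 1"
      "0 \<le> a" "0 \<le> b" "a + b = 1" "i < k"
    show "0 \<le> coord (a *\<^sub>R u + b *\<^sub>R w) i"
      using * by simp
    have "a * coord u i + b * coord w i \<le> a * 1 + b * 1"
      using * by (intro add_mono mult_left_mono) auto
    then show "coord (a *\<^sub>R u + b *\<^sub>R w) i \<le> 1"
      using * by simp
  qed simp
  then have "convex (T ` unit_cube k)"
    using convex_translation[OF convex_linear_image[OF lin], of "unit_cube k" "y 0"]
    by (simp add: T_def image_image)
  moreover have "y ` {..k} \<subseteq> T ` unit_cube k"
  proof
    fix p assume "p \<in> y ` {..k}"
    then obtain i where i: "i \<le> k" "p = y i"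
      by auto
    show "p \<in> T ` unit_cube k"
    proof (cases i)
      case 0
      have "T 0 = p"
        using i 0 by (simp add: T_def L_def)
      moreover have "0 \<in> unit_cube k"
        by (simp add: unit_cube_def Rn_def)
      ultimately show ?thesis by blast
    next
      case (Suc j)
      define b where "b = embed_Rn k (\<lambda>i. if i = j then 1 else 0)"
      have "L b = (\<Sum>i<k. if i = j then v j else 0)"
        unfolding L_def b_def by (rule sum.cong) (auto simp: coord_embed_Rn)
      then have "T b = p"
        using i Suc by (simp add: T_def v_def)
      moreover have "b \<in> unit_cube k"
        by (auto simp: unit_cube_def b_def embed_Rn_in_Rn coord_embed_Rn)
      ultimately show ?thesis by blast
    qed
  qed
  ultimately have hull: "convex hull (y ` {..k}) \<subseteq> T ` unit_cube k"
    by (intro hull_minimal)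
  define K where "K = (\<Sum>j<k. norm (v j)) + 1"
  have K: "0 < K"
    unfolding K_def by (intro add_nonneg_pos sum_nonneg) auto
  have "hausdorff_outer (real k) (T ` unit_cube k) \<le> ennreal (K powr real k) * hausdorff_outer (real k) (unit_cube k)"
  proof (rule hausdorff_outer_image_le[OF _ K])
    fix u w
    have "dist (T u) (T w) = norm (L (u - w))"
      by (simp add: T_def dist_norm linear_diff[OF lin])
    also have "\<dots> \<le> (\<Sum>j<k. norm (coord (u - w) j *\<^sub>R v j))"
      unfolding L_def by (rule norm_sum)
    also have "\<dots> \<le> (\<Sum>j<k. norm (u - w) * norm (v j))"
    proof (rule sum_mono)
      fix j
      show "norm (coord (u - w) j *\<^sub>R v j) \<le> norm (u - w) * norm (v j)"
        using norm_coord_le[of "u - w" j] by (simp add: mult_right_mono)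
    qed
    also have "\<dots> \<le> K * dist u w"
      unfolding K_def dist_norm sum_distrib_left[symmetric] by (simp add: distrib_left distrib_right mult.commute)
    finally show "dist (T u) (T w) \<le> K * dist u w" .
  qed (use k in simp)
  also have "\<dots> < \<infinity>"
    using hausdorff_unit_cube_finite[OF k] by (simp add: ennreal_mult_less_top)
  finally have fin: "hausdorff_outer (real k) (convex hull (y ` {..k})) < \<infinity>"
    using hausdorff_outer_mono[OF hull, of "real k"] by (rule_tac le_less_trans)
  define B where "B = {u \<in> Rn k. \<forall>i<k. 0 \<le> coord u i \<and> coord u i \<le> 1 / real k}"
  have T_hull: "T ` B \<subseteq> convex hull (y ` {..k})"
  proof
    fix p assume "p \<in> T ` B"
    then obtain u where u: "u \<in> B" "p = T u"
      by blast
    define a where "a i = (case i of 0 \<Rightarrow> 1 - (\<Sum>j<k. coord u j) | Suc j \<Rightarrow> coord u j)" for i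
    have "(\<Sum>j<k. coord u j) \<le> (\<Sum>j<k. 1 / real k)"
      using u by (intro sum_mono) (auto simp: B_def)
    then have s1: "(\<Sum>j<k. coord u j) \<le> 1"
      using k by simp
    have "p = (\<Sum>i\<in>{..k}. a i *\<^sub>R y i)"
      unfolding u(2) T_def L_def v_def sum.atMost_shift
      by (simp add: a_def algebra_simps sum_subtractf scaleR_sum_left scaleR_left_diff_distrib)
    also have "\<dots> \<in> convex hull (y ` {..k})"
    proof (rule convex_sum)
      show "(\<Sum>i\<in>{..k}. a i) = 1"
        by (simp add: sum.atMost_shift a_def)
      show "0 \<le> a i" if "i \<in> {..k}" for i
        using that u s1 by (cases i) (auto simp: a_def B_def)
      show "y i \<in> convex hull (y ` {..k})" if "i \<in> {..k}" for i
        using that by (intro hull_inc) auto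
    qed auto
    finally show "p \<in> convex hull (y ` {..k})" .
  qed
  have expand: "norm (u - w) \<le> (real k / \<sigma>) * norm (T u - T w)" if "u \<in> B" "w \<in> B" for u w
  proof -
    have "T u - T w = (\<Sum>j<k. coord (u - w) j *\<^sub>R (y (Suc j) - y 0))"
      by (simp add: T_def L_def v_def sum_subtractf scaleR_left_diff_distrib)
    then have "\<bar>coord (u - w) i\<bar> \<le> norm (T u - T w) / \<sigma>" if "i < k" for i
      using nd[OF that, of "coord (u - w)"] \<sigma> by (simp add: field_simps)
    then have "(\<Sum>i<k. norm (coord (u - w) i)) \<le> (\<Sum>i<k. norm (T u - T w) / \<sigma>)"
      by (intro sum_mono) simp
    moreover have "norm (u - w) \<le> (\<Sum>i<k. norm (coord (u - w) i))"
      using that by (intro norm_le_sum_coord) (auto simp: B_def Rn_def)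
    ultimately show ?thesis
      by simp
  qed
  have inj: "inj_on T B"
    using expand by (intro inj_onI) (metis diff_self mult_zero_right norm_le_zero_iff norm_zero right_minus_eq)
  define g where "g = inv_into B T"
  have gT: "g (T u) = u" if "u \<in> B" for u
    unfolding g_def using inj that by (rule inv_into_f_f)
  have "ennreal ((1 / real k) ^ k) \<le> hausdorff_outer (real k) B"
    using k by (intro hausdorff_box_ge) (auto simp: B_def)
  also have "B = g ` (T ` B)"
    using gT by (auto simp: image_image)
  also have "hausdorff_outer (real k) (g ` (T ` B)) \<le> ennreal ((real k / \<sigma>) powr real k) * hausdorff_outer (real k) (T ` B)"
  proof (rule hausdorff_outer_image_le)
    fix p q assume "p \<in> T ` B" "q \<in> T ` B"
    then show "dist (g p) (g q) \<le> real k / \<sigma> * dist p q"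
      using expand gT by (auto simp: dist_norm)
  qed (use k \<sigma> in auto)
  also have "\<dots> \<le> ennreal ((real k / \<sigma>) powr real k) * hausdorff_outer (real k) (convex hull (y ` {..k}))"
    using T_hull by (intro mult_left_mono hausdorff_outer_mono) auto
  also have "\<dots> = ennreal ((real k / \<sigma>) ^ k * enn2real (hausdorff_outer (real k) (convex hull (y ` {..k}))))"
    using fin k \<sigma> by (simp add: powr_realpow ennreal_mult ennreal_enn2real_if)
  finally have "(1 / real k) ^ k \<le> (real k / \<sigma>) ^ k * enn2real (hausdorff_outer (real k) (convex hull (y ` {..k})))"
    using k \<sigma> by (subst (asm) ennreal_le_iff) auto
  then have "(\<sigma> / real k) ^ k * (1 / real k) ^ k
      \<le> (\<sigma> / real k) ^ k * ((real k / \<sigma>) ^ k * enn2real (hausdorff_outer (real k) (convex hull (y ` {..k}))))"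
    using \<sigma> by (intro mult_left_mono) auto
  also have "(\<sigma> / real k) ^ k * ((real k / \<sigma>) ^ k * enn2real (hausdorff_outer (real k) (convex hull (y ` {..k}))))
    = enn2real (hausdorff_outer (real k) (convex hull (y ` {..k})))"
    using k \<sigma> by (simp add: mult.assoc[symmetric] power_mult_distrib[symmetric])
  also have "(\<sigma> / real k) ^ k * (1 / real k) ^ k = (\<sigma> / (real k * real k)) ^ k"
    by (simp add: power_mult_distrib[symmetric])
  finally show ?thesis .
qed

lemma curvK_ge:
  assumes \<sigma>: "0 < \<sigma>"
    and nd: "\<And>u i. i < m + 1 \<Longrightarrow> \<sigma> * \<bar>u i\<bar> \<le> norm (\<Sum>j<m + 1. u j *\<^sub>R (y (Suc j) - y 0))"
    and D: "\<And>i j. i \<le> m + 1 \<Longrightarrow> j \<le> m + 1 \<Longrightarrow> dist (y i) (y j) \<le> D"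
  shows "(\<sigma> / (real (m + 1) * real (m + 1))) ^ (m + 1) / D ^ (m + 2) \<le> curvK m y"
proof -
  let ?X = "y ` {..m + 1}"
  have fin: "bounded ?X"
    by (intro finite_imp_bounded) auto
  \<comment> \<open>Testing nondegeneracy on a single edge shows that the diameter is positive, so
    that the quotient is not the default value 0.\<close>
  have "\<sigma> * \<bar>1\<bar> \<le> norm (\<Sum>j<m + 1. (if j = 0 then 1 else 0) *\<^sub>R (y (Suc j) - y 0))"
    using nd[of 0 "\<lambda>j. if j = 0 then 1 else 0"] by simp
  also have "(\<Sum>j<m + 1. (if j = 0 then 1 else 0) *\<^sub>R (y (Suc j) - y 0)) = (\<Sum>j<m + 1. if j = 0 then y 1 - y 0 else 0)"
    by (rule sum.cong) auto
  also have "\<dots> = y 1 - y 0"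
    by (subst sum.delta) auto
  finally have "\<sigma> \<le> dist (y 1) (y 0)"
    by (simp add: dist_norm)
  also have "\<dots> \<le> diameter ?X"
    using fin by (rule diameter_bounded_bound) auto
  finally have pos: "0 < diameter ?X"
    using \<sigma> by simp
  have le: "diameter ?X \<le> D"
    using D D[of 0 0] by (intro diameter_le_dist) auto
  have "(\<sigma> / (real (m + 1) * real (m + 1))) ^ (m + 1) \<le> enn2real (hausdorff_outer (real (m + 1)) (convex hull ?X))"
    using simplex_hausdorff_ge[OF _ \<sigma> nd] by simp
  then show ?thesis
    unfolding curvK_def using pos le \<sigma>
    by (intro frac_le power_mono) auto
qed

text \<open>The choice is greedy: as long as at most \<open>m\<close> vectors have been found, they
  lie in some \<open>m\<close>-plane inside \<open>Rn n\<close>, and the point of \<open>D\<close>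
  far from this plane becomes the next vector.\<close>

lemma nondegenerate_vectors_exist:
  fixes D :: "real finseq set"
  assumes m: "m \<le> n" and D: "D \<subseteq> Rn n" and r: "0 < r" and \<delta>: "0 < \<delta>" "\<delta> \<le> 1"
    and far: "\<And>e. orthonormal m e \<Longrightarrow> \<forall>i<m. e i \<in> Rn n \<Longrightarrow> \<exists>z\<in>D. norm z \<le> r \<and> \<delta> * r < norm (perp m e z)"
    and k: "k \<le> m + 1"
  shows "\<exists>v. (\<forall>i<k. v i \<in> D \<and> norm (v i) \<le> r) \<and>
    (\<forall>u. \<forall>i<k. r * (\<delta> / 2) ^ k * \<bar>u i\<bar> \<le> norm (\<Sum>j<k. u j *\<^sub>R v j))"
  using k
proof (induction k)
  case (Suc k)
  then obtain v where v: "\<And>i. i < k \<Longrightarrow> v i \<in> D" "\<And>i. i < k \<Longrightarrow> norm (v i) \<le> r"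
    "\<And>u i. i < k \<Longrightarrow> r * (\<delta> / 2) ^ k * \<bar>u i\<bar> \<le> norm (\<Sum>j<k. u j *\<^sub>R v j)"
    by auto
  obtain k' e' where e': "k' \<le> card (v ` {..<k})" "orthonormal k' e'" "\<forall>i<k'. e' i \<in> Rn n" "v ` {..<k} \<subseteq> plane k' e'"
    using orthonormal_contains_finite[of "v ` {..<k}" "Rn n"] v(1) D subspace_Rn by blast
  have "k' \<le> m"
    using e'(1) card_image_le[of "{..<k}" v] Suc.prems by simp
  then obtain e where e: "orthonormal m e" "\<forall>i<m. e i \<in> Rn n" "plane k' e' \<subseteq> plane m e"
    using orthonormal_extend_to[OF _ m e'(2,3)] by blast
  have ve: "v j \<in> plane m e" if "j < k" for j
    using that e'(4) e(3) by blast
  obtain z where z: "z \<in> D" "norm z \<le> r" "\<delta> * r < norm (perp m e z)"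
    using far[OF e(1,2)] by blast
  have "r * (\<delta> / 2) ^ Suc k * \<bar>u i\<bar> \<le> norm (\<Sum>j<Suc k. u j *\<^sub>R (v(k := z)) j)" if i: "i < Suc k" for u i
  proof -
    define X where "X = (\<Sum>j<k. u j *\<^sub>R v j)"
    have sum: "(\<Sum>j<Suc k. u j *\<^sub>R (v(k := z)) j) = X + u k *\<^sub>R z"
      by (simp add: X_def)
    have "X \<in> plane m e"
      unfolding X_def using ve by (intro subspace_sum[OF subspace_plane] subspace_scale[OF subspace_plane]) auto
    then have "perp m e (X + u k *\<^sub>R z) = u k *\<^sub>R perp m e z"
      using perp_plane[OF e(1)] by (simp add: perp_simps)
    then have "\<bar>u k\<bar> * norm (perp m e z) \<le> norm (X + u k *\<^sub>R z)"
      using norm_perp_le[OF e(1), of "X + u k *\<^sub>R z"] by simp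
    moreover have "\<bar>u k\<bar> * (\<delta> * r) \<le> \<bar>u k\<bar> * norm (perp m e z)"
      using z(3) by (intro mult_left_mono) auto
    ultimately have A: "\<bar>u k\<bar> * (\<delta> * r) \<le> norm (X + u k *\<^sub>R z)"
      by linarith
    have "norm X - norm (u k *\<^sub>R z) \<le> norm (X + u k *\<^sub>R z)"
      by (rule norm_diff_ineq)
    moreover have "norm (u k *\<^sub>R z) \<le> \<bar>u k\<bar> * r"
      using z(2) by (simp add: mult_left_mono)
    ultimately have B: "norm X - \<bar>u k\<bar> * r \<le> norm (X + u k *\<^sub>R z)"
      by linarith
    have pw: "(\<delta> / 2) ^ k \<le> 1"
      using \<delta> by (intro power_le_one) auto
    \<comment> \<open>If the new coefficient \<open>u k\<close> is large, the part of
      \<open>z\<close> perpendicular to the plane gives the bound; if it is small, the old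
      combination \<open>X\<close> dominates. The threshold is set so that each case costs at most
      the factor \<open>\<delta> / 2\<close>.\<close>
    show ?thesis
      unfolding sum
    proof (cases "i = k \<or> (\<delta> / 2) ^ k * \<bar>u i\<bar> / 2 \<le> \<bar>u k\<bar>")
      case True
      have "(\<delta> / 2) ^ k * \<bar>u i\<bar> / 2 \<le> \<bar>u k\<bar>"
      proof (cases "i = k")
        case True
        have "(\<delta> / 2) ^ k * \<bar>u k\<bar> \<le> 1 * \<bar>u k\<bar>"
          using pw by (intro mult_right_mono) auto
        then show ?thesis
          using True by simp
      qed (use True in simp)
      then have "(\<delta> / 2) ^ k * \<bar>u i\<bar> / 2 * (\<delta> * r) \<le> \<bar>u k\<bar> * (\<delta> * r)"
        using \<delta> r by (intro mult_right_mono) auto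
      then show "r * (\<delta> / 2) ^ Suc k * \<bar>u i\<bar> \<le> norm (X + u k *\<^sub>R z)"
        using A by (simp add: mult_ac)
    next
      case False
      then have "i < k" "\<bar>u k\<bar> \<le> (\<delta> / 2) ^ k * \<bar>u i\<bar> / 2"
        using i by auto
      then have "\<bar>u k\<bar> * r \<le> (\<delta> / 2) ^ k * \<bar>u i\<bar> / 2 * r"
        using r by (intro mult_right_mono) auto
      moreover have "r * (\<delta> / 2) ^ k * \<bar>u i\<bar> \<le> norm X"
        unfolding X_def by (rule v(3)[OF \<open>i < k\<close>])
      ultimately have "r * (\<delta> / 2) ^ k * \<bar>u i\<bar> / 2 \<le> norm (X + u k *\<^sub>R z)"
        using B by (simp add: mult_ac)
      moreover have "\<delta> * (r * (\<delta> / 2) ^ k * \<bar>u i\<bar> / 2) \<le> 1 * (r * (\<delta> / 2) ^ k * \<bar>u i\<bar> / 2)"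
        using \<delta> r by (intro mult_right_mono) auto
      ultimately show "r * (\<delta> / 2) ^ Suc k * \<bar>u i\<bar> \<le> norm (X + u k *\<^sub>R z)"
        by (simp add: mult_ac)
    qed
  qed
  moreover have "\<forall>i<Suc k. (v(k := z)) i \<in> D \<and> norm ((v(k := z)) i) \<le> r"
    using v z by (auto simp: less_Suc_eq)
  ultimately show ?case
    by blast
qed auto

text \<open>The bound is taken at an index where \<open>\<bar>u i\<bar>\<close> is maximal: there
  the perturbation consumes at most half of it, and the maximum dominates all other
  coefficients.\<close>

lemma nondegenerate_perturbation:
  fixes v v' :: "nat \<Rightarrow> 'a::real_normed_vector"
  assumes nd: "\<And>u i. i < k \<Longrightarrow> \<sigma> * \<bar>u i\<bar> \<le> norm (\<Sum>j<k. u j *\<^sub>R v j)"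
    and near: "\<And>j. j < k \<Longrightarrow> norm (v' j - v j) \<le> \<sigma> / (2 * real k)" and \<sigma>: "0 < \<sigma>" and i: "i < k"
  shows "\<sigma> / 2 * \<bar>u i\<bar> \<le> norm (\<Sum>j<k. u j *\<^sub>R v' j)"
proof -
  define M where "M = Max ((\<lambda>i. \<bar>u i\<bar>) ` {..<k})"
  have "M \<in> (\<lambda>i. \<bar>u i\<bar>) ` {..<k}"
    unfolding M_def using i by (intro Max_in) auto
  then obtain j where j: "j < k" "M = \<bar>u j\<bar>"
    by auto
  have M: "\<bar>u a\<bar> \<le> M" if "a < k" for a
    unfolding M_def using that by (intro Max_ge) auto
  have "norm (\<Sum>a<k. u a *\<^sub>R (v' a - v a)) \<le> (\<Sum>a<k. norm (u a *\<^sub>R (v' a - v a)))"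
    by (rule norm_sum)
  also have "\<dots> \<le> (\<Sum>a<k. M * (\<sigma> / (2 * real k)))"
  proof (rule sum_mono)
    fix a assume "a \<in> {..<k}"
    then have "\<bar>u a\<bar> * norm (v' a - v a) \<le> M * (\<sigma> / (2 * real k))"
      using M[of a] near[of a] j by (intro mult_mono) auto
    then show "norm (u a *\<^sub>R (v' a - v a)) \<le> M * (\<sigma> / (2 * real k))"
      by simp
  qed
  also have "\<dots> = \<sigma> / 2 * M"
    using i by simp
  finally have "norm (\<Sum>a<k. u a *\<^sub>R (v' a - v a)) \<le> \<sigma> / 2 * M" .
  moreover have "(\<Sum>a<k. u a *\<^sub>R v' a) = (\<Sum>a<k. u a *\<^sub>R v a) + (\<Sum>a<k. u a *\<^sub>R (v' a - v a))"
    by (simp add: scaleR_right_diff_distrib sum_subtractf)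
  moreover have "\<sigma> * M \<le> norm (\<Sum>a<k. u a *\<^sub>R v a)"
    using nd[OF j(1), of u] j(2) by simp
  ultimately have "\<sigma> / 2 * M \<le> norm (\<Sum>a<k. u a *\<^sub>R v' a)"
    using norm_diff_ineq[of "\<Sum>a<k. u a *\<^sub>R v a" "\<Sum>a<k. u a *\<^sub>R (v' a - v a)"] by simp
  moreover have "\<sigma> / 2 * \<bar>u i\<bar> \<le> \<sigma> / 2 * M"
    using \<sigma> M[OF i] by (intro mult_left_mono) auto
  ultimately show ?thesis
    by linarith
qed

lemma closed_product_set:
  fixes A :: "nat \<Rightarrow> 'a::real_inner set"
  assumes "\<And>i. i < l \<Longrightarrow> closed (A i)"
  shows "closed (product_set l A)"
proof -
  have cont: "continuous_on UNIV (\<lambda>y :: 'a finseq. coord y i)" for i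
    unfolding continuous_on_iff using dist_coord_le by (metis le_less_trans)
  have "product_set l A = (\<Inter>i\<in>{..<l}. (\<lambda>y. coord y i) -` A i) \<inter> (\<Inter>i\<in>{l..}. (\<lambda>y. coord y i) -` {0})"
    by (auto simp: product_set_def)
  then show ?thesis
    using assms by (auto intro!: closed_Int closed_INT closed_vimage cont)
qed

text \<open>Fixed vertices \<open>z\<close> minorise the inner supremum, and a closed
  \<open>W\<close> is measurable, so its indicator integrates to its Hausdorff measure. The integral
  is a supremum over simple functions below the integrand, hence the pointwise comparison suffices
  although measurability of the inner supremum has not been established.\<close>

lemma energy_ge:
  fixes S :: "real finseq set"
  assumes "closed W" "W \<subseteq> finpower l S" "0 \<le> K" "0 \<le> p"
    and z: "\<And>i. i \<in> {l..m + 1} \<Longrightarrow> z i \<in> S"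
    and K: "\<And>y. y \<in> W \<Longrightarrow> K \<le> curvK m (\<lambda>i. if i < l then coord y i else z i)"
  shows "ennreal (K powr p) * hausdorff_outer (real (m * l)) W \<le> energy m p l S"
proof -
  let ?M = "hausdorff_measure (real (m * l)) :: real finseq finseq measure"
  have W: "W \<in> sets ?M"
    by (rule closed_hausdorff_measurable) fact
  have "ennreal (K powr p) * hausdorff_outer (real (m * l)) W = ennreal (K powr p) * emeasure ?M W"
    using W by (simp add: emeasure_hausdorff_measure)
  also have "\<dots> = (\<integral>\<^sup>+ y. ennreal (K powr p) * indicator W y \<partial>?M)"
    using W by (simp add: nn_integral_cmult_indicator)
  also have "\<dots> \<le> energy m p l S"
    unfolding energy_def
  proof (rule nn_integral_mono)
    fix y
    show "ennreal (K powr p) * indicator W y \<le>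
      (SUP z\<in>{z. \<forall>i\<in>{l..m + 1}. z i \<in> S}. ennreal (curvK m (\<lambda>i. if i < l then coord y i else z i) powr p)) *
      indicator (finpower l S) y"
    proof (cases "y \<in> W")
      case True
      have "ennreal (K powr p) \<le> ennreal (curvK m (\<lambda>i. if i < l then coord y i else z i) powr p)"
        using assms K[OF True] by (intro ennreal_leI powr_mono2) auto
      also have "\<dots> \<le> (SUP z\<in>{z. \<forall>i\<in>{l..m + 1}. z i \<in> S}.
          ennreal (curvK m (\<lambda>i. if i < l then coord y i else z i) powr p))"
        using z by (intro SUP_upper) auto
      finally show ?thesis
        using True assms(2) by (auto simp: indicator_def)
    qed simp
  qed
  finally show ?thesis .
qed

definition has_flat_plane :: "nat \<Rightarrow> nat \<Rightarrow> real finseq set \<Rightarrow> real finseq \<Rightarrow> real \<Rightarrow> real \<Rightarrow> bool"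
  where "has_flat_plane n m S x r \<delta> \<longleftrightarrow>
    (\<exists>e. orthonormal m e \<and> (\<forall>i<m. e i \<in> Rn n) \<and> flat m S e x r \<delta>)"

text \<open>The vertices of a fat simplex may move within balls of radius \<open>\<tau>\<close>, a
  multiple of \<open>r * \<delta> ^ k\<close>, while the curvature stays at least a multiple of
  \<open>\<delta> ^ (k * k) / r\<close>; integration over a product of \<open>l\<close> such pieces
  of the set gives the bound. The Ahlfors bound is applied only at
  \<open>\<tau> \<le> r / 2\<close>, so \<open>r\<close> may exceed \<open>R\<close>, and this lets
  the scale grow later on. The constant precedes all data of the set, including
  \<open>n\<close>.\<close>

lemma energy_ge_of_not_flat:
  assumes m: "1 \<le> m" and l: "l \<in> {1..m + 2}" and p: "0 < p"
  obtains c where "0 < c" and "\<And>n S A R E x r \<delta>. \<lbrakk>m \<le> n; compact S; S \<subseteq> Rn n; 0 < A;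
    \<forall>y\<in>S. \<forall>s. 0 < s \<and> s \<le> R \<longrightarrow> ennreal (A * s ^ m) \<le> hausdorff_outer (real m) (S \<inter> ball y s);
    energy m p l S \<le> ennreal E; 0 \<le> E; x \<in> S; 0 < r; r \<le> 2 * R; 0 < \<delta>; \<delta> \<le> 1;
    \<not> has_flat_plane n m S x r \<delta>\<rbrakk> \<Longrightarrow>
    c * A ^ l * \<delta> powr (real ((m + 1) * (m + 1)) * p + real ((m + 1) * (m * l))) \<le> E * r powr (p - real (m * l))"
proof -
  define k where "k = m + 1"
  have k: "2 \<le> k"
    using m by (simp add: k_def)
  obtain c1 where c1: "0 < c1" "\<And>(A :: nat \<Rightarrow> real finseq set) a. 0 < a \<Longrightarrow>
    (\<forall>i<l. compact (A i) \<and> ennreal a \<le> hausdorff_outer (real m) (A i)) \<Longrightarrow>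
    ennreal (c1 * a ^ l) \<le> hausdorff_outer (real (m * l)) (product_set l A)"
    using hausdorff_product_set_ge[OF m, of l] l by auto
  \<comment> \<open>\<open>c2\<close> and \<open>c3\<close> collect the factors in the curvature
    bound and in \<open>\<tau>\<close> that depend on \<open>k\<close> alone.\<close>
  define c2 where "c2 = (1 / (2 ^ k * 2 * real k * real k)) ^ k / 4 ^ (k + 1)"
  define c3 where "c3 = 1 / (2 ^ k * 4 * real k)"
  define c where "c = c2 powr p * c1 * c3 ^ (m * l)"
  have c23: "0 < c2" "0 < c3"
    using k by (auto simp: c2_def c3_def)
  have c0: "0 < c"
    using c23 c1 by (simp add: c_def)
  have bound: "c * A ^ l * \<delta> powr (real (k * k) * p + real (k * (m * l))) \<le> E * r powr (p - real (m * l))"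
    if n: "m \<le> n" and S: "compact S" "S \<subseteq> Rn n" and A: "0 < A"
      and ahl: "\<forall>y\<in>S. \<forall>s. 0 < s \<and> s \<le> R \<longrightarrow> ennreal (A * s ^ m) \<le> hausdorff_outer (real m) (S \<inter> ball y s)"
      and E: "energy m p l S \<le> ennreal E" "0 \<le> E" and x: "x \<in> S" and r: "0 < r" "r \<le> 2 * R"
      and \<delta>: "0 < \<delta>" "\<delta> \<le> 1" and not_flat: "\<not> has_flat_plane n m S x r \<delta>"
    for n S A R E x r \<delta>
  proof -
    define \<sigma> where "\<sigma> = r * (\<delta> / 2) ^ k"
    \<comment> \<open>Moving both ends of an edge by \<open>\<tau>\<close> changes the edge by at
      most \<open>2 * \<tau> = \<sigma> / (2 * k)\<close>, the tolerance of
      \<open>nondegenerate_perturbation\<close>.\<close>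
    define \<tau> where "\<tau> = \<sigma> / (4 * real k)"
    have \<sigma>: "0 < \<sigma>" "\<sigma> \<le> r"
    proof -
      have "(\<delta> / 2) ^ k \<le> 1"
        using \<delta> by (intro power_le_one) auto
      then show "\<sigma> \<le> r"
        using r mult_left_mono[of "(\<delta> / 2) ^ k" 1 r] by (simp add: \<sigma>_def)
    qed (use r \<delta> in \<open>simp add: \<sigma>_def\<close>)
    have \<tau>: "0 < \<tau>" "\<tau> \<le> r / 2" "\<tau> \<le> R"
    proof -
      show "0 < \<tau>"
        using \<sigma> k by (simp add: \<tau>_def)
      have "\<tau> \<le> \<sigma> / 2"
        unfolding \<tau>_def using \<sigma> k by (intro divide_left_mono) auto
      then show "\<tau> \<le> r / 2"
        using \<sigma> by simp
      then show "\<tau> \<le> R"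
        using r by simp
    qed
    have "\<exists>v. (\<forall>i<k. v i \<in> (\<lambda>z. z - x) ` S \<and> norm (v i) \<le> r) \<and>
      (\<forall>u. \<forall>i<k. r * (\<delta> / 2) ^ k * \<bar>u i\<bar> \<le> norm (\<Sum>j<k. u j *\<^sub>R v j))"
    proof (rule nondegenerate_vectors_exist[OF n _ r(1) \<delta>])
      show "(\<lambda>z. z - x) ` S \<subseteq> Rn n"
        using S(2) x by (auto intro!: subspace_diff[OF subspace_Rn])
      show "k \<le> m + 1"
        by (simp add: k_def)
      fix e :: "nat \<Rightarrow> real finseq" assume "orthonormal m e" "\<forall>i<m. e i \<in> Rn n"
      then have "\<not> flat m S e x r \<delta>"
        using not_flat by (auto simp: has_flat_plane_def)
      then show "\<exists>z\<in>(\<lambda>z. z - x) ` S. norm z \<le> r \<and> \<delta> * r < norm (perp m e z)"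
        by (force simp: flat_def not_le)
    qed
    then obtain v where v: "\<And>i. i < k \<Longrightarrow> v i \<in> (\<lambda>z. z - x) ` S" "\<And>i. i < k \<Longrightarrow> norm (v i) \<le> r"
      and nd: "\<And>u i. i < k \<Longrightarrow> \<sigma> * \<bar>u i\<bar> \<le> norm (\<Sum>j<k. u j *\<^sub>R v j)"
      unfolding \<sigma>_def by blast
    define z where "z i = (case i of 0 \<Rightarrow> x | Suc j \<Rightarrow> x + v j)" for i
    have z: "z i \<in> S" "dist x (z i) \<le> r" if "i \<le> k" for i
    proof -
      show "z i \<in> S"
      proof (cases i)
        case (Suc j)
        then have "v j \<in> (\<lambda>z. z - x) ` S"
          using that v(1) by simp
        then show ?thesis
          using Suc by (auto simp: z_def)
      qed (use x in \<open>simp add: z_def\<close>)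
      show "dist x (z i) \<le> r"
        using that r v(2) by (cases i) (auto simp: z_def dist_norm)
    qed
    define B where "B i = S \<inter> cball (z i) \<tau>" for i
    have B: "compact (B i)" "ennreal (A * \<tau> ^ m) \<le> hausdorff_outer (real m) (B i)" if "i < l" for i
    proof -
      show "compact (B i)"
        unfolding B_def using S(1) by (intro compact_Int_closed) auto
      \<comment> \<open>In the extreme case \<open>l = m + 2\<close> all vertices are integrated,
        including the last one with index \<open>k = m + 1\<close>.\<close>
      have "i \<le> k"
        using that l by (auto simp: k_def)
      then have "ennreal (A * \<tau> ^ m) \<le> hausdorff_outer (real m) (S \<inter> ball (z i) \<tau>)"
        using ahl z(1) \<tau> by blast
      also have "\<dots> \<le> hausdorff_outer (real m) (B i)"
        unfolding B_def by (intro hausdorff_outer_mono) auto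
      finally show "ennreal (A * \<tau> ^ m) \<le> hausdorff_outer (real m) (B i)" .
    qed
    define W where "W = product_set l B"
    have W_outer: "ennreal (c1 * (A * \<tau> ^ m) ^ l) \<le> hausdorff_outer (real (m * l)) W"
      unfolding W_def using A \<tau> B by (intro c1(2)) auto
    define K where "K = (\<sigma> / 2 / (real k * real k)) ^ k / (4 * r) ^ (k + 1)"
    have K0: "0 \<le> K"
      using \<sigma> r by (simp add: K_def)
    have "ennreal (K powr p) * hausdorff_outer (real (m * l)) W \<le> energy m p l S"
    proof (rule energy_ge)
      show "closed W"
        unfolding W_def using B(1) compact_imp_closed by (intro closed_product_set) auto
      show "W \<subseteq> finpower l S"
        by (auto simp: W_def product_set_def finpower_def B_def)
      show "z i \<in> S" if "i \<in> {l..m + 1}" for i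
        using that z by (auto simp: k_def)
      fix y assume y: "y \<in> W"
      define q where "q i = (if i < l then coord y i else z i)" for i
      have q: "dist (z i) (q i) \<le> \<tau>" for i
        using y \<tau> by (auto simp: q_def W_def product_set_def B_def)
      have "(\<sigma> / 2 / (real (m + 1) * real (m + 1))) ^ (m + 1) / (4 * r) ^ (m + 2) \<le> curvK m q"
      proof (rule curvK_ge)
        show "\<sigma> / 2 * \<bar>u i\<bar> \<le> norm (\<Sum>j<m + 1. u j *\<^sub>R (q (Suc j) - q 0))" if "i < m + 1" for u i
          unfolding k_def[symmetric]
        proof (rule nondegenerate_perturbation[OF nd _ \<sigma>(1)])
          fix j assume "j < k"
          have "q (Suc j) - q 0 - v j = (q (Suc j) - z (Suc j)) - (q 0 - z 0)"
            by (simp add: z_def)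
          then have "norm (q (Suc j) - q 0 - v j) = norm ((q (Suc j) - z (Suc j)) - (q 0 - z 0))"
            by (rule arg_cong)
          also have "\<dots> \<le> \<tau> + \<tau>"
            using q[of "Suc j"] q[of 0] norm_triangle_ineq4[of "q (Suc j) - z (Suc j)" "q 0 - z 0"]
            by (simp add: dist_norm norm_minus_commute)
          also have "\<dots> = \<sigma> / (2 * real k)"
            by (simp add: \<tau>_def)
          finally show "norm (q (Suc j) - q 0 - v j) \<le> \<sigma> / (2 * real k)" .
        qed (use that in \<open>simp_all add: k_def\<close>)
        fix i j assume "i \<le> m + 1" "j \<le> m + 1"
        then have "dist x (z i) \<le> r" "dist x (z j) \<le> r"
          using z by (auto simp: k_def)
        moreover have "dist (q i) (q j) \<le> dist (z i) (q i) + dist x (z i) + dist x (z j) + dist (z j) (q j)"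
          by metric
        ultimately show "dist (q i) (q j) \<le> 4 * r"
          using q[of i] q[of j] \<tau> by linarith
      qed (use \<sigma> in simp)
      then show "K \<le> curvK m (\<lambda>i. if i < l then coord y i else z i)"
        by (simp add: K_def q_def[abs_def] k_def)
    qed (use K0 p in auto)
    moreover have "ennreal (K powr p) * ennreal (c1 * (A * \<tau> ^ m) ^ l)
        \<le> ennreal (K powr p) * hausdorff_outer (real (m * l)) W"
      using W_outer by (rule mult_left_mono) simp
    ultimately have "ennreal (K powr p) * ennreal (c1 * (A * \<tau> ^ m) ^ l) \<le> ennreal E"
      using E(1) by (meson order_trans)
    then have main: "K powr p * (c1 * (A * \<tau> ^ m) ^ l) \<le> E"
      using E(2) A \<tau> c1 by (simp flip: ennreal_mult)
    have K_eq: "K = c2 * \<delta> ^ (k * k) / r"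
    proof -
      have "K = (r * \<delta> ^ k * (1 / (2 ^ k * 2 * real k * real k))) ^ k / (4 * r) ^ (k + 1)"
        by (simp add: K_def \<sigma>_def power_divide mult_ac)
      also have "\<dots> = (r ^ k * \<delta> ^ (k * k) * (1 / (2 ^ k * 2 * real k * real k)) ^ k) / (4 ^ (k + 1) * r ^ (k + 1))"
        by (simp only: power_mult_distrib power_mult[symmetric])
      also have "\<dots> = c2 * \<delta> ^ (k * k) / r"
        unfolding c2_def using r by (simp add: field_simps)
      finally show ?thesis .
    qed
    have Kp: "K powr p = c2 powr p * \<delta> powr (real (k * k) * p) / r powr p"
      unfolding K_eq using c23 \<delta> r
      by (simp add: powr_divide powr_mult powr_powr flip: powr_realpow)
    have \<tau>_eq: "\<tau> = c3 * (r * \<delta> ^ k)"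
      by (simp add: \<tau>_def \<sigma>_def c3_def power_divide)
    have "(A * \<tau> ^ m) ^ l = A ^ l * \<tau> ^ (m * l)"
      by (simp only: power_mult_distrib power_mult)
    also have "\<tau> ^ (m * l) = c3 ^ (m * l) * (r ^ (m * l) * \<delta> ^ (k * (m * l)))"
      unfolding \<tau>_eq by (simp only: power_mult_distrib power_mult)
    also have "r ^ (m * l) = r powr real (m * l)"
      using r by (simp only: powr_realpow)
    also have "\<delta> ^ (k * (m * l)) = \<delta> powr real (k * (m * l))"
      using \<delta> by (simp only: powr_realpow)
    finally have "K powr p * (c1 * (A * \<tau> ^ m) ^ l) =
        c2 powr p * \<delta> powr (real (k * k) * p) / r powr p *
        (c1 * (A ^ l * (c3 ^ (m * l) * (r powr real (m * l) * \<delta> powr real (k * (m * l))))))"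
      by (simp only: Kp)
    also have "\<dots> = c * A ^ l * (\<delta> powr (real (k * k) * p) * \<delta> powr real (k * (m * l))) * (r powr real (m * l) / r powr p)"
      unfolding c_def by (simp only: times_divide_eq_left times_divide_eq_right mult_ac)
    finally have "c * A ^ l * \<delta> powr (real (k * k) * p + real (k * (m * l))) * (r powr real (m * l) / r powr p) \<le> E"
      using main by (simp only: powr_add)
    then have "c * A ^ l * \<delta> powr (real (k * k) * p + real (k * (m * l))) * (r powr real (m * l) / r powr p)
        * r powr (p - real (m * l)) \<le> E * r powr (p - real (m * l))"
      by (rule mult_right_mono) simp
    moreover have "r powr real (m * l) / r powr p * r powr (p - real (m * l)) = 1"
      using r by (simp add: powr_diff)
    ultimately show ?thesis
      by (simp only: mult.assoc mult_1_right)
  qed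
  show thesis
    by (rule that[OF c0 bound[unfolded k_def]])
qed

section \<open>Flatness numbers of fine sets\<close>

lemma full_mono: "full m S e x r d \<Longrightarrow> d \<le> d' \<Longrightarrow> 0 \<le> r \<Longrightarrow> full m S e x r d'"
  unfolding full_def by (meson mult_right_mono order_trans)

lemma beta_number_le:
  assumes e: "orthonormal m e" "\<forall>i<m. e i \<in> Rn n" and x: "x \<in> S" and r: "0 < r" and flat: "flat m S e x r \<delta>"
  shows "beta_number n m S x r \<le> \<delta>"
proof -
  define f where "f H = (SUP z\<in>S \<inter> cball x r. infdist z ((+) x ` H))" for H
  have x_in: "x \<in> S \<inter> cball x r"
    using x r by simp
  \<comment> \<open>Real infima and suprema require bounded families. The point \<open>x\<close>
    lies in \<open>S\<close> and in every translated plane, so each distance in the ball is at most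
    \<open>r\<close> and each supremum is at least 0.\<close>
  have f0: "0 \<le> f H" if "H \<in> grassmannian n m" for H
  proof -
    have "x \<in> (+) x ` H"
      using that subspace_0[of H] by (auto simp: grassmannian_def image_iff intro!: bexI[of _ 0])
    then have "infdist z ((+) x ` H) \<le> dist x z" for z
      using infdist_le[of x "(+) x ` H" z] by (simp add: dist_commute)
    then have "bdd_above ((\<lambda>z. infdist z ((+) x ` H)) ` (S \<inter> cball x r))"
      by (intro bdd_aboveI2[of _ _ r]) (auto intro: order_trans)
    then have "infdist x ((+) x ` H) \<le> f H"
      unfolding f_def using x_in by (intro cSUP_upper)
    then show ?thesis
      using infdist_nonneg order_trans by blast
  qed
  have "(INF H\<in>grassmannian n m. f H) \<le> f (plane m e)"
    using f0 grassmannian_plane[OF e] by (intro cINF_lower bdd_belowI2[of _ 0])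
  also have "\<dots> \<le> \<delta> * r"
    unfolding f_def
  proof (rule cSUP_least)
    show "S \<inter> cball x r \<noteq> {}"
      using x_in by blast
    fix z assume z: "z \<in> S \<inter> cball x r"
    have "infdist z ((+) x ` plane m e) \<le> dist z (x + oproj m e (z - x))"
      using oproj_in_plane by (intro infdist_le) blast
    also have "\<dots> = norm (perp m e (z - x))"
      by (simp add: dist_norm perp_def algebra_simps)
    also have "\<dots> \<le> \<delta> * r"
      using flat z by (auto simp: flat_def dist_norm norm_minus_commute)
    finally show "infdist z ((+) x ` plane m e) \<le> \<delta> * r" .
  qed
  finally show ?thesis
    using r by (simp add: beta_number_def f_def[abs_def] field_simps)
qed

text \<open>The strict bound yields a plane even if the infimum is not attained. Both one-sided
  distances are nonnegative, so each is bounded by their sum: one gives flatness, the other fullness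
  with the approximating point inside the closed ball.\<close>

lemma flat_full_of_theta_number:
  assumes m: "1 \<le> m" "m \<le> n" and x: "x \<in> S" and r: "0 < r" and \<theta>: "theta_number n m S x r < \<delta>"
  shows "\<exists>e. orthonormal m e \<and> (\<forall>i<m. e i \<in> Rn n) \<and> flat m S e x r \<delta> \<and> full m S e x r \<delta>"
proof -
  obtain e0 :: "nat \<Rightarrow> real finseq" where "orthonormal m e0" "\<forall>i<m. e0 i \<in> Rn n"
    using orthonormal_extend_to[of 0 m n "\<lambda>_. 0"] m(2) by (auto simp: orthonormal_def)
  then have "grassmannian n m \<noteq> {}"
    using grassmannian_plane by blast
  moreover have "(INF H\<in>grassmannian n m. hausdorff_dist (S \<inter> cball x r) (((+) x ` H) \<inter> cball x r)) < \<delta> * r"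
    using \<theta> r by (simp add: theta_number_def field_simps)
  ultimately obtain H where H: "H \<in> grassmannian n m"
    "hausdorff_dist (S \<inter> cball x r) (((+) x ` H) \<inter> cball x r) < \<delta> * r"
    using cInf_lessD[of "(\<lambda>H. hausdorff_dist (S \<inter> cball x r) (((+) x ` H) \<inter> cball x r)) ` grassmannian n m" "\<delta> * r"]
    by auto
  obtain e where e: "orthonormal m e" "\<forall>i<m. e i \<in> Rn n" "plane m e = H"
    using grassmannian_orthonormal[OF m(1) H(1)] by blast
  define A where "A = S \<inter> cball x r"
  define F where "F = ((+) x ` plane m e) \<inter> cball x r"
  have xA: "x \<in> A"
    using x r by (simp add: A_def)
  have xF: "x \<in> F"
    using r zero_in_plane[of m e] by (auto simp: F_def image_iff intro!: bexI[of _ 0])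
  have sup: "(SUP y\<in>X. infdist y Y) \<ge> infdist y Y" "(SUP y\<in>X. infdist y Y) \<ge> 0"
    if "X \<subseteq> cball x r" "x \<in> Y" "x \<in> X" "y \<in> X" for X Y y
  proof -
    have "infdist y Y \<le> r" if "y \<in> X" for y
      using infdist_le[OF \<open>x \<in> Y\<close>, of y] that \<open>X \<subseteq> cball x r\<close> by (auto simp: dist_commute)
    then have bdd: "bdd_above ((\<lambda>y. infdist y Y) ` X)"
      by (intro bdd_aboveI2[of _ _ r])
    show "(SUP y\<in>X. infdist y Y) \<ge> infdist y Y"
      using bdd that(4) by (intro cSUP_upper)
    then show "(SUP y\<in>X. infdist y Y) \<ge> 0"
      using infdist_nonneg order_trans by blast
  qed
  have AF: "A \<subseteq> cball x r" "F \<subseteq> cball x r"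
    by (auto simp: A_def F_def)
  have hd: "(SUP y\<in>A. infdist y F) + (SUP y\<in>F. infdist y A) < \<delta> * r"
    using H(2) by (simp add: hausdorff_dist_def A_def F_def e(3))
  have A_near: "infdist y F < \<delta> * r" if "y \<in> A" for y
    using hd sup(1)[OF AF(1) xF xA that] sup(2)[OF AF(2) xA xF xF] by linarith
  have F_near: "infdist y A < \<delta> * r" if "y \<in> F" for y
    using hd sup(1)[OF AF(2) xA xF that] sup(2)[OF AF(1) xF xA xA] by linarith
  have close: "\<exists>z\<in>Y. dist y z < \<delta> * r" if "infdist y Y < \<delta> * r" "Y \<noteq> {}" for y Y
    using that cInf_lessD[of "dist y ` Y" "\<delta> * r"] by (auto simp: infdist_notempty)
  have "flat m S e x r \<delta>"
    unfolding flat_def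
  proof (intro ballI impI)
    fix z assume "z \<in> S" "norm (z - x) \<le> r"
    then have "z \<in> A"
      by (simp add: A_def dist_norm norm_minus_commute)
    then obtain f where f: "f \<in> F" "dist z f < \<delta> * r"
      using close[OF A_near] xF by blast
    then obtain h where h: "h \<in> plane m e" "f = x + h"
      by (auto simp: F_def)
    have "norm (perp m e (z - x)) \<le> norm (z - x - h)"
      by (rule norm_perp_le_dist[OF e(1) h(1)])
    also have "\<dots> = dist z f"
      by (simp add: dist_norm h(2) algebra_simps)
    finally show "norm (perp m e (z - x)) \<le> \<delta> * r"
      using f(2) by simp
  qed
  moreover have "full m S e x r \<delta>"
    unfolding full_def
  proof (intro ballI impI)
    fix w assume "w \<in> plane m e" "norm w \<le> r"
    then have "x + w \<in> F"
      by (auto simp: F_def dist_norm)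
    then obtain z where "z \<in> A" "dist (x + w) z < \<delta> * r"
      using close[OF F_near] xA by blast
    then show "\<exists>z\<in>S. norm (z - x) \<le> r \<and> norm (z - x - w) \<le> \<delta> * r"
      by (intro bexI[of _ z]) (auto simp: A_def dist_norm norm_minus_commute algebra_simps)
  qed
  ultimately show ?thesis
    using e by blast
qed

section \<open>Bootstrapping to a universal scale\<close>

definition reifenberg_flat :: "nat \<Rightarrow> nat \<Rightarrow> real finseq set \<Rightarrow> real \<Rightarrow> real \<Rightarrow> real \<Rightarrow> bool"
  where "reifenberg_flat n m S \<kappa> C R \<longleftrightarrow> (\<forall>x\<in>S. \<forall>r. 0 < r \<and> r \<le> R \<longrightarrow>
    (\<exists>e. orthonormal m e \<and> (\<forall>i<m. e i \<in> Rn n) \<and> flat m S e x r (C * r powr \<kappa>) \<and> full m S e x r (1 / 16)))"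

lemma reifenberg_flat_field:
  assumes "reifenberg_flat n m S \<kappa> C R" "0 < \<kappa>" "0 \<le> C" "0 < R" "C * R powr \<kappa> \<le> flatness_threshold \<kappa>" "compact S"
  shows "\<exists>e. flat_field m S e R C \<kappa>"
proof -
  have "\<forall>x r. \<exists>e. x \<in> S \<and> 0 < r \<and> r \<le> R \<longrightarrow>
      orthonormal m e \<and> flat m S e x r (C * r powr \<kappa>) \<and> full m S e x r (1 / 16)"
    using assms(1) unfolding reifenberg_flat_def by blast
  then obtain e where "\<And>x r. x \<in> S \<Longrightarrow> 0 < r \<Longrightarrow> r \<le> R \<Longrightarrow>
      orthonormal m (e x r) \<and> flat m S (e x r) x r (C * r powr \<kappa>) \<and> full m S (e x r) x r (1 / 16)"
    by metis
  then have "flat_field m S e R C \<kappa>"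
    using assms by unfold_locales auto
  then show ?thesis
    by (rule exI[of _ e])
qed

text \<open>The exponents are chosen so that a set without a \<open>\<delta>\<close>-flat plane at scale \<open>r\<close> violates the
  energy bound as soon as \<open>\<delta>\<close> is this power of \<open>r\<close>; the summand \<open>1\<close> makes the violation strict.\<close>

definition flat_constant :: "real \<Rightarrow> real \<Rightarrow> nat \<Rightarrow> real \<Rightarrow> real \<Rightarrow> real"
  where "flat_constant c N l E A = ((E + 1) / (c * A ^ l)) powr (1 / N)"

lemma has_flat_plane_of_energy:
  assumes c: "0 < c" and N: "0 < N" and E: "0 \<le> E" and A: "0 < A" and r: "0 < r"
    and le: "flat_constant c N l E A * r powr (q / N) \<le> 1"
    and bound: "\<And>\<delta>. 0 < \<delta> \<Longrightarrow> \<delta> \<le> 1 \<Longrightarrow> \<not> has_flat_plane n m S x r \<delta> \<Longrightarrow>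
      c * A ^ l * \<delta> powr N \<le> E * r powr q"
  shows "has_flat_plane n m S x r (flat_constant c N l E A * r powr (q / N))"
proof (rule ccontr)
  let ?C = "flat_constant c N l E A"
  have X: "0 < (E + 1) / (c * A ^ l)"
    using c A E by simp
  have C: "0 < ?C"
    using X unfolding flat_constant_def by (simp only: powr_gt_zero)
  assume "\<not> ?thesis"
  then have "c * A ^ l * (?C * r powr (q / N)) powr N \<le> E * r powr q"
    using C r le by (intro bound) auto
  also have "(?C * r powr (q / N)) powr N = (E + 1) / (c * A ^ l) * r powr q"
  proof -
    have "1 / N * N = 1"
      using N by simp
    then have "?C powr N = (E + 1) / (c * A ^ l)"
      unfolding flat_constant_def powr_powr by (simp only: powr_one[OF less_imp_le[OF X]])
    moreover have "(r powr (q / N)) powr N = r powr q"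
      using N by (simp add: powr_powr)
    ultimately show ?thesis
      using C r by (simp only: powr_mult)
  qed
  also have "c * A ^ l * ((E + 1) / (c * A ^ l) * r powr q) = (E + 1) * r powr q"
    using c A by simp
  finally have "r powr q \<le> 0"
    by (simp add: distrib_right)
  then show False
    using r by simp
qed

theorem theorem2:
  fixes m l :: nat and p E :: real
  assumes "1 \<le> m" and "l \<in> {1..m + 2}" and "p > real (m * l)" and "0 \<le> E"
  shows "\<exists>R0>0. \<forall>n\<ge>m. \<forall>\<Sigma>. m_fine n m \<Sigma> \<and> energy m p l \<Sigma> \<le> ennreal E \<longrightarrow>
    (\<forall>x\<in>\<Sigma>. \<forall>r. 0 < r \<and> r \<le> R0 \<longrightarrow>
       hausdorff_outer (real m) (\<Sigma> \<inter> ball x r)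
         \<ge> ennreal ((sqrt 15 / 4) ^ m * unit_ball_vol (real m) * r ^ m))"
proof -
  define N where "N = real ((m + 1) * (m + 1)) * p + real ((m + 1) * (m * l))"
  define q where "q = p - real (m * l)"
  \<comment> \<open>Balancing \<open>\<delta> powr N\<close> against \<open>r powr q\<close> makes
    \<open>\<delta>\<close> a multiple of \<open>r powr (q / N)\<close>.\<close>
  define \<kappa> where "\<kappa> = q / N"
  define \<eta> where "\<eta> = flatness_threshold \<kappa>"
  define a where "a = (sqrt 15 / 4) ^ m * unit_ball_vol (real m)"
  have p: "0 < p"
    using assms(3) by (simp add: le_less_trans[of 0 "real (m * l)"])
  have N: "0 < N"
  proof -
    have "0 < real ((m + 1) * (m + 1))"
      by (simp only: of_nat_0_less_iff) simp
    then show ?thesis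
      unfolding N_def using p by (intro add_pos_nonneg mult_pos_pos) auto
  qed
  have \<kappa>: "0 < \<kappa>"
    unfolding \<kappa>_def q_def using N assms(3) by simp
  have \<eta>: "0 < \<eta>" "\<eta> \<le> 1 / 8192"
    using flatness_threshold_pos[OF \<kappa>] by (auto simp: \<eta>_def flatness_threshold_def)
  have a: "0 < a"
    by (simp add: a_def)
  obtain c where c: "0 < c" and bound: "\<And>n S A R E x r \<delta>. \<lbrakk>m \<le> n; compact S; S \<subseteq> Rn n; 0 < A;
      \<forall>y\<in>S. \<forall>s. 0 < s \<and> s \<le> R \<longrightarrow> ennreal (A * s ^ m) \<le> hausdorff_outer (real m) (S \<inter> ball y s);
      energy m p l S \<le> ennreal E; 0 \<le> E; x \<in> S; 0 < r; r \<le> 2 * R; 0 < \<delta>; \<delta> \<le> 1;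
      \<not> has_flat_plane n m S x r \<delta>\<rbrakk> \<Longrightarrow> c * A ^ l * \<delta> powr N \<le> E * r powr q"
    unfolding N_def q_def
  proof (rule energy_ge_of_not_flat[OF assms(1,2) p], goal_cases)
    case (1 c)
    show ?thesis
      by (rule 1(1)[OF 1(2,3)])
  qed
  define C where "C A = flat_constant c N l E A" for A
  have C: "0 < C A" if "0 < A" for A
    using that c assms(4) by (simp add: C_def flat_constant_def)
  \<comment> \<open>At this radius \<open>C a * R0 powr \<kappa>\<close> equals
    \<open>\<eta>\<close>. The Ahlfors constant in \<open>C a\<close> is the constant of the claim
    itself, so \<open>R0\<close> is determined by \<open>m\<close>, \<open>l\<close>,
    \<open>p\<close> and \<open>E\<close>.\<close>
  define R0 where "R0 = (\<eta> / C a) powr (1 / \<kappa>)"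
  have R0: "0 < R0"
    using \<eta> C[OF a] by (simp add: R0_def)
  have C_le: "D * r powr \<kappa> \<le> \<eta>" if "0 < r" "0 < D" "r \<le> (\<eta> / D) powr (1 / \<kappa>)" for D r
  proof -
    have "r powr \<kappa> \<le> ((\<eta> / D) powr (1 / \<kappa>)) powr \<kappa>"
      using that \<kappa> by (intro powr_mono2) auto
    also have "\<dots> = \<eta> / D"
      using \<kappa> \<eta> that by (simp add: powr_powr)
    finally show ?thesis
      using that by (simp add: field_simps)
  qed
  have "ennreal (a * r ^ m) \<le> hausdorff_outer (real m) (S \<inter> ball x r)"
    if n: "m \<le> n" and fine: "m_fine n m S" and energy: "energy m p l S \<le> ennreal E"
      and x: "x \<in> S" and r: "0 < r" "r \<le> R0" for n S x r
  proof -
    have S: "S \<subseteq> Rn n" "compact S"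
      using fine by (auto simp: m_fine_def)
    have flat_plane: "has_flat_plane n m S x r (C A * r powr \<kappa>)"
      if "0 < A" "\<forall>y\<in>S. \<forall>s. 0 < s \<and> s \<le> R \<longrightarrow> ennreal (A * s ^ m) \<le> hausdorff_outer (real m) (S \<inter> ball y s)"
        "x \<in> S" "0 < r" "r \<le> 2 * R" "C A * r powr \<kappa> \<le> 1" for A R x r
      unfolding C_def \<kappa>_def
    proof (rule has_flat_plane_of_energy[OF c N assms(4) that(1,4)])
      show "flat_constant c N l E A * r powr (q / N) \<le> 1"
        using that(6) by (simp add: C_def \<kappa>_def)
      fix \<delta> :: real assume "0 < \<delta>" "\<delta> \<le> 1" "\<not> has_flat_plane n m S x r \<delta>"
      then show "c * A ^ l * \<delta> powr N \<le> E * r powr q"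
        by (rule bound[OF n S(2,1) that(1,2) energy assms(4) that(3-5)])
    qed
    have ahlfors: "ennreal (a * s ^ m) \<le> hausdorff_outer (real m) (S \<inter> ball y s)"
      if G: "reifenberg_flat n m S \<kappa> D R" "0 < D" "0 < R" "D * R powr \<kappa> \<le> \<eta>" and y: "y \<in> S" and s: "0 < s" "s \<le> R"
      for D R y s
    proof -
      obtain e where "flat_field m S e R D \<kappa>"
        using reifenberg_flat_field[OF G(1) \<kappa> _ G(3) G(4)[unfolded \<eta>_def] S(2)] G(2) by auto
      from hausdorff_ball_ge[OF this assms(1) y s] show ?thesis
        by (simp add: a_def)
    qed
    \<comment> \<open>The old constant \<open>D\<close> matters only through smallness at the scale
      \<open>R\<close>: it gives the Ahlfors constant \<open>a\<close>, which in turn gives flatness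
      with \<open>C a\<close> up to \<open>2 * R\<close>. Fullness, available up to
      \<open>33 / 32 * R\<close>, limits the gain.\<close>
    have step: "reifenberg_flat n m S \<kappa> (C a) R'"
      if G: "reifenberg_flat n m S \<kappa> D R" "0 < D" "0 < R" "D * R powr \<kappa> \<le> \<eta>" and R': "R' \<le> 33 / 32 * R" "R' \<le> R0"
      for D R R'
      unfolding reifenberg_flat_def
    proof (intro ballI allI impI)
      fix y s assume y: "y \<in> S" and s: "0 < s \<and> s \<le> R'"
      obtain e where ff: "flat_field m S e R D \<kappa>"
        using reifenberg_flat_field[OF G(1) \<kappa> _ G(3) G(4)[unfolded \<eta>_def] S(2)] G(2) by auto
      have Cs: "C a * s powr \<kappa> \<le> \<eta>"
        using s R' C[OF a] by (intro C_le) (auto simp: R0_def)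
      have "has_flat_plane n m S y s (C a * s powr \<kappa>)"
        using ahlfors[OF G] s R' Cs \<eta> by (intro flat_plane[OF a _ y, of R]) auto
      then obtain e' where e': "orthonormal m e'" "\<forall>i<m. e' i \<in> Rn n" "flat m S e' y s (C a * s powr \<kappa>)"
        by (auto simp: has_flat_plane_def)
      have "full m S e' y s (1 / 16)"
        using y s R' e' Cs \<eta> C[OF a] by (intro flat_field.full_of_flat[OF ff, where \<delta> = "C a * s powr \<kappa>"]) auto
      then show "\<exists>e. orthonormal m e \<and> (\<forall>i<m. e i \<in> Rn n) \<and> flat m S e y s (C a * s powr \<kappa>) \<and> full m S e y s (1 / 16)"
        using e' by blast
    qed
    obtain RA A where A: "0 < RA" "0 < A"
      "\<forall>y\<in>S. \<forall>s. 0 < s \<and> s \<le> RA \<longrightarrow> ennreal (A * s ^ m) \<le> hausdorff_outer (real m) (S \<inter> ball y s)"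
      using fine unfolding m_fine_def by blast
    obtain R\<theta> M where M: "0 < R\<theta>" "1 < M"
      "\<And>y s. y \<in> S \<Longrightarrow> 0 < s \<Longrightarrow> s \<le> R\<theta> \<Longrightarrow> theta_number n m S y s \<le> M * beta_number n m S y s"
      using fine unfolding m_fine_def by blast
    \<comment> \<open>\<open>M\<close> leads from the beta number to the theta number, and the
      factor 2 makes the bound strict, as the extraction of a plane requires.\<close>
    define D where "D = 2 * M * C A"
    have D: "0 < D"
      using M C[OF A(2)] by (simp add: D_def)
    define R1 where "R1 = min (min RA R\<theta>) ((\<eta> / D) powr (1 / \<kappa>))"
    have R1: "0 < R1" "R1 \<le> RA" "R1 \<le> R\<theta>" "R1 \<le> (\<eta> / D) powr (1 / \<kappa>)"
      using A M \<eta> D by (auto simp: R1_def)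
    have initial: "reifenberg_flat n m S \<kappa> D R1"
      unfolding reifenberg_flat_def
    proof (intro ballI allI impI)
      fix y s assume y: "y \<in> S" and s: "0 < s \<and> s \<le> R1"
      have Ds: "D * s powr \<kappa> \<le> \<eta>"
        using s R1 D by (intro C_le) auto
      have CA0: "0 < C A * s powr \<kappa>"
        using C[OF A(2)] s by simp
      have Ds': "D * s powr \<kappa> = 2 * M * (C A * s powr \<kappa>)"
        by (simp add: D_def)
      have "1 * (C A * s powr \<kappa>) \<le> 2 * M * (C A * s powr \<kappa>)"
        using CA0 M by (intro mult_right_mono) auto
      then have CAs: "C A * s powr \<kappa> \<le> 1"
        using Ds Ds' \<eta> by linarith
      obtain e where e: "orthonormal m e" "\<forall>i<m. e i \<in> Rn n" "flat m S e y s (C A * s powr \<kappa>)"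
        using flat_plane[OF A(2,3) y _ _ CAs] s R1 by (auto simp: has_flat_plane_def)
      have "theta_number n m S y s \<le> M * beta_number n m S y s"
        using M(3) y s R1 by auto
      also have "\<dots> \<le> M * (C A * s powr \<kappa>)"
        using M beta_number_le[OF e(1,2) y _ e(3)] s by (intro mult_left_mono) auto
      also have "\<dots> < D * s powr \<kappa>"
        unfolding Ds' using M CA0 by simp
      finally obtain e' where e': "orthonormal m e'" "\<forall>i<m. e' i \<in> Rn n"
        "flat m S e' y s (D * s powr \<kappa>)" "full m S e' y s (D * s powr \<kappa>)"
        using flat_full_of_theta_number[OF assms(1) n y] s by blast
      have "full m S e' y s (1 / 16)"
        using Ds \<eta> s by (intro full_mono[OF e'(4)]) auto
      then show "\<exists>e. orthonormal m e \<and> (\<forall>i<m. e i \<in> Rn n) \<and> flat m S e y s (D * s powr \<kappa>) \<and> full m S e y s (1 / 16)"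
        using e' by blast
    qed
    \<comment> \<open>Round 0 does not enlarge the scale but replaces \<open>D\<close> by
      \<open>C a\<close>. Each further round may gain the factor 33/32, until the minimum equals
      \<open>R0\<close>.\<close>
    have "reifenberg_flat n m S \<kappa> (C a) (min R0 ((33 / 32) ^ j * R1))" for j
    proof (induction j)
      case 0
      show ?case
        using R1 D by (intro step[OF initial D R1(1) C_le]) auto
    next
      case (Suc j)
      have "0 < min R0 ((33 / 32) ^ j * R1)"
        using R0 R1 by simp
      moreover have "C a * min R0 ((33 / 32) ^ j * R1) powr \<kappa> \<le> \<eta>"
        using calculation C[OF a] by (intro C_le) (auto simp: R0_def)
      moreover have "min R0 ((33 / 32) ^ Suc j * R1) \<le> 33 / 32 * min R0 ((33 / 32) ^ j * R1)"
        using R0 by (auto simp: min_def)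
      ultimately show ?case
        by (intro step[OF Suc.IH C[OF a]]) auto
    qed
    moreover obtain j where "R0 / R1 < (33 / 32) ^ j"
      using real_arch_pow[of "33 / 32" "R0 / R1"] by auto
    then have "min R0 ((33 / 32) ^ j * R1) = R0"
      using R1 by (simp add: field_simps min_def)
    ultimately have "reifenberg_flat n m S \<kappa> (C a) R0"
      by metis
    then show ?thesis
      using C[OF a] R0 x r by (intro ahlfors C_le) (auto simp: R0_def)
  qed
  then show ?thesis
    using R0 unfolding a_def by blast
qed

end
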